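(* Let $m>2$ be an integer and consider the $m$-th order partial differential equation for $u=u(x,t)$ $$P\Big(u,\frac{\partial u}{\partial x},\frac{\partial u}{\partial t},\frac{\partial^2u}{\partial x^2},\frac{\partial^2u}{\partial x\partial t},\frac{\partial^2u}{\partial t^2},\ldots,\frac{\partial^m u}{\partial x^m},\frac{\partial^m u}{\partial x^{m-1}\partial t},\ldots,\frac{\partial^m u}{\partial t^m},\varepsilon\Big)=0,\qquad( * )$$ where $\mathcal W\subset\mathbb R^{(m+1)(m+2)/2}$ is open, $\mathcal I\subset\mathbb R$ is an open interval containing $0$, $P:\mathcal W\times\mathcal I\to\mathbb R$ is a sufficiently smooth function and $\varepsilon$ is a small parameter. Assume that $( * )$ satisfies Property $\mathcal B$ (defined in the context) for some $c\in\mathbb R$ and $k\in\mathbb R$, where $\ell\ge1$ denotes the number of simple zeroes of the function $M_{c,k}$ appearing in that property. Then: (a) For $\varepsilon=0$ the equation $( * )$ has a continuum of periodic traveling wave solutions $u=U_{h,k}(x-ct)$, for $h$ in an open real interval. (b) For $\varepsilon$ small enough, the equation $( * )$ has at least $\ell$ periodic traveling wave solutions $u=U_{h_j,k}(x-ct,\varepsilon)$, $j=1,2,\ldots,\ell$.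
   Context: Traveling waves. A traveling wave solution of speed $c$ of $( * )$ is a solution $u(x,t)=U(x-ct)$ with $U(s)$ defined for all $s\in\mathbb R$; equivalently $U$ is a solution, defined for all $s$, of the $m$-th order ODE $$P_c(U,U',\ldots,U^{(m)},\varepsilon):=P\big(U,U',-cU',U'',-cU'',c^2U'',\ldots,U^{(m)},-cU^{(m)},\ldots,(-c)^mU^{(m)},\varepsilon\big)=0 .$$ It is periodic if $U$ is a (nonconstant) periodic function. Property $\mathcal B$. The equation $( * )$ satisfies Property $\mathcal B$ for $c,k\in\mathbb R$ if the following four conditions hold. (o) There exists a sufficiently smooth function $Q_c:\mathcal W_c\times\mathcal I\to\mathbb R$, with $\mathcal W_c\subset\mathbb R^3$ open, such that, for $U=U(s)$, $$\frac{d^{m-2}}{ds^{m-2}}\big(Q_c(U,U',U'',\varepsilon)\big)=P_c(U,U',U'',\ldots,U^{(m)},\varepsilon).$$ (i) There exist two $\mathcal C^1$ functions $f_{c,k}:\mathcal V_{c,k}(\varepsilon)\to\mathbb R$ and $g_{c,k}:\mathcal V_{c,k}(\varepsilon)\times\mathcal I\to\mathbb R$, with $\mathcal V_{c,k}(\varepsilon)\subset\mathbb R^2$ and $\mathcal V_{c,k}(\varepsilon)\times\mathcal I\subset\mathbb R^3$ open sets ($f_{c,k}=f_{c,k}(x,y)$ does not depend on $\varepsilon$), such that, for $\varepsilon$ small enough, $$\{(x,y,z):(x,y)\in\mathcal V_{c,k}(\varepsilon),\ z=k+f_{c,k}(x,y)+\varepsilon g_{c,k}(x,y,\varepsilon)\}\subset\{(x,y,z)\in\mathcal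 W_c:Q_c(x,y,z,\varepsilon)=k\}.$$ Moreover, if $\mathcal V_{c,k}$ denotes the limit of the sets $\mathcal V_{c,k}(\varepsilon)$ when $\varepsilon\to0$, the only solution of $f_{c,k}(x,0)+k=0$ in $\mathcal V_{c,k}$ is $x=x_{c,k}$. (ii) There exists a $\mathcal C^2$ function $H_{c,k}:\mathcal V_{c,k}\to[0,\infty)$ such that $H_{c,k}(x_{c,k},0)=0$ and $$\frac{\partial H_{c,k}(x,y)}{\partial y}=\frac{y}{s_{c,k}(x,y)},\qquad\frac{\partial H_{c,k}(x,y)}{\partial x}=-\frac{f_{c,k}(x,y)+k}{s_{c,k}(x,y)},$$ for some $\mathcal C^1$ function $s_{c,k}:\mathcal V_{c,k}\to(0,\infty)$. (Notice that then $\frac{\partial}{\partial x}\big(\frac{y}{s_{c,k}}\big)+\frac{\partial}{\partial y}\big(\frac{f_{c,k}+k}{s_{c,k}}\big)\equiv0$.) (iii) For each $h\in(0,\overline h_{c,k})$, where $\overline h_{c,k}\in(0,\infty]$, the set $\gamma_{c,k}(h):=\{(x,y)\in\mathcal V_{c,k}:H_{c,k}(x,y)=h\}$ is a closed oval surrounding $(x_{c,k},0)$, and the function $M_{c,k}:(0,\overline h_{c,k})\to\mathbb R$ defined as the line integral $$M_{c,k}(h)=\int_{\gamma_{c,k}(h)}\frac{g_{c,k}(x,y,0)}{s_{c,k}(x,y)}\,dx$$ has $\ell\ge1$ simple zeroes in $(0,\overline h_{c,k})$. In (b), $h_1,\dots,h_\ell$ are these zeroes.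
   Formalization: For m≥4 it is additionally assumed that, for small ε, f+εg is C^{m-2} on V(ε) (with f, g only C^1 the waves need not be C^m and (a) can fail); the identity in (o) is read as including that the wave's derivatives lie in W. *)

theory Defs
  imports "HOL-Analysis.Analysis" "HOL-Library.Periodic_Fun"
begin

text \<open>\<open>Ck_on r f S\<close> is meant for open \<open>S\<close> only: all derivatives of \<open>f\<close> up to order \<open>r\<close> exist and are
  continuous on \<open>S\<close>.\<close>

fun Ck_on :: "nat \<Rightarrow> ('a::real_normed_vector \<Rightarrow> 'b::real_normed_vector) \<Rightarrow> 'a set \<Rightarrow> bool" where
  "Ck_on 0 f S \<longleftrightarrow> continuous_on S f"
| "Ck_on (Suc r) f S \<longleftrightarrow> (\<forall>x\<in>S. f differentiable (at x)) \<and>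
     (\<forall>v. Ck_on r (\<lambda>x. frechet_derivative f (at x) v) S)"

section \<open>The partial differential equation and its travelling waves\<close>

text \<open>The coordinates of the space containing \<open>\<W>\<close> are indexed by a finite type \<open>'n\<close>. The bijection
  \<open>\<iota>\<close> from \<open>'n\<close> onto the pairs \<open>(i, j)\<close> with \<open>i + j \<le> m\<close> tells which coordinate is the slot of
  \<open>\<partial>\<^sup>i\<^sup>+\<^sup>ju / \<partial>x\<^sup>i\<partial>t\<^sup>j\<close>; there are \<open>(m + 1)(m + 2) / 2\<close> such pairs.\<close>

definition derivative_slots :: "nat \<Rightarrow> ('n::finite \<Rightarrow> nat \<times> nat) \<Rightarrow> bool" where
  "derivative_slots m \<iota> \<longleftrightarrow> bij_betw \<iota> UNIV {(i, j). i + j \<le> m}"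

definition partial_xt :: "nat \<Rightarrow> nat \<Rightarrow> (real \<times> real \<Rightarrow> real) \<Rightarrow> real \<times> real \<Rightarrow> real" where
  "partial_xt i j u = (\<lambda>(x, t). (deriv ^^ i) (\<lambda>x'. (deriv ^^ j) (\<lambda>t'. u (x', t')) t) x)"

definition jet :: "('n::finite \<Rightarrow> nat \<times> nat) \<Rightarrow> (real \<times> real \<Rightarrow> real) \<Rightarrow> real \<times> real \<Rightarrow> real ^ 'n" where
  "jet \<iota> u p = (\<chi> n. partial_xt (fst (\<iota> n)) (snd (\<iota> n)) u p)"

definition pde_solution ::
  "nat \<Rightarrow> ('n::finite \<Rightarrow> nat \<times> nat) \<Rightarrow> (real ^ 'n) set \<Rightarrow> ((real ^ 'n) \<times> real \<Rightarrow> real) \<Rightarrow> real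
     \<Rightarrow> (real \<times> real \<Rightarrow> real) \<Rightarrow> bool" where
  "pde_solution m \<iota> W P \<epsilon> u \<longleftrightarrow>
     Ck_on m u UNIV \<and> (\<forall>p. jet \<iota> u p \<in> W \<and> P (jet \<iota> u p, \<epsilon>) = 0)"

definition periodic_travelling_wave ::
  "nat \<Rightarrow> ('n::finite \<Rightarrow> nat \<times> nat) \<Rightarrow> (real ^ 'n) set \<Rightarrow> ((real ^ 'n) \<times> real \<Rightarrow> real) \<Rightarrow> real \<Rightarrow> real
     \<Rightarrow> (real \<Rightarrow> real) \<Rightarrow> bool" where
  "periodic_travelling_wave m \<iota> W P c \<epsilon> U \<longleftrightarrow>
     pde_solution m \<iota> W P \<epsilon> (\<lambda>(x, t). U (x - c * t)) \<and>
     (\<exists>T>0. periodic_fun_simple U T) \<and> \<not> U constant_on UNIV"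

text \<open>Every periodic wave has a continuum of translates, so waves are counted up to translation.\<close>

definition translates :: "(real \<Rightarrow> real) \<Rightarrow> (real \<Rightarrow> real) \<Rightarrow> bool" where
  "translates U U' \<longleftrightarrow> (\<exists>\<tau>. \<forall>s. U' s = U (s + \<tau>))"

text \<open>\<open>wave_slots \<iota> c z\<close> fills the slot of \<open>\<partial>\<^sup>i\<^sup>+\<^sup>ju / \<partial>x\<^sup>i\<partial>t\<^sup>j\<close> with \<open>(-c)\<^sup>j z\<^sub>i\<^sub>+\<^sub>j\<close>, so that
  \<open>P\<^sub>c (z\<^sub>0, \<dots>, z\<^sub>m, \<epsilon>) = P (wave_slots \<iota> c z, \<epsilon>)\<close>.\<close>

definition wave_slots :: "('n::finite \<Rightarrow> nat \<times> nat) \<Rightarrow> real \<Rightarrow> (nat \<Rightarrow> real) \<Rightarrow> real ^ 'n" where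
  "wave_slots \<iota> c z = (\<chi> n. (- c) ^ snd (\<iota> n) * z (fst (\<iota> n) + snd (\<iota> n)))"

definition P_wave ::
  "('n::finite \<Rightarrow> nat \<times> nat) \<Rightarrow> ((real ^ 'n) \<times> real \<Rightarrow> real) \<Rightarrow> real \<Rightarrow> (nat \<Rightarrow> real) \<Rightarrow> real \<Rightarrow> real" where
  "P_wave \<iota> P c z \<epsilon> = P (wave_slots \<iota> c z, \<epsilon>)"

section \<open>Limits of sets, ovals and line integrals\<close>

text \<open>The topological lower and upper limits of the open sets \<open>V \<epsilon>\<close> coincide and equal \<open>L\<close>
  (equivalently, the complements converge to the complement of \<open>L\<close> in the sense of
  Painleve and Kuratowski).\<close>

definition open_sets_limit :: "('e \<Rightarrow> ('a::metric_space) set) \<Rightarrow> 'a set \<Rightarrow> 'e filter \<Rightarrow> bool" where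
  "open_sets_limit V L F \<longleftrightarrow>
     L = {p. \<exists>r>0. \<forall>\<^sub>F \<epsilon> in F. ball p r \<subseteq> V \<epsilon>} \<and>
     L = {p. \<exists>r>0. \<exists>\<^sub>F \<epsilon> in F. ball p r \<subseteq> V \<epsilon>}"

definition level_set :: "(real \<times> real) set \<Rightarrow> (real \<times> real \<Rightarrow> real) \<Rightarrow> real \<Rightarrow> (real \<times> real) set" where
  "level_set V H h = {p \<in> V. H p = h}"

definition closed_oval_around :: "real \<times> real \<Rightarrow> (real \<times> real) set \<Rightarrow> bool" where
  "closed_oval_around p C \<longleftrightarrow>
     (\<exists>\<gamma>. simple_path \<gamma> \<and> pathfinish \<gamma> = pathstart \<gamma> \<and> path_image \<gamma> = C) \<and> p \<in> inside C"

text \<open>\<open>\<gamma>\<close> runs once through the closed curve \<open>C\<close>, in the direction of the vector field \<open>X\<close>.\<close>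

definition oriented_by ::
  "(real \<times> real \<Rightarrow> real \<times> real) \<Rightarrow> (real \<times> real) set \<Rightarrow> (real \<Rightarrow> real \<times> real) \<Rightarrow> bool" where
  "oriented_by X C \<gamma> \<longleftrightarrow>
     simple_path \<gamma> \<and> pathfinish \<gamma> = pathstart \<gamma> \<and> path_image \<gamma> = C \<and>
     \<gamma> C1_differentiable_on {0..1} \<and>
     (\<forall>t\<in>{0..1}. \<exists>\<mu>>0. vector_derivative \<gamma> (at t) = \<mu> *\<^sub>R X (\<gamma> t))"

definition line_integral_dx :: "(real \<times> real \<Rightarrow> real) \<Rightarrow> (real \<Rightarrow> real \<times> real) \<Rightarrow> real" where
  "line_integral_dx F \<gamma> = integral {0..1} (\<lambda>t. F (\<gamma> t) * fst (vector_derivative \<gamma> (at t)))"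

text \<open>The function \<open>M\<close>. The ovals are oriented as orbits of \<open>x' = y, y' = k + f(x, y)\<close>. The other
  orientation changes the sign of \<open>M\<close> and so has the same simple zeroes; the value does not
  depend on the parametrization that is chosen.\<close>

definition melnikov ::
  "real \<Rightarrow> (real \<times> real) set \<Rightarrow> (real \<times> real \<Rightarrow> real) \<Rightarrow> ((real \<times> real) \<times> real \<Rightarrow> real)
     \<Rightarrow> (real \<times> real \<Rightarrow> real) \<Rightarrow> (real \<times> real \<Rightarrow> real) \<Rightarrow> real \<Rightarrow> real" where
  "melnikov k V f g s H h =
     line_integral_dx (\<lambda>p. g (p, 0) / s p)
       (SOME \<gamma>. oriented_by (\<lambda>p. (snd p, k + f p)) (level_set V H h) \<gamma>)"

definition simple_zero :: "(real \<Rightarrow> real) \<Rightarrow> real \<Rightarrow> bool" where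
  "simple_zero M h \<longleftrightarrow> M h = 0 \<and> (\<exists>D. D \<noteq> 0 \<and> (M has_real_derivative D) (at h))"

section \<open>Property B\<close>

text \<open>The identity of condition (o) is required of every \<open>C\<^sup>m\<close> function \<open>U\<close> wherever
  \<open>Q (U, U', U'', \<epsilon>)\<close> is defined; it includes that the right-hand side is then defined too.\<close>

definition property_B_o ::
  "nat \<Rightarrow> ('n::finite \<Rightarrow> nat \<times> nat) \<Rightarrow> (real ^ 'n) set \<Rightarrow> real set \<Rightarrow> ((real ^ 'n) \<times> real \<Rightarrow> real) \<Rightarrow> real
     \<Rightarrow> (real \<times> real \<times> real) set \<Rightarrow> ((real \<times> real \<times> real) \<times> real \<Rightarrow> real) \<Rightarrow> bool" where
  "property_B_o m \<iota> W I P c Wc Q \<longleftrightarrow>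
     open Wc \<and> Ck_on (m - 2) Q (Wc \<times> I) \<and>
     (\<forall>U. \<forall>\<epsilon>\<in>I. \<forall>s. Ck_on m U UNIV \<longrightarrow> (U s, deriv U s, (deriv ^^ 2) U s) \<in> Wc \<longrightarrow>
        wave_slots \<iota> c (\<lambda>r. (deriv ^^ r) U s) \<in> W \<and>
        (deriv ^^ (m - 2)) (\<lambda>\<sigma>. Q ((U \<sigma>, deriv U \<sigma>, (deriv ^^ 2) U \<sigma>), \<epsilon>)) s
          = P_wave \<iota> P c (\<lambda>r. (deriv ^^ r) U s) \<epsilon>)"

text \<open>\<open>V 0\<close> plays the role of the limit set \<open>\<V>\<^sub>c\<^sub>,\<^sub>k\<close>.\<close>

definition property_B_i ::
  "real set \<Rightarrow> real \<Rightarrow> (real \<times> real \<times> real) set \<Rightarrow> ((real \<times> real \<times> real) \<times> real \<Rightarrow> real)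
     \<Rightarrow> (real \<Rightarrow> (real \<times> real) set) \<Rightarrow> (real \<times> real \<Rightarrow> real) \<Rightarrow> ((real \<times> real) \<times> real \<Rightarrow> real)
     \<Rightarrow> real \<Rightarrow> bool" where
  "property_B_i I k Wc Q V f g xc \<longleftrightarrow>
     (\<forall>\<epsilon>\<in>I. open (V \<epsilon>) \<and> Ck_on 1 f (V \<epsilon>) \<and> Ck_on 1 g (V \<epsilon> \<times> I)) \<and>
     (\<forall>\<^sub>F \<epsilon> in nhds 0.
        {(x, y, z). (x, y) \<in> V \<epsilon> \<and> z = k + f (x, y) + \<epsilon> * g ((x, y), \<epsilon>)}
          \<subseteq> {(x, y, z) \<in> Wc. Q ((x, y, z), \<epsilon>) = k}) \<and>
     open_sets_limit V (V 0) (at 0) \<and>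
     {x. (x, 0) \<in> V 0 \<and> f (x, 0) + k = 0} = {xc}"

definition property_B_ii ::
  "real \<Rightarrow> (real \<times> real) set \<Rightarrow> (real \<times> real \<Rightarrow> real) \<Rightarrow> real
     \<Rightarrow> (real \<times> real \<Rightarrow> real) \<Rightarrow> (real \<times> real \<Rightarrow> real) \<Rightarrow> bool" where
  "property_B_ii k V0 f xc s H \<longleftrightarrow>
     Ck_on 2 H V0 \<and> (\<forall>p\<in>V0. H p \<ge> 0) \<and> H (xc, 0) = 0 \<and>
     Ck_on 1 s V0 \<and> (\<forall>p\<in>V0. s p > 0) \<and>
     (\<forall>x y. (x, y) \<in> V0 \<longrightarrow>
        ((\<lambda>y'. H (x, y')) has_real_derivative y / s (x, y)) (at y) \<and>
        ((\<lambda>x'. H (x', y)) has_real_derivative - ((f (x, y) + k) / s (x, y))) (at x))"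

text \<open>\<open>hz 1, \<dots>, hz l\<close> enumerate the simple zeroes of \<open>M\<close>.\<close>

definition property_B_iii ::
  "real \<Rightarrow> (real \<times> real) set \<Rightarrow> (real \<times> real \<Rightarrow> real) \<Rightarrow> ((real \<times> real) \<times> real \<Rightarrow> real)
     \<Rightarrow> real \<Rightarrow> (real \<times> real \<Rightarrow> real) \<Rightarrow> (real \<times> real \<Rightarrow> real) \<Rightarrow> ereal \<Rightarrow> nat \<Rightarrow> (nat \<Rightarrow> real) \<Rightarrow> bool" where
  "property_B_iii k V0 f g xc s H hbar l hz \<longleftrightarrow>
     0 < hbar \<and>
     (\<forall>h>0. ereal h < hbar \<longrightarrow> closed_oval_around (xc, 0) (level_set V0 H h)) \<and>
     1 \<le> l \<and>
     bij_betw hz {1..l} {h. 0 < h \<and> ereal h < hbar \<and> simple_zero (melnikov k V0 f g s H) h}"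

definition property_B ::
  "nat \<Rightarrow> ('n::finite \<Rightarrow> nat \<times> nat) \<Rightarrow> (real ^ 'n) set \<Rightarrow> real set \<Rightarrow> ((real ^ 'n) \<times> real \<Rightarrow> real)
     \<Rightarrow> real \<Rightarrow> real \<Rightarrow> (real \<times> real \<times> real) set \<Rightarrow> ((real \<times> real \<times> real) \<times> real \<Rightarrow> real)
     \<Rightarrow> (real \<Rightarrow> (real \<times> real) set) \<Rightarrow> (real \<times> real \<Rightarrow> real) \<Rightarrow> ((real \<times> real) \<times> real \<Rightarrow> real)
     \<Rightarrow> real \<Rightarrow> (real \<times> real \<Rightarrow> real) \<Rightarrow> (real \<times> real \<Rightarrow> real) \<Rightarrow> ereal \<Rightarrow> nat \<Rightarrow> (nat \<Rightarrow> real) \<Rightarrow> bool" where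
  "property_B m \<iota> W I P c k Wc Q V f g xc s H hbar l hz \<longleftrightarrow>
     property_B_o m \<iota> W I P c Wc Q \<and>
     property_B_i I k Wc Q V f g xc \<and>
     property_B_ii k (V 0) f xc s H \<and>
     property_B_iii k (V 0) f g xc s H hbar l hz"

text \<open>Solutions of \<open>U'' = k + f (U, U') + \<epsilon> g (U, U', \<epsilon>)\<close> are only \<open>C\<^sup>3\<close> if \<open>f\<close> and \<open>g\<close> are just
  \<open>C\<^sup>1\<close>. The following makes them \<open>C\<^sup>m\<close>, as solutions of an equation of order \<open>m\<close> have to be;
  for \<open>m = 3\<close> it adds nothing to \<open>property_B_i\<close>. It holds, by the implicit function theorem, whenever
  \<open>Q\<close> is \<open>C\<^sup>m\<^sup>-\<^sup>2\<close> and its derivative in the third variable has no zero on the surface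
  \<open>z = k + f + \<epsilon>g\<close>.\<close>

definition sufficiently_smooth_surface ::
  "nat \<Rightarrow> (real \<Rightarrow> (real \<times> real) set) \<Rightarrow> (real \<times> real \<Rightarrow> real) \<Rightarrow> ((real \<times> real) \<times> real \<Rightarrow> real)
     \<Rightarrow> bool" where
  "sufficiently_smooth_surface m V f g \<longleftrightarrow>
     (\<forall>\<^sub>F \<epsilon> in nhds 0. Ck_on (m - 2) (\<lambda>p. f p + \<epsilon> * g (p, \<epsilon>)) (V \<epsilon>))"

end

theory Submission
  imports Defs
begin

text \<open>The wave equation of order \<open>m\<close> is a derivative of \<open>Q (U, U', U'', \<epsilon>) = k\<close>, which is solved by
  the periodic orbits of \<open>x' = y, y' = k + f (x, y) + \<epsilon> g (x, y, \<epsilon>)\<close>. For \<open>\<epsilon> = 0\<close> the ovals of \<open>H\<close> are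
  such orbits: by compactness an orbit on an oval accumulates at some point, and since the oval is a
  single arc near that point, the orbit closes up. Along a perturbed orbit \<open>H\<close> changes at the rate
  \<open>\<epsilon> y g / s\<close>, so the first return to a vertical section changes it by \<open>\<epsilon> D (y, \<epsilon>)\<close> with \<open>D\<close> jointly
  continuous, and \<open>D (y, 0)\<close> is a positive integer multiple of \<open>M (H (x\<^sub>0, y))\<close>. At a simple zero \<open>M\<close>
  changes sign; hence, for each fixed small \<open>\<epsilon>\<close>, so does \<open>D (\<cdot>, \<epsilon>)\<close>, and the intermediate value
  theorem provides a closed orbit near the oval. No differentiability of the return map is used.\<close>

section \<open>Travelling waves from planar periodic orbits\<close>

text \<open>Condition (iii) only says that an oval is a simple closed curve, and \<open>f\<close>,
  \<open>g\<close> are merely C^1 on open sets that vary with \<epsilon>. So no smooth structure on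
  the ovals is given beforehand; it is obtained from the flow: \<open>H\<close> vanishes at the only
  equilibrium, hence the field has no zero on an oval with h > 0. To have a global flow, the field
  is restricted to a compact neighbourhood of one oval, where it is Lipschitz, and extended to the
  whole space; the orbits that matter never leave that neighbourhood. The parameter \<epsilon>
  becomes a third coordinate with derivative 0, so that continuity in the initial value includes
  continuity in \<epsilon>. \<open>D\<close> is an integral along the orbit and not a quotient by
  \<epsilon>, hence it makes sense at \<epsilon> = 0. The integer multiple of \<open>M\<close> may
  change with y; being positive, it leaves the sign alone. Finally, waves are told apart by their
  phase curves (U, U'), which translation preserves: curves on, or close to, disjoint ovals cannot
  belong to translates.\<close>

lemma frechet_derivative_cong_open:
  assumes "open S" "x \<in> S" "\<And>y. y \<in> S \<Longrightarrow> f y = g y" "f differentiable (at x)"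
  shows "g differentiable (at x)" "frechet_derivative g (at x) = frechet_derivative f (at x)"
proof -
  have "(f has_derivative frechet_derivative f (at x)) (at x)"
    using assms(4) frechet_derivative_works by blast
  then have *: "(g has_derivative frechet_derivative f (at x)) (at x)"
    using has_derivative_transform_within_open assms(1-3) by blast
  then show "g differentiable (at x)" by (auto simp: differentiable_def)
  show "frechet_derivative g (at x) = frechet_derivative f (at x)"
    using frechet_derivative_at[OF *] by simp
qed

lemma Ck_on_cong:
  assumes "Ck_on r f S" "open S" "\<And>x. x \<in> S \<Longrightarrow> f x = g x"
  shows "Ck_on r g S"
  using assms
proof (induction r arbitrary: f g)
  case 0
  then have "continuous_on S f" by simp
  then have "continuous_on S g" by (rule continuous_on_eq) (rule 0)
  then show ?case by simp
next
  case (Suc r)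
  have d: "f differentiable (at x)" if "x \<in> S" for x
    using Suc.prems(1) that by simp
  note * = frechet_derivative_cong_open[OF Suc.prems(2) _ Suc.prems(3) d]
  have "Ck_on r (\<lambda>x. frechet_derivative g (at x) v) S" for v
  proof (rule Suc.IH[OF _ Suc.prems(2)])
    show "Ck_on r (\<lambda>x. frechet_derivative f (at x) v) S" using Suc.prems(1) by simp
    show "frechet_derivative f (at x) v = frechet_derivative g (at x) v" if "x \<in> S" for x
      using *(2)[OF that _ that] by simp
  qed
  moreover have "g differentiable (at x)" if "x \<in> S" for x
    using *(1)[OF that _ that] by simp
  ultimately show ?case by simp
qed

lemma Ck_on_Suc_imp: "Ck_on (Suc r) f S \<Longrightarrow> Ck_on r f S"
proof (induction r arbitrary: f)
  case 0
  then show ?case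
    by (auto intro!: continuous_at_imp_continuous_on differentiable_imp_continuous_within)
next
  case (Suc r)
  then have "\<forall>v. Ck_on r (\<lambda>x. frechet_derivative f (at x) v) S"
    using Suc.IH Suc.prems unfolding Ck_on.simps(2)[of "Suc r"] by blast
  with Suc.prems show ?case by simp
qed

lemma Ck_on_mono: "Ck_on r f S \<Longrightarrow> q \<le> r \<Longrightarrow> Ck_on q f S"
proof (induction r)
  case (Suc r)
  then show ?case using Ck_on_Suc_imp[OF Suc.prems(1)] by (cases "q = Suc r") simp_all
qed simp

lemma Ck_on_has_derivative:
  "Ck_on (Suc r) f S \<Longrightarrow> x \<in> S \<Longrightarrow> (f has_derivative frechet_derivative f (at x)) (at x)"
  using frechet_derivative_works by auto

lemma Ck_on_SucI:
  assumes "open S" "\<And>x. x \<in> S \<Longrightarrow> (f has_derivative f' x) (at x)" "\<And>v. Ck_on r (\<lambda>x. f' x v) S"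
  shows "Ck_on (Suc r) f S"
proof -
  have eq: "frechet_derivative f (at x) = f' x" if "x \<in> S" for x
    using frechet_derivative_at[OF assms(2)[OF that]] by simp
  have "Ck_on r (\<lambda>x. frechet_derivative f (at x) v) S" for v
    by (rule Ck_on_cong[OF assms(3) assms(1)]) (simp add: eq)
  then show ?thesis using assms(2) by (auto simp: differentiable_def)
qed

lemma Ck_on_const: "Ck_on r (\<lambda>_. a) S"
proof (induction r arbitrary: a)
  case (Suc r)
  then show ?case by simp
qed simp

lemma Ck_on_add:
  assumes "open S" "Ck_on r f S" "Ck_on r g S"
  shows "Ck_on r (\<lambda>x. f x + g x) S"
  using assms(2,3)
proof (induction r arbitrary: f g)
  case 0
  then show ?case by (auto intro: continuous_intros)
next
  case (Suc r)
  show ?case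
    by (rule Ck_on_SucI[OF assms(1)
          has_derivative_add[OF Ck_on_has_derivative[OF Suc.prems(1)] Ck_on_has_derivative[OF Suc.prems(2)]]])
      (use Suc in auto)
qed

lemma Ck_on_sum:
  assumes "open S" "\<And>i. i \<in> A \<Longrightarrow> Ck_on r (f i) S"
  shows "Ck_on r (\<lambda>x. \<Sum>i\<in>A. f i x) S"
  using assms(2)
  by (induction A rule: infinite_finite_induct)
    (simp_all add: Ck_on_const Ck_on_add assms(1) del: Ck_on.simps)

lemma Ck_on_mult:
  fixes f g :: "'a::real_normed_vector \<Rightarrow> 'b::real_normed_algebra"
  assumes "open S" "Ck_on r f S" "Ck_on r g S"
  shows "Ck_on r (\<lambda>x. f x * g x) S"
  using assms(2,3)
proof (induction r arbitrary: f g)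
  case 0
  then show ?case by (auto intro: continuous_intros)
next
  case (Suc r)
  have "Ck_on r (\<lambda>x. f x * frechet_derivative g (at x) v + frechet_derivative f (at x) v * g x) S" for v
    using Suc.prems Suc.prems[THEN Ck_on_Suc_imp]
    by (intro Ck_on_add Suc.IH assms(1)) simp_all
  then show ?case
    by (intro Ck_on_SucI[OF assms(1)
          has_derivative_mult[OF Ck_on_has_derivative[OF Suc.prems(1)] Ck_on_has_derivative[OF Suc.prems(2)]]])
qed

text \<open>By the chain rule, a directional derivative of the composition is a finite sum of
  products: derivatives of the coordinates of \<open>G\<close> times partial derivatives of
  \<open>F\<close> evaluated along \<open>G\<close>. The induction is over all \<open>F\<close> at
  once, because it is applied to these partial derivatives.\<close>

lemma Ck_on_compose:
  fixes G :: "'a::real_normed_vector \<Rightarrow> 'b::euclidean_space" and F :: "'b \<Rightarrow> real"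
  assumes "open S" "Ck_on r F T" "\<And>b. b \<in> Basis \<Longrightarrow> Ck_on r (\<lambda>x. G x \<bullet> b) S" "G ` S \<subseteq> T"
  shows "Ck_on r (\<lambda>x. F (G x)) S"
  using assms(2,3)
proof (induction r arbitrary: F)
  case 0
  then have "continuous_on S G"
    by (intro continuous_on_componentwise[THEN iffD2]) auto
  with 0 assms(4) show ?case
    by (auto intro: continuous_on_compose2)
next
  case (Suc r)
  define G' where "G' x v = (\<Sum>b\<in>Basis. frechet_derivative (\<lambda>x. G x \<bullet> b) (at x) v *\<^sub>R b)" for x v
  have G': "(G has_derivative G' x) (at x)" if "x \<in> S" for x
  proof (rule has_derivative_componentwise_within[THEN iffD2], rule ballI)
    fix b :: 'b assume b: "b \<in> Basis"
    have "(\<lambda>v. G' x v \<bullet> b) = frechet_derivative (\<lambda>x. G x \<bullet> b) (at x)"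
      using b by (auto simp: G'_def inner_sum_left inner_Basis if_distrib cong: if_cong)
    then show "((\<lambda>x. G x \<bullet> b) has_derivative (\<lambda>v. G' x v \<bullet> b)) (at x)"
      using Ck_on_has_derivative[OF Suc.prems(2)[OF b] that] by simp
  qed
  have FG: "((\<lambda>x. F (G x)) has_derivative (\<lambda>v. frechet_derivative F (at (G x)) (G' x v))) (at x)"
    if "x \<in> S" for x
    using diff_chain_at[OF G'[OF that] Ck_on_has_derivative[OF Suc.prems(1)]] assms(4) that
    by (auto simp: o_def)
  have eq: "frechet_derivative F (at (G x)) (G' x v) =
      (\<Sum>b\<in>Basis. frechet_derivative (\<lambda>x. G x \<bullet> b) (at x) v * frechet_derivative F (at (G x)) b)"
    if "x \<in> S" for x v
  proof -
    have "linear (frechet_derivative F (at (G x)))"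
      using Ck_on_has_derivative[OF Suc.prems(1)] assms(4) that has_derivative_linear by blast
    then show ?thesis
      by (simp add: G'_def linear_sum linear_cmul)
  qed
  have "Ck_on r (\<lambda>x. \<Sum>b\<in>Basis. frechet_derivative (\<lambda>x. G x \<bullet> b) (at x) v * frechet_derivative F (at (G x)) b) S" for v
  proof (rule Ck_on_sum[OF assms(1)], rule Ck_on_mult[OF assms(1)])
    fix b :: 'b assume b: "b \<in> Basis"
    show "Ck_on r (\<lambda>x. frechet_derivative (\<lambda>x. G x \<bullet> b) (at x) v) S"
      using Suc.prems(2)[OF b] by simp
    have "Ck_on r (\<lambda>y. frechet_derivative F (at y) b) T"
      using Suc.prems(1) by simp
    then show "Ck_on r (\<lambda>x. frechet_derivative F (at (G x)) b) S"
      by (rule Suc.IH) (rule Ck_on_Suc_imp[OF Suc.prems(2)])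
  qed
  then have "Ck_on r (\<lambda>x. frechet_derivative F (at (G x)) (G' x v)) S" for v
    by (rule Ck_on_cong[OF _ assms(1)]) (simp add: eq)
  then show ?case
    by (intro Ck_on_SucI[OF assms(1) FG])
qed

text \<open>In one variable the derivative in direction v is \<open>deriv U x * v\<close>. This
  links the Frechet derivatives of \<open>Ck_on\<close> to the iterated \<open>deriv\<close> that
  fills the slots of the equation.\<close>

lemma Ck_on_Suc_real:
  fixes U :: "real \<Rightarrow> real"
  shows "Ck_on (Suc r) U UNIV \<longleftrightarrow>
    (\<forall>x. (U has_real_derivative deriv U x) (at x)) \<and> Ck_on r (deriv U) UNIV"
proof -
  have D: "(U has_real_derivative deriv U x) (at x)" "frechet_derivative U (at x) v = deriv U x * v"
    if "U differentiable (at x)" for x v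
  proof -
    show *: "(U has_real_derivative deriv U x) (at x)"
      using that DERIV_deriv_iff_real_differentiable by blast
    show "frechet_derivative U (at x) v = deriv U x * v"
      using frechet_derivative_at[OF *[unfolded has_field_derivative_def]] by simp
  qed
  show ?thesis
  proof
    assume L: "Ck_on (Suc r) U UNIV"
    then have "Ck_on r (\<lambda>x. frechet_derivative U (at x) 1) UNIV" by simp
    then have "Ck_on r (deriv U) UNIV"
      by (rule Ck_on_cong) (use D L in auto)
    with L D show "(\<forall>x. (U has_real_derivative deriv U x) (at x)) \<and> Ck_on r (deriv U) UNIV"
      by auto
  next
    assume R: "(\<forall>x. (U has_real_derivative deriv U x) (at x)) \<and> Ck_on r (deriv U) UNIV"
    have "Ck_on r (\<lambda>x. deriv U x * v) UNIV" for v
      using R by (intro Ck_on_mult Ck_on_const) auto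
    then show "Ck_on (Suc r) U UNIV"
      by (intro Ck_on_SucI[where f'="\<lambda>x v. deriv U x * v"])
        (use R in \<open>auto simp: has_field_derivative_def\<close>)
  qed
qed

lemma Ck_on_deriv_funpow:
  fixes U :: "real \<Rightarrow> real"
  assumes "Ck_on m U UNIV" "j < m"
  shows "((deriv ^^ j) U has_real_derivative (deriv ^^ Suc j) U x) (at x)"
  using assms
proof (induction j arbitrary: m U)
  case 0
  then obtain r where "m = Suc r" using less_imp_Suc_add by blast
  then show ?case using 0 Ck_on_Suc_real by auto
next
  case (Suc j)
  then obtain r where r: "m = Suc r" using less_imp_Suc_add by blast
  then have "Ck_on r (deriv U) UNIV" using Suc Ck_on_Suc_real by blast
  from Suc.IH[OF this] r Suc.prems show ?case by (simp add: funpow_Suc_right del: funpow.simps)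
qed

section \<open>Jets and smoothness of travelling waves\<close>

lemma partial_xt_wave:
  assumes "Ck_on m U UNIV" "i + j \<le> m"
  shows "partial_xt i j (\<lambda>(x, t). U (x - c * t)) (x, t) = (- c) ^ j * (deriv ^^ (i + j)) U (x - c * t)"
proof -
  have 1: "(deriv ^^ j) (\<lambda>t'. U (x' - c * t')) = (\<lambda>t. (- c) ^ j * (deriv ^^ j) U (x' - c * t))"
    if "j \<le> m" for x' j
    using that
  proof (induction j)
    case (Suc j)
    have "deriv (\<lambda>t. (- c) ^ j * (deriv ^^ j) U (x' - c * t)) t = (- c) ^ Suc j * (deriv ^^ Suc j) U (x' - c * t)" for t
    proof (rule DERIV_imp_deriv)
      have "((\<lambda>t. (deriv ^^ j) U (x' - c * t)) has_real_derivative (deriv ^^ Suc j) U (x' - c * t) * (- c)) (at t)"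
        by (rule DERIV_chain2[OF Ck_on_deriv_funpow[OF assms(1)]])
          (use Suc.prems in \<open>auto intro!: derivative_eq_intros\<close>)
      from DERIV_cmult[OF this, of "(- c) ^ j"]
      show "((\<lambda>t. (- c) ^ j * (deriv ^^ j) U (x' - c * t)) has_real_derivative
         (- c) ^ Suc j * (deriv ^^ Suc j) U (x' - c * t)) (at t)"
        by (simp add: algebra_simps)
    qed
    with Suc show ?case by auto
  qed simp
  have 2: "(deriv ^^ i) (\<lambda>x'. (- c) ^ j * (deriv ^^ j) U (x' - c * t))
      = (\<lambda>x'. (- c) ^ j * (deriv ^^ (i + j)) U (x' - c * t))" if "i + j \<le> m" for i
    using that
  proof (induction i)
    case (Suc i)
    have "deriv (\<lambda>x'. (- c) ^ j * (deriv ^^ (i + j)) U (x' - c * t)) x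
       = (- c) ^ j * (deriv ^^ (Suc i + j)) U (x - c * t)" for x
    proof (rule DERIV_imp_deriv)
      have "((\<lambda>x'. (deriv ^^ (i + j)) U (x' - c * t)) has_real_derivative
          (deriv ^^ Suc (i + j)) U (x - c * t) * 1) (at x)"
        by (rule DERIV_chain2[OF Ck_on_deriv_funpow[OF assms(1)]])
          (use Suc.prems in \<open>auto intro!: derivative_eq_intros\<close>)
      from DERIV_cmult[OF this, of "(- c) ^ j"]
      show "((\<lambda>x'. (- c) ^ j * (deriv ^^ (i + j)) U (x' - c * t)) has_real_derivative
         (- c) ^ j * (deriv ^^ (Suc i + j)) U (x - c * t)) (at x)"
        by simp
    qed
    with Suc show ?case by auto
  qed simp
  show ?thesis
    using 1 2 assms(2) by (simp add: partial_xt_def)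
qed

lemma jet_wave:
  assumes "Ck_on m U UNIV" "derivative_slots m \<iota>"
  shows "jet \<iota> (\<lambda>(x, t). U (x - c * t)) (x, t) = wave_slots \<iota> c (\<lambda>r. (deriv ^^ r) U (x - c * t))"
proof -
  have "fst (\<iota> n) + snd (\<iota> n) \<le> m" for n
    using bij_betwE[OF assms(2)[unfolded derivative_slots_def]] by (auto simp: case_prod_unfold)
  then show ?thesis
    using partial_xt_wave[OF assms(1)] by (simp add: jet_def wave_slots_def)
qed

lemma Ck_on_bounded_linear: 
  assumes "open S" "bounded_linear h" shows "Ck_on r h S"
proof (cases r)
  case 0
  then show ?thesis by (simp add: assms linear_continuous_on)
next
  case (Suc q)
  show ?thesis unfolding Suc
    by (intro Ck_on_SucI[where f'="\<lambda>_. h"] bounded_linear_imp_has_derivative Ck_on_const assms)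
qed

lemma Ck_on_wave:
  fixes U :: "real \<Rightarrow> real"
  assumes "Ck_on m U UNIV"
  shows "Ck_on m (\<lambda>(x, t). U (x - c * t)) UNIV"
proof -
  have "bounded_linear (\<lambda>p::real \<times> real. fst p - c * snd p)"
    by (intro bounded_linear_intros)
  then have "Ck_on m (\<lambda>p::real \<times> real. U (fst p - c * snd p)) UNIV"
    by (intro Ck_on_compose[OF _ assms]) (auto intro!: Ck_on_bounded_linear)
  then show ?thesis by (simp add: case_prod_unfold)
qed

text \<open>Bootstrapping: if \<open>u\<close> and \<open>v\<close> are C^r, then so are u' = v and
  v' = F (u, v), as long as r does not exceed the smoothness n of \<open>F\<close>. This ends with
  \<open>v\<close> of class C^(n+1), and u' = v gives one more derivative to \<open>u\<close>
  alone.\<close>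

lemma Ck_on_planar_solution:
  assumes u: "\<And>t. (u has_real_derivative v t) (at t)"
    and v: "\<And>t. (v has_real_derivative F (u t, v t)) (at t)"
    and F: "Ck_on n F S" and S: "\<And>t. (u t, v t) \<in> S"
  shows "Ck_on (Suc (Suc n)) u UNIV"
proof -
  have du: "deriv u = v"
    using DERIV_imp_deriv[OF u] by (rule ext)
  have dv: "deriv v = (\<lambda>t. F (u t, v t))"
    using DERIV_imp_deriv[OF v] by (rule ext)
  have "Ck_on r u UNIV \<and> Ck_on r v UNIV" if "r \<le> Suc n" for r
    using that
  proof (induction r)
    case 0
    then show ?case
      using u v by (auto intro!: continuous_at_imp_continuous_on DERIV_isCont)
  next
    case (Suc r)
    then have IH: "Ck_on r u UNIV" "Ck_on r v UNIV" by auto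
    have "Ck_on r F S" using F Suc.prems by (intro Ck_on_mono[OF F]) auto
    then have "Ck_on r (\<lambda>t. F (u t, v t)) UNIV"
      by (rule Ck_on_compose[OF open_UNIV, where T=S]) (use IH S in \<open>auto simp: Basis_prod_def\<close>)
    then show ?case
      unfolding Ck_on_Suc_real du dv using IH u v by auto
  qed
  from this[of "Suc n"] show ?thesis
    unfolding Ck_on_Suc_real[of "Suc n"] du using u by auto
qed

text \<open>\<open>Q\<close> has the constant value \<open>k\<close> along the orbit, so condition
  (o) expresses P_c as a derivative of a constant. The time \<open>t0\<close>, at which the wave has
  nonzero slope, excludes constant waves.\<close>

lemma periodic_travelling_waveI:
  fixes \<iota> :: "'n::finite \<Rightarrow> nat \<times> nat"
  assumes m: "m > 2" and \<iota>: "derivative_slots m \<iota>" and B: "property_B_o m \<iota> W I P c Wc Q"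
    and \<epsilon>: "\<epsilon> \<in> I"
    and surf: "\<And>p. p \<in> S \<Longrightarrow> (fst p, snd p, F p) \<in> Wc \<and> Q ((fst p, snd p, F p), \<epsilon>) = k"
    and F: "Ck_on (m - 2) F S" and S: "\<And>t. (u t, v t) \<in> S"
    and u: "\<And>t. (u has_real_derivative v t) (at t)"
    and v: "\<And>t. (v has_real_derivative F (u t, v t)) (at t)"
    and T: "T > 0" "\<And>t. u (t + T) = u t" and v0: "v t0 \<noteq> 0"
  shows "periodic_travelling_wave m \<iota> W P c \<epsilon> u"
proof -
  have "m = Suc (Suc (m - 2))" using m by simp
  then have Cm: "Ck_on m u UNIV"
    using Ck_on_planar_solution[OF u v F S] by simp
  have du: "deriv u = v"
    using DERIV_imp_deriv[OF u] by (rule ext)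
  have dv: "deriv v = (\<lambda>t. F (u t, v t))"
    using DERIV_imp_deriv[OF v] by (rule ext)
  have d2: "(deriv ^^ 2) u = (\<lambda>t. F (u t, v t))"
    by (simp add: numeral_2_eq_2 du dv)
  have const: "(deriv ^^ Suc n) (\<lambda>_. a) = (\<lambda>_. 0)" for n and a :: real
    by (induction n) auto
  \<comment> \<open>Since m > 2, at least one derivative is taken; with none, the value k would
    remain instead of 0.\<close>
  have "m - 2 = Suc (m - 3)" using m by simp
  then have "(deriv ^^ (m - 2)) (\<lambda>\<sigma>. Q ((u \<sigma>, deriv u \<sigma>, (deriv ^^ 2) u \<sigma>), \<epsilon>)) s = 0" for s
    using surf[OF S] const by (simp only: du d2 fst_conv snd_conv)
  moreover have "(u s, deriv u s, (deriv ^^ 2) u s) \<in> Wc" for s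
    using surf[OF S] by (simp only: du d2 fst_conv snd_conv)
  moreover have "(u s, deriv u s, (deriv ^^ 2) u s) \<in> Wc \<Longrightarrow>
      wave_slots \<iota> c (\<lambda>r. (deriv ^^ r) u s) \<in> W \<and>
      (deriv ^^ (m - 2)) (\<lambda>\<sigma>. Q ((u \<sigma>, deriv u \<sigma>, (deriv ^^ 2) u \<sigma>), \<epsilon>)) s
        = P (wave_slots \<iota> c (\<lambda>r. (deriv ^^ r) u s), \<epsilon>)" for s
    using B[unfolded property_B_o_def P_wave_def, THEN conjunct2, THEN conjunct2,
        THEN spec, THEN bspec, OF \<epsilon>, THEN spec, THEN mp, OF Cm, THEN mp] .
  ultimately have *: "wave_slots \<iota> c (\<lambda>r. (deriv ^^ r) u s) \<in> W \<and>
      P (wave_slots \<iota> c (\<lambda>r. (deriv ^^ r) u s), \<epsilon>) = 0" for s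
    by simp
  have "pde_solution m \<iota> W P \<epsilon> (\<lambda>(x, t). u (x - c * t))"
    unfolding pde_solution_def
  proof (intro conjI allI Ck_on_wave Cm)
    fix p :: "real \<times> real"
    obtain x t where p: "p = (x, t)" by fastforce
    show "jet \<iota> (\<lambda>(x, t). u (x - c * t)) p \<in> W"
      and "P (jet \<iota> (\<lambda>(x, t). u (x - c * t)) p, \<epsilon>) = 0"
      unfolding p jet_wave[OF Cm \<iota>] using * by blast+
  qed
  moreover have "periodic_fun_simple u T"
    using T(2) by unfold_locales
  moreover have "\<not> u constant_on UNIV"
  proof
    assume "u constant_on UNIV"
    then obtain a where "u = (\<lambda>_. a)" unfolding constant_on_def by auto
    then have "deriv u t0 = 0" by simp
    with v0 du show False by simp
  qed
  ultimately show ?thesis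
    unfolding periodic_travelling_wave_def using T(1) by blast
qed

section \<open>Flows of Lipschitz vector fields\<close>

text \<open>\<open>exp (- 2 * B * (t - a))\<close> times the squared norm of \<open>w\<close> is
  nonincreasing. Working with the square keeps the function differentiable where \<open>w\<close>
  vanishes.\<close>

lemma gronwall:
  fixes w :: "real \<Rightarrow> 'a::real_inner"
  assumes "a \<le> b"
    and w: "\<And>t. t \<in> {a..b} \<Longrightarrow> (w has_vector_derivative w' t) (at t within {a..b})"
    and B: "\<And>t. t \<in> {a..b} \<Longrightarrow> norm (w' t) \<le> B * norm (w t)"
  shows "norm (w b) \<le> exp (B * (b - a)) * norm (w a)"
proof -
  define N where "N t = exp (- 2 * B * (t - a)) * (w t \<bullet> w t)" for t
  have "N b \<le> N a"
  proof (rule DERIV_nonpos_imp_decreasing_open[OF \<open>a \<le> b\<close>])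
    fix t assume t: "a < t" "t < b"
    then have "(w has_vector_derivative w' t) (at t)"
      using w[of t] by (simp add: at_within_Icc_at)
    then have "((\<lambda>t. w t \<bullet> w t) has_real_derivative w t \<bullet> w' t + w' t \<bullet> w t) (at t)"
      unfolding has_real_derivative_iff_has_vector_derivative
      by (intro bounded_bilinear.has_vector_derivative[OF bounded_bilinear_inner])
    then have "(N has_real_derivative
        exp (- 2 * B * (t - a)) * (2 * (w t \<bullet> w' t - B * (w t \<bullet> w t)))) (at t)"
      unfolding N_def by (auto intro!: derivative_eq_intros simp: algebra_simps inner_commute)
    moreover have "w t \<bullet> w' t \<le> B * (w t \<bullet> w t)"
    proof -
      have "w t \<bullet> w' t \<le> norm (w t) * norm (w' t)" by (rule norm_cauchy_schwarz)
      also have "\<dots> \<le> norm (w t) * (B * norm (w t))"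
        using B[of t] t by (intro mult_left_mono) auto
      finally show ?thesis by (simp add: dot_square_norm power2_eq_square algebra_simps)
    qed
    ultimately show "\<exists>y. (N has_real_derivative y) (at t) \<and> y \<le> 0"
      by (intro exI conjI) (auto intro: mult_nonneg_nonpos)
  next
    have "continuous_on {a..b} w"
      using w has_vector_derivative_continuous continuous_on_eq_continuous_within by blast
    then show "continuous_on {a..b} N" unfolding N_def by (intro continuous_intros)
  qed
  then have "exp (- 2 * B * (b - a)) * (norm (w b))\<^sup>2 \<le> (norm (w a))\<^sup>2"
    by (simp add: N_def dot_square_norm)
  then have "exp (2 * B * (b - a)) * (exp (- 2 * B * (b - a)) * (norm (w b))\<^sup>2)
      \<le> exp (2 * B * (b - a)) * (norm (w a))\<^sup>2"
    by (intro mult_left_mono) auto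
  then have "(norm (w b))\<^sup>2 \<le> exp (2 * B * (b - a)) * (norm (w a))\<^sup>2"
    by (simp add: mult.assoc[symmetric] exp_add[symmetric])
  also have "\<dots> = (exp (B * (b - a)) * norm (w a))\<^sup>2"
    by (simp add: power_mult_distrib exp_double[symmetric] mult.assoc)
  finally show ?thesis by (rule power2_le_imp_le) simp
qed

lemma continuous_antiderivative:
  fixes w :: "real \<Rightarrow> 'a::banach"
  assumes "continuous_on UNIV w"
  shows "\<exists>W. W 0 = 0 \<and> (\<forall>t. (W has_vector_derivative w t) (at t))"
proof -
  define W where "W t = integral {0..t} w - integral {t..0} w" for t
  have "W 0 = 0" by (simp add: W_def)
  moreover have "(W has_vector_derivative w t) (at t)" for t
  proof -
  define N where "N = \<bar>t\<bar> + 1"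
  have int: "w integrable_on {a..b}" for a b
    using assms continuous_on_subset integrable_continuous_interval by blast
  \<comment> \<open>The fundamental theorem applies to integrals with a fixed left endpoint. On the
    window around t, \<open>W\<close> differs by a constant from the integral starting at
    \<open>-N\<close>, whatever the sign of s.\<close>
  have W: "W s = integral {-N..s} w - integral {-N..0} w" if "s \<in> {-N<..<N}" for s
  proof (cases "s \<ge> 0")
    case True
    then have "integral {-N..0} w + integral {0..s} w = integral {-N..s} w"
      using that by (intro Henstock_Kurzweil_Integration.integral_combine int) auto
    moreover have "integral {s..0} w = 0" using True by (cases "s = 0") auto
    ultimately show ?thesis unfolding W_def by (metis add_diff_cancel_left' diff_zero)
  next
    case False
    then have "integral {-N..s} w + integral {s..0} w = integral {-N..0} w"
      using that by (intro Henstock_Kurzweil_Integration.integral_combine int) auto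
    moreover have "integral {0..s} w = 0" using False by auto
    ultimately show ?thesis unfolding W_def by (simp add: algebra_simps)
  qed
  have t: "t \<in> {-N<..<N}" by (auto simp: N_def)
  have "((\<lambda>s. integral {-N..s} w) has_vector_derivative w t) (at t within {-N..N})"
    using t by (intro integral_has_vector_derivative continuous_on_subset[OF assms]) auto
  then have "((\<lambda>s. integral {-N..s} w) has_vector_derivative w t) (at t)"
    using t by (simp add: at_within_Icc_at)
  then have "((\<lambda>s. integral {-N..s} w - integral {-N..0} w) has_vector_derivative w t) (at t)"
    by (auto intro!: derivative_eq_intros)
  then show ?thesis
    by (rule has_vector_derivative_transform_within_open[where S="{-N<..<N}"])
      (use t W in auto)
  qed
  ultimately show ?thesis by blast
qed

lemma has_vector_derivative_reflect:
  assumes "(u has_vector_derivative u') (at (- t))"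
  shows "((\<lambda>s. u (- s)) has_vector_derivative - u') (at t)"
proof -
  have "(uminus has_vector_derivative - 1) (at t)"
    by (auto intro!: derivative_eq_intros)
  from vector_diff_chain_at[OF this assms] show ?thesis by (simp add: o_def)
qed

text \<open>Integration gains a factor 1 / B against the weight
  \<open>exp (B * \<bar>t\<bar>)\<close>. This makes the Picard operator both bounded and
  contracting in the weighted norm.\<close>

lemma exponential_growth:
  fixes W :: "real \<Rightarrow> 'a::real_normed_vector"
  assumes W: "\<And>t. (W has_vector_derivative w t) (at t)" "W 0 = 0"
    and w: "\<And>t. norm (w t) \<le> A * exp (B * \<bar>t\<bar>)" and "B > 0"
  shows "norm (W t) \<le> A / B * exp (B * \<bar>t\<bar>)"
proof -
  have A: "A \<ge> 0" using order_trans[OF norm_ge_zero w[of 0]] by simp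
  have pos: "norm (W t) \<le> A / B * exp (B * t)"
    if W: "\<And>t. (W has_vector_derivative w t) (at t)" "W 0 = 0"
      and w: "\<And>t. norm (w t) \<le> A * exp (B * \<bar>t\<bar>)" and t: "t > 0"
    for W w :: "real \<Rightarrow> 'a" and t
  proof -
    have "norm (W t - W 0) \<le> A / B * exp (B * t) - A / B * exp (B * 0)"
    proof (rule differentiable_bound_general[OF t, where f'=w and \<phi>'="\<lambda>s. A * exp (B * s)"])
      show "continuous_on {0..t} W"
        using W(1) has_vector_derivative_continuous continuous_at_imp_continuous_on by blast
      show "((\<lambda>s. A / B * exp (B * s)) has_vector_derivative A * exp (B * s)) (at s)" for s
        unfolding has_real_derivative_iff_has_vector_derivative[symmetric]
        using \<open>B > 0\<close> by (auto intro!: derivative_eq_intros)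
      show "norm (w s) \<le> A * exp (B * s)" if "0 < s" for s
        using w[of s] that by simp
    qed (use \<open>B > 0\<close> in \<open>auto intro!: continuous_intros W\<close>)
    moreover have "A / B \<ge> 0" using A \<open>B > 0\<close> by simp
    ultimately show ?thesis using W(2) by simp
  qed
  consider "t > 0" | "t = 0" | "t < 0" by linarith
  then show ?thesis
  proof cases
    case 1
    then show ?thesis using pos[OF W w] by simp
  next
    case 2
    then show ?thesis using W(2) A \<open>B > 0\<close> by simp
  next
    case 3
    have "((\<lambda>s. W (- s)) has_vector_derivative - w (- s)) (at s)" for s
      by (rule has_vector_derivative_reflect[OF W(1)])
    from pos[OF this, of "-t"] show ?thesis using 3 W(2) w[of "- _"] by simp
  qed
qed

text \<open>With the weight \<open>exp (- B \<bar>t\<bar>)\<close> the Picard operator is a contraction on the whole line at once.\<close>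

lemma lipschitz_ode_solution:
  fixes X :: "'a::banach \<Rightarrow> 'a"
  assumes "L-lipschitz_on UNIV X"
  shows "\<exists>u. u 0 = z \<and> (\<forall>t. (u has_vector_derivative X (u t)) (at t))"
proof -
  \<comment> \<open>This choice gives L / B \<le> 1 / 2, the contraction constant, and keeps B
    positive for L = 0.\<close>
  define B where "B = 2 * (L + 1)"
  have L: "L \<ge> 0" using assms lipschitz_on_nonneg by blast
  then have B: "B > 0" by (simp add: B_def)
  define E where "E t = exp (B * \<bar>t\<bar>)" for t :: real
  have E: "E t > 0" "E t \<ge> 1" for t using B by (simp_all add: E_def)
  have X: "norm (X x - X y) \<le> L * norm (x - y)" for x y
    using assms by (auto simp: lipschitz_on_def dist_norm)
  have cX: "continuous_on UNIV X" using assms lipschitz_on_continuous_on by blast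
  have cE: "continuous_on UNIV E" unfolding E_def by (intro continuous_intros)
  \<comment> \<open>A candidate u is stored as v = u / E, a bounded continuous function, so that the
    Banach fixed point theorem can be used on a complete type.\<close>
  define w where "w v s = X (E s *\<^sub>R apply_bcontfun v s)" for v s
  have "continuous_on UNIV (w v)" for v
    unfolding w_def by (intro continuous_on_compose2[OF cX] continuous_intros cE) auto
  then have "\<forall>v. \<exists>W. W 0 = 0 \<and> (\<forall>t. (W has_vector_derivative w v t) (at t))"
    using continuous_antiderivative by blast
  then obtain J where J: "J v 0 = 0" "(J v has_vector_derivative w v t) (at t)" for v t
    by metis
  have w_bound: "norm (w v s) \<le> (norm (X 0) + L * norm v) * E s" for v s
  proof -
    have "norm (w v s) \<le> norm (X 0) + norm (w v s - X 0)"
      by (metis add.commute diff_add_cancel norm_triangle_ineq)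
    also have "norm (w v s - X 0) \<le> L * (E s * norm (apply_bcontfun v s))"
      using X[of "E s *\<^sub>R apply_bcontfun v s" 0] E(1)[of s] by (simp add: w_def)
    also have "\<dots> \<le> L * (E s * norm v)"
      using L E(1)[of s] by (intro mult_left_mono norm_bounded) auto
    also have "norm (X 0) + \<dots> \<le> norm (X 0) * E s + L * (E s * norm v)"
      using E(2)[of s] mult_left_mono[OF E(2) norm_ge_zero] by simp
    finally show ?thesis by (simp add: algebra_simps)
  qed
  have w_diff: "norm (w v s - w v' s) \<le> (L * dist v v') * E s" for v v' s
  proof -
    have "norm (w v s - w v' s) \<le> L * norm (E s *\<^sub>R (apply_bcontfun v s - apply_bcontfun v' s))"
      unfolding w_def scaleR_diff_right by (rule X)
    also have "\<dots> = L * (E s * dist (apply_bcontfun v s) (apply_bcontfun v' s))"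
      using E(1)[of s] by (simp add: dist_norm)
    also have "\<dots> \<le> L * (E s * dist v v')"
      using L E(1)[of s] by (intro mult_left_mono dist_bounded) auto
    finally show ?thesis by (simp add: algebra_simps)
  qed
  have J_bound: "norm (J v t) \<le> (norm (X 0) + L * norm v) / B * E t" for v t
    unfolding E_def by (rule exponential_growth[OF J(2) J(1) w_bound[unfolded E_def] B])
  have J_diff: "norm (J v t - J v' t) \<le> (L * dist v v') / B * E t" for v v' t
    unfolding E_def
    by (rule exponential_growth[OF _ _ w_diff[unfolded E_def] B, where W="\<lambda>t. J v t - J v' t"])
      (auto intro!: derivative_intros J simp: J)
  define T0 where "T0 v t = inverse (E t) *\<^sub>R (z + J v t)" for v t
  define T where "T v = Bcontfun (T0 v)" for v
  have T: "apply_bcontfun (T v) = T0 v" for v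
  proof -
    have "continuous_on UNIV (J v)"
      by (intro continuous_at_imp_continuous_on ballI has_vector_derivative_continuous[OF J(2)])
    then have "continuous_on UNIV (T0 v)"
      unfolding T0_def using E(1) by (intro continuous_intros cE) (metis less_irrefl)
    moreover have "norm (T0 v t) \<le> norm z + (norm (X 0) + L * norm v) / B" for t
    proof -
      have "norm (T0 v t) \<le> inverse (E t) * (norm z + norm (J v t))"
        using E(1)[of t] by (simp add: T0_def norm_triangle_ineq)
      also have "\<dots> \<le> inverse (E t) * (norm z * E t + (norm (X 0) + L * norm v) / B * E t)"
        using E[of t] J_bound[of v t] mult_left_mono[OF E(2) norm_ge_zero, of z t]
        by (intro mult_left_mono add_mono) auto
      also have "\<dots> = norm z + (norm (X 0) + L * norm v) / B"
        using E(1)[of t] by (simp add: field_simps)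
      finally show ?thesis .
    qed
    ultimately have "T0 v \<in> bcontfun" by (rule bcontfun_normI)
    then show ?thesis by (simp add: T_def Bcontfun_inverse)
  qed
  have "dist (T v) (T v') \<le> 1 / 2 * dist v v'" for v v'
  proof (rule dist_bound)
    fix t
    have "dist (apply_bcontfun (T v) t) (apply_bcontfun (T v') t)
        = inverse (E t) * norm (J v t - J v' t)"
      using E(1)[of t] by (simp add: T T0_def dist_norm scaleR_diff_right[symmetric])
    also have "\<dots> \<le> inverse (E t) * ((L * dist v v') / B * E t)"
      using E(1)[of t] J_diff by (intro mult_left_mono) auto
    also have "\<dots> = L / B * dist v v'" using E(1)[of t] by (simp add: field_simps)
    also have "\<dots> \<le> 1 / 2 * dist v v'"
      using L by (intro mult_right_mono) (auto simp: B_def field_simps)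
    finally show "dist (apply_bcontfun (T v) t) (apply_bcontfun (T v') t) \<le> 1 / 2 * dist v v'" .
  qed
  then obtain v where v: "T v = v"
    using banach_fix_type[of "1/2" T] by auto
  have Jv: "z + J v t = E t *\<^sub>R apply_bcontfun v t" for t
    using fun_cong[OF T, of v t] E(1)[of t] by (simp add: v T0_def)
  show ?thesis
  proof (intro exI conjI allI)
    show "z + J v 0 = z" by (simp add: J)
    show "((\<lambda>t. z + J v t) has_vector_derivative X (z + J v t)) (at t)" for t
      using has_vector_derivative_add[OF has_vector_derivative_const J(2)[of v t], of z]
      by (simp add: Jv w_def)
  qed
qed

section \<open>Uniqueness, group law and continuity of the flow\<close>

locale lipschitz_flow =
  fixes X :: "'a::euclidean_space \<Rightarrow> 'a" and L :: real and \<Phi> :: "real \<Rightarrow> 'a \<Rightarrow> 'a"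
  assumes lipschitz: "L-lipschitz_on UNIV X"
    and flow_0 [simp]: "\<Phi> 0 z = z"
    and flow_deriv: "((\<lambda>t. \<Phi> t z) has_vector_derivative X (\<Phi> t z)) (at t)"

lemma lipschitz_flow_exists:
  fixes X :: "'a::euclidean_space \<Rightarrow> 'a"
  assumes "L-lipschitz_on UNIV X"
  obtains \<Phi> where "lipschitz_flow X L \<Phi>"
proof -
  obtain \<phi> where "\<And>z. \<phi> z 0 = z \<and> (\<forall>t. (\<phi> z has_vector_derivative X (\<phi> z t)) (at t))"
    using lipschitz_ode_solution[OF assms] by metis
  then have "lipschitz_flow X L (\<lambda>t z. \<phi> z t)"
    using assms by unfold_locales auto
  then show ?thesis using that by blast
qed

context lipschitz_flow
begin

lemma X_lipschitz: "norm (X x - X y) \<le> L * norm (x - y)"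
  using lipschitz_on_normD[OF lipschitz] by simp

lemma L_nonneg: "L \<ge> 0"
  by (rule lipschitz_on_nonneg[OF lipschitz])

text \<open>The factor \<mu> serves twice: \<mu> = -1 reverses time, and \<mu> as the variable speed
  of a parametrized oval shows later that every such parametrization follows the flow.\<close>

lemma rescaled_solutions_dist:
  assumes "a \<le> b"
    and u: "\<And>t. t \<in> {a..b} \<Longrightarrow> (u has_vector_derivative \<mu> t *\<^sub>R X (u t)) (at t within {a..b})"
    and v: "\<And>t. t \<in> {a..b} \<Longrightarrow> (v has_vector_derivative \<mu> t *\<^sub>R X (v t)) (at t within {a..b})"
    and B: "\<And>t. t \<in> {a..b} \<Longrightarrow> \<bar>\<mu> t\<bar> \<le> B"
  shows "norm (u b - v b) \<le> exp (B * L * (b - a)) * norm (u a - v a)"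
proof (rule gronwall[OF \<open>a \<le> b\<close>])
  fix t assume t: "t \<in> {a..b}"
  show "((\<lambda>t. u t - v t) has_vector_derivative \<mu> t *\<^sub>R X (u t) - \<mu> t *\<^sub>R X (v t)) (at t within {a..b})"
    by (intro derivative_intros u v t)
  have "norm (\<mu> t *\<^sub>R X (u t) - \<mu> t *\<^sub>R X (v t)) = \<bar>\<mu> t\<bar> * norm (X (u t) - X (v t))"
    by (simp add: scaleR_diff_right[symmetric])
  also have "\<dots> \<le> B * (L * norm (u t - v t))"
    using B[OF t] X_lipschitz by (intro mult_mono) auto
  finally show "norm (\<mu> t *\<^sub>R X (u t) - \<mu> t *\<^sub>R X (v t)) \<le> B * L * norm (u t - v t)"
    by simp
qed

lemma solutions_dist:
  assumes u: "\<And>t. (u has_vector_derivative X (u t)) (at t)"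
    and v: "\<And>t. (v has_vector_derivative X (v t)) (at t)"
  shows "norm (u t - v t) \<le> exp (L * \<bar>t\<bar>) * norm (u 0 - v 0)"
proof (cases "t \<ge> 0")
  case True
  then show ?thesis
    using rescaled_solutions_dist[of 0 t u "\<lambda>_. 1" v 1] u v
    by (simp add: has_vector_derivative_at_within)
next
  case False
  then show ?thesis
    using rescaled_solutions_dist[of 0 "-t" "\<lambda>s. u (- s)" "\<lambda>_. -1" "\<lambda>s. v (- s)" 1]
      has_vector_derivative_reflect[OF u] has_vector_derivative_reflect[OF v]
    by (simp add: has_vector_derivative_at_within)
qed

lemma solution_eq_flow:
  assumes "\<And>t. (u has_vector_derivative X (u t)) (at t)"
  shows "u t = \<Phi> t (u 0)"
  using solutions_dist[OF assms flow_deriv, of t "u 0"] by simp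

lemma flow_add: "\<Phi> (s + t) z = \<Phi> s (\<Phi> t z)"
proof -
  have "((\<lambda>s. \<Phi> (s + t) z) has_vector_derivative X (\<Phi> (s + t) z)) (at s)" for s
  proof -
    have "((\<lambda>s. s + t) has_vector_derivative 1) (at s)"
      by (auto intro!: derivative_eq_intros)
    from vector_diff_chain_at[OF this flow_deriv] show ?thesis by (simp add: o_def)
  qed
  from solution_eq_flow[OF this, of s] show ?thesis by simp
qed

lemma dist_flow: "dist (\<Phi> t y) (\<Phi> t z) \<le> exp (L * \<bar>t\<bar>) * dist y z"
  using solutions_dist[OF flow_deriv[where z=y] flow_deriv[where z=z], of t] by (simp add: dist_norm)

text \<open>The triangle inequality through the point reached from \<open>z0\<close> at the varying
  time separates the two variables: \<open>dist_flow\<close> controls the change of the initial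
  value, differentiability the change of time.\<close>

lemma flow_continuous: "continuous_on UNIV (\<lambda>(t, z). \<Phi> t z)"
proof (rule continuous_at_imp_continuous_on, rule ballI)
  fix p :: "real \<times> 'a"
  obtain t0 z0 where p: "p = (t0, z0)" by fastforce
  have "isCont (\<lambda>t. \<Phi> t z0) t0"
    using flow_deriv has_vector_derivative_continuous by blast
  then have c: "((\<lambda>q. \<Phi> (fst q) z0) \<longlongrightarrow> \<Phi> t0 z0) (at p)"
    by (rule isCont_tendsto_compose) (auto intro!: tendsto_eq_intros simp: p)
  have "((\<lambda>q. exp (L * \<bar>fst q\<bar>) * dist (snd q) z0 + dist (\<Phi> (fst q) z0) (\<Phi> t0 z0)) \<longlongrightarrow>
      exp (L * \<bar>t0\<bar>) * dist z0 z0 + dist (\<Phi> t0 z0) (\<Phi> t0 z0)) (at p)"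
    by (intro tendsto_intros c) (auto intro!: tendsto_eq_intros simp: p)
  then have "((\<lambda>q. exp (L * \<bar>fst q\<bar>) * dist (snd q) z0 + dist (\<Phi> (fst q) z0) (\<Phi> t0 z0)) \<longlongrightarrow> 0) (at p)"
    by simp
  moreover have "dist (\<Phi> (fst q) (snd q)) (\<Phi> t0 z0)
      \<le> exp (L * \<bar>fst q\<bar>) * dist (snd q) z0 + dist (\<Phi> (fst q) z0) (\<Phi> t0 z0)" for q
    using dist_triangle[of "\<Phi> (fst q) (snd q)" "\<Phi> t0 z0" "\<Phi> (fst q) z0"] dist_flow[of "fst q" "snd q" z0]
    by linarith
  ultimately have "((\<lambda>q. dist (\<Phi> (fst q) (snd q)) (\<Phi> t0 z0)) \<longlongrightarrow> 0) (at p)"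
    by (elim Lim_null_comparison[rotated]) (auto simp: real_norm_def)
  then show "isCont (\<lambda>(t, z). \<Phi> t z) p"
    unfolding isCont_def p case_prod_unfold fst_conv snd_conv by (rule tendsto_dist_iff[THEN iffD2])
qed

lemma continuous_on_flow [continuous_intros]:
  "continuous_on S f \<Longrightarrow> continuous_on S g \<Longrightarrow> continuous_on S (\<lambda>x. \<Phi> (f x) (g x))"
  using continuous_on_compose2[OF flow_continuous, of S "\<lambda>x. (f x, g x)"]
  by (auto intro: continuous_on_Pair)

lemma flow_periodic:
  assumes "\<Phi> T z = z"
  shows "\<Phi> (t + T) z = \<Phi> t z" "\<Phi> (t + real n * T) z = \<Phi> t z"
proof -
  show 1: "\<Phi> (t + T) z = \<Phi> t z" for t
    using assms by (simp add: flow_add)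
  show "\<Phi> (t + real n * T) z = \<Phi> t z"
  proof (induction n)
    case (Suc n)
    then show ?case using 1[of "t + real n * T"] by (simp add: algebra_simps)
  qed simp
qed

lemma flow_periodic_reduce:
  assumes "\<Phi> T z = z" "T > 0"
  obtains n :: int and r where "t = r + of_int n * T" "0 \<le> r" "r < T" "\<Phi> t z = \<Phi> r z"
    "t \<ge> 0 \<Longrightarrow> n \<ge> 0"
proof -
  define n where "n = \<lfloor>t / T\<rfloor>"
  define r where "r = t - of_int n * T"
  have "0 \<le> r" "r < T"
    using floor_divide_lower[OF \<open>T > 0\<close>, of t] floor_divide_upper[OF \<open>T > 0\<close>, of t]
    by (auto simp: r_def n_def algebra_simps)
  moreover have "\<Phi> t z = \<Phi> r z"
  proof (cases "n \<ge> 0")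
    case True
    then show ?thesis
      using flow_periodic(2)[OF assms(1), of r "nat n"] by (simp add: r_def)
  next
    case False
    then show ?thesis
      using flow_periodic(2)[OF assms(1), of t "nat (- n)"] by (simp add: r_def)
  qed
  moreover have "t \<ge> 0 \<Longrightarrow> n \<ge> 0" using assms(2) by (simp add: n_def)
  moreover have "t = r + of_int n * T" by (simp add: r_def)
  ultimately show ?thesis using that by blast
qed

end

section \<open>Lipschitz extensions and crossing times\<close>

text \<open>McShane's formula.\<close>

lemma lipschitz_extension_real:
  fixes F :: "'a::metric_space \<Rightarrow> real"
  assumes "L-lipschitz_on N F"
  obtains G where "L-lipschitz_on UNIV G" "\<And>x. x \<in> N \<Longrightarrow> G x = F x"
proof (cases "N = {}")
  case True
  have "L-lipschitz_on UNIV (\<lambda>_::'a. 0::real)"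
    using lipschitz_on_nonneg[OF assms] by (intro lipschitz_onI) auto
  then show ?thesis using that True by blast
next
  case False
  have L: "L \<ge> 0" using lipschitz_on_nonneg[OF assms] .
  have F: "\<bar>F x - F y\<bar> \<le> L * dist x y" if "x \<in> N" "y \<in> N" for x y
    using lipschitz_onD[OF assms that] by (simp add: dist_real_def)
  define G where "G z = (INF w\<in>N. F w + L * dist w z)" for z
  obtain w0 where w0: "w0 \<in> N" using False by blast
  have bdd: "bdd_below ((\<lambda>w. F w + L * dist w z) ` N)" for z
  proof (rule bdd_belowI2)
    fix w assume w: "w \<in> N"
    have "L * dist w w0 \<le> L * (dist w z + dist z w0)"
      using L by (intro mult_left_mono dist_triangle) auto
    then show "F w0 - L * dist z w0 \<le> F w + L * dist w z"
      using F[OF w w0] by (simp add: algebra_simps)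
  qed
  have le: "G z \<le> G z' + L * dist z z'" for z z'
  proof -
    have "G z - L * dist z z' \<le> F w + L * dist w z'" if w: "w \<in> N" for w
    proof -
      have "G z \<le> F w + L * dist w z"
        unfolding G_def by (rule cINF_lower[OF bdd w])
      moreover have "L * dist w z \<le> L * (dist w z' + dist z z')"
        using L by (intro mult_left_mono) (auto intro: dist_triangle2)
      ultimately show ?thesis by (simp add: algebra_simps)
    qed
    then have "G z - L * dist z z' \<le> G z'"
      unfolding G_def[of z'] by (intro cINF_greatest False)
    then show ?thesis by simp
  qed
  have "L-lipschitz_on UNIV G"
  proof (rule lipschitz_onI[OF _ L])
    show "dist (G z) (G z') \<le> L * dist z z'" for z z'
      using le[of z z'] le[of z' z] by (simp add: dist_real_def dist_commute abs_le_iff)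
  qed
  moreover have "G x = F x" if x: "x \<in> N" for x
  proof (rule antisym)
    show "G x \<le> F x" using cINF_lower[OF bdd x, of x] by (simp add: G_def)
    show "F x \<le> G x"
      unfolding G_def
    proof (rule cINF_greatest[OF False])
      fix w assume "w \<in> N"
      then show "F x \<le> F w + L * dist w x"
        using F[OF x, of w] by (simp add: dist_commute abs_le_iff)
    qed
  qed
  ultimately show ?thesis using that by blast
qed

text \<open>\<open>N\<close> may fail to be convex, so the mean value inequality is used only on
  small balls, and compactness passes from local to global. \<open>Ck_on\<close> gives continuity of
  the derivative one direction at a time; summing the bounds over the basis bounds the operator
  norm.\<close>

lemma Ck_on_1_lipschitz_on_compact:
  fixes F :: "'a::euclidean_space \<Rightarrow> real"
  assumes "Ck_on 1 F S" "open S" "compact N" "N \<subseteq> S"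
  obtains L where "L-lipschitz_on N F"
proof -
  have d: "(F has_derivative frechet_derivative F (at x)) (at x)" if "x \<in> S" for x
    using Ck_on_has_derivative[of 0] assms(1) that by simp
  have c: "continuous_on S (\<lambda>x. frechet_derivative F (at x) v)" for v
    using assms(1) by simp
  \<comment> \<open>\<open>local_lipschitz\<close> speaks of time-dependent maps; the set of times
    is the dummy singleton of 0.\<close>
  have "local_lipschitz {0::real} S (\<lambda>_. F)"
  proof (rule local_lipschitzI)
    fix x assume "x \<in> S"
    then obtain u where u: "u > 0" "cball x u \<subseteq> S"
      using \<open>open S\<close> open_contains_cball by blast
    have "\<exists>C. \<forall>y\<in>cball x u. norm (frechet_derivative F (at y) b) \<le> C" for b
    proof -
      have "compact ((\<lambda>y. frechet_derivative F (at y) b) ` cball x u)"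
        by (intro compact_continuous_image continuous_on_subset[OF c u(2)]) simp
      then show ?thesis
        by (meson bounded_iff compact_imp_bounded image_eqI)
    qed
    then obtain C where C: "\<And>b y. y \<in> cball x u \<Longrightarrow> norm (frechet_derivative F (at y) b) \<le> C b"
      by metis
    define B where "B = (\<Sum>b\<in>Basis. C b)"
    have on: "onorm (frechet_derivative F (at y)) \<le> B" if y: "y \<in> cball x u" for y
    proof (rule onorm_le)
      fix v :: 'a
      have lin: "linear (frechet_derivative F (at y))"
        using d has_derivative_linear u(2) y by blast
      have "frechet_derivative F (at y) v = frechet_derivative F (at y) (\<Sum>b\<in>Basis. (v \<bullet> b) *\<^sub>R b)"
        by (simp add: euclidean_representation)
      also have "\<dots> = (\<Sum>b\<in>Basis. (v \<bullet> b) * frechet_derivative F (at y) b)"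
        by (simp add: linear_sum[OF lin] linear_cmul[OF lin])
      also have "norm \<dots> \<le> (\<Sum>b\<in>Basis. norm v * C b)"
        using C[OF y] Basis_le_norm
        by (intro sum_norm_le) (auto simp: abs_mult intro!: mult_mono)
      finally show "norm (frechet_derivative F (at y) v) \<le> B * norm v"
        by (simp add: B_def sum_distrib_left mult.commute)
    qed
    have "norm (F y - F z) \<le> B * norm (y - z)" if "y \<in> cball x u" "z \<in> cball x u" for y z
      using u(2) that
      by (intro differentiable_bound[OF convex_cball has_derivative_at_withinI[OF d] on]) auto
    moreover have "B \<ge> 0"
      using C[of x] u(1) unfolding B_def by (meson centre_in_cball less_imp_le norm_ge_zero order_trans sum_nonneg)
    ultimately have "B-lipschitz_on (cball x u \<inter> S) F"
      by (intro lipschitz_onI) (auto simp: dist_norm)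
    then show "\<exists>u>0. \<exists>L. \<forall>t\<in>cball t u \<inter> {0}. L-lipschitz_on (cball x u \<inter> S) F" for t :: real
      using u(1) by blast
  qed
  then have "local_lipschitz {0::real} N (\<lambda>_. F)"
    by (rule local_lipschitz_subset) (use assms in auto)
  from local_lipschitz_compact_implies_lipschitz[OF this assms(3)] that show ?thesis
    by auto
qed

text \<open>An implicit function theorem that rests on monotonicity in t alone: for z near
  \<open>z0\<close>, \<xi> increases strictly on a window around T and changes sides of c between
  its ends. It is later applied with z a point of the phase space, \<xi> its first coordinate along
  the flow and v the second.\<close>

lemma crossing_time_pos:
  fixes \<xi> v :: "real \<Rightarrow> 'a::metric_space \<Rightarrow> real"
  assumes d: "\<And>t z. ((\<lambda>t. \<xi> t z) has_real_derivative v t z) (at t)"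
    and c\<xi>: "continuous_on UNIV (\<lambda>(t, z). \<xi> t z)" and cv: "continuous_on UNIV (\<lambda>(t, z). v t z)"
    and "v T z0 > 0" "\<xi> T z0 = c" "\<eta> > 0"
  obtains \<delta> \<tau> where "\<delta> > 0" "continuous_on (ball z0 \<delta>) \<tau>"
    "\<And>z. z \<in> ball z0 \<delta> \<Longrightarrow> \<bar>\<tau> z - T\<bar> < \<eta> \<and> \<xi> (\<tau> z) z = c"
proof -
  have "open {p. 0 < (\<lambda>(t, z). v t z) p}"
    by (intro open_Collect_less continuous_intros cv)
  moreover have "(T, z0) \<in> {p. 0 < (\<lambda>(t, z). v t z) p}" using assms(4) by simp
  ultimately obtain A B where "open A" "open B" "(T, z0) \<in> A \<times> B"
    and "A \<times> B \<subseteq> {p. 0 < (\<lambda>(t, z). v t z) p}"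
    by (rule open_prod_elim)
  then have AB: "open A" "open B" "T \<in> A" "z0 \<in> B" "\<And>t z. t \<in> A \<Longrightarrow> z \<in> B \<Longrightarrow> 0 < v t z"
    by auto
  obtain e where e: "e > 0" "ball T e \<subseteq> A" using AB openE by blast
  define \<eta>' where "\<eta>' = min (\<eta> / 2) (e / 2)"
  have \<eta>': "\<eta>' > 0" "\<eta>' < \<eta>" "\<eta>' < e" using assms(6) e(1) by (auto simp: \<eta>'_def)
  have mono: "\<xi> s z < \<xi> t z" if "z \<in> B" "T - \<eta>' \<le> s" "s < t" "t \<le> T + \<eta>'" for s t z
  proof (rule DERIV_pos_imp_increasing[OF \<open>s < t\<close>])
    fix r assume "s \<le> r" "r \<le> t"
    then have "r \<in> A" using that \<eta>' e(2) by (auto simp: dist_real_def)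
    then show "\<exists>y. ((\<lambda>t. \<xi> t z) has_real_derivative y) (at r) \<and> 0 < y"
      using d[where t=r and z=z] AB(5)[where t=r and z=z] that(1) by (intro exI conjI)
  qed
  have c2: "continuous_on UNIV (\<lambda>z. \<xi> t z)" for t
    using continuous_on_compose2[OF c\<xi> continuous_on_Pair[OF continuous_on_const continuous_on_id]]
    by simp
  have lo: "open {z. \<xi> t z < c}" and hi: "open {z. c < \<xi> t z}" for t
    by (intro open_Collect_less continuous_intros c2)+
  define N where "N = B \<inter> {z. \<xi> (T - \<eta>') z < c} \<inter> {z. c < \<xi> (T + \<eta>') z}"
  have "open N" unfolding N_def by (intro open_Int AB(2) lo hi)
  moreover have "z0 \<in> N"
    using mono[OF AB(4), of "T - \<eta>'" T] mono[OF AB(4), of T "T + \<eta>'"] \<eta>'(1) AB(4) assms(5)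
    by (auto simp: N_def)
  ultimately obtain \<delta> where \<delta>: "\<delta> > 0" "ball z0 \<delta> \<subseteq> N" using openE by blast
  have "\<exists>t. \<bar>t - T\<bar> < \<eta>' \<and> \<xi> t z = c" if z: "z \<in> N" for z
  proof -
    have "continuous_on {T - \<eta>'..T + \<eta>'} (\<lambda>t. \<xi> t z)"
      by (intro continuous_at_imp_continuous_on ballI DERIV_isCont[OF d])
    then obtain t where "T - \<eta>' \<le> t" "t \<le> T + \<eta>'" "\<xi> t z = c"
      using IVT'[of "\<lambda>t. \<xi> t z" "T - \<eta>'" c "T + \<eta>'"] z \<eta>'(1) by (auto simp: N_def)
    moreover have "t \<noteq> T - \<eta>'" "t \<noteq> T + \<eta>'" using z \<open>\<xi> t z = c\<close> by (auto simp: N_def)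
    ultimately show ?thesis by (intro exI[of _ t]) auto
  qed
  then obtain \<tau> where \<tau>: "\<And>z. z \<in> N \<Longrightarrow> \<bar>\<tau> z - T\<bar> < \<eta>' \<and> \<xi> (\<tau> z) z = c" by metis
  have "continuous_on N \<tau>"
  proof (rule continuous_at_imp_continuous_on, rule ballI)
    fix z assume z: "z \<in> N"
    show "isCont \<tau> z"
      unfolding isCont_def
    proof (rule tendstoI)
      fix \<epsilon> :: real assume "\<epsilon> > 0"
      \<comment> \<open>The shifted times \<tau> z - r and \<tau> z + r stay in the window of
        monotonicity. There \<xi> lies strictly below and above c; this persists for y near z and
        traps \<tau> y between the two times.\<close>
      define r where "r = Min {\<epsilon>, \<tau> z - (T - \<eta>'), T + \<eta>' - \<tau> z}"
      have r: "r > 0" "r \<le> \<epsilon>" "T - \<eta>' \<le> \<tau> z - r" "\<tau> z + r \<le> T + \<eta>'"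
        using \<tau>[OF z] \<open>\<epsilon> > 0\<close> by (auto simp: r_def abs_less_iff)
      have zB: "z \<in> B" using z by (simp add: N_def)
      have "z \<in> N \<inter> {z. \<xi> (\<tau> z - r) z < c} \<inter> {z. c < \<xi> (\<tau> z + r) z}"
        using mono[OF zB, of "\<tau> z - r" "\<tau> z"] mono[OF zB, of "\<tau> z" "\<tau> z + r"] r \<tau>[OF z] z by auto
      then have "z \<in> N \<inter> {y. \<xi> (\<tau> z - r) y < c} \<inter> {y. c < \<xi> (\<tau> z + r) y}" by auto
      moreover have "open (N \<inter> {y. \<xi> (\<tau> z - r) y < c} \<inter> {y. c < \<xi> (\<tau> z + r) y})"
        by (intro open_Int \<open>open N\<close> lo hi)
      ultimately have "\<forall>\<^sub>F y in at z. y \<in> N \<inter> {y. \<xi> (\<tau> z - r) y < c} \<inter> {y. c < \<xi> (\<tau> z + r) y}"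
        by (intro eventually_at_in_open')
      then show "\<forall>\<^sub>F y in at z. dist (\<tau> y) (\<tau> z) < \<epsilon>"
      proof (rule eventually_mono)
        fix y assume y: "y \<in> N \<inter> {y. \<xi> (\<tau> z - r) y < c} \<inter> {y. c < \<xi> (\<tau> z + r) y}"
        then have yB: "y \<in> B" by (simp add: N_def)
        have w: "T - \<eta>' \<le> \<tau> y" "\<tau> y \<le> T + \<eta>'"
          using \<tau>[of y] y by (auto simp: abs_less_iff)
        have "\<tau> z - r < \<tau> y"
        proof (rule ccontr)
          assume "\<not> \<tau> z - r < \<tau> y"
          then have "\<xi> (\<tau> y) y \<le> \<xi> (\<tau> z - r) y"
            using mono[OF yB, of "\<tau> y" "\<tau> z - r"] \<tau>[of y] \<tau>[OF z] y r w
            by (cases "\<tau> y = \<tau> z - r") auto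
          then show False using \<tau>[of y] y by auto
        qed
        moreover have "\<tau> y < \<tau> z + r"
        proof (rule ccontr)
          assume "\<not> \<tau> y < \<tau> z + r"
          then have "\<xi> (\<tau> z + r) y \<le> \<xi> (\<tau> y) y"
            using mono[OF yB, of "\<tau> z + r" "\<tau> y"] \<tau>[of y] \<tau>[OF z] y r w
            by (cases "\<tau> y = \<tau> z + r") auto
          then show False using \<tau>[of y] y by auto
        qed
        ultimately show "dist (\<tau> y) (\<tau> z) < \<epsilon>" using r by (simp add: dist_real_def)
      qed
    qed
  qed
  then have "continuous_on (ball z0 \<delta>) \<tau>" using \<delta>(2) continuous_on_subset by blast
  then show ?thesis
    using that[OF \<delta>(1)] \<tau> \<delta>(2) \<eta>' by (meson order_less_trans subsetD)
qed

lemma crossing_time: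
  fixes \<xi> v :: "real \<Rightarrow> 'a::metric_space \<Rightarrow> real"
  assumes d: "\<And>t z. ((\<lambda>t. \<xi> t z) has_real_derivative v t z) (at t)"
    and c\<xi>: "continuous_on UNIV (\<lambda>(t, z). \<xi> t z)" and cv: "continuous_on UNIV (\<lambda>(t, z). v t z)"
    and "v T z0 \<noteq> 0" "\<xi> T z0 = c" "\<eta> > 0"
  obtains \<delta> \<tau> where "\<delta> > 0" "continuous_on (ball z0 \<delta>) \<tau>"
    "\<And>z. z \<in> ball z0 \<delta> \<Longrightarrow> \<bar>\<tau> z - T\<bar> < \<eta> \<and> \<xi> (\<tau> z) z = c"
proof (cases "v T z0 > 0")
  case True
  then show ?thesis using crossing_time_pos[OF d c\<xi> cv True assms(5,6)] that by blast
next
  case False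
  have "((\<lambda>t. - \<xi> t z) has_real_derivative - v t z) (at t)" for t z
    using d by (auto intro!: derivative_intros)
  moreover have "continuous_on UNIV (\<lambda>(t, z). - \<xi> t z)" "continuous_on UNIV (\<lambda>(t, z). - v t z)"
    using c\<xi> cv by (auto simp: case_prod_unfold intro!: continuous_intros)
  ultimately obtain \<delta> \<tau> where "\<delta> > 0" "continuous_on (ball z0 \<delta>) \<tau>"
    "\<And>z. z \<in> ball z0 \<delta> \<Longrightarrow> \<bar>\<tau> z - T\<bar> < \<eta> \<and> - \<xi> (\<tau> z) z = - c"
    using crossing_time_pos[of "\<lambda>t z. - \<xi> t z" "\<lambda>t z. - v t z" T z0 "- c" \<eta>] False assms(4-6)
    by (smt (verit))
  then show ?thesis using that by auto
qed

section \<open>The unperturbed ovals\<close>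

locale planar_oscillator =
  fixes V0 :: "(real \<times> real) set" and k xc :: real and f s H :: "real \<times> real \<Rightarrow> real"
    and I :: "real set" and g :: "(real \<times> real) \<times> real \<Rightarrow> real"
  assumes open_V0: "open V0" and open_I: "open I" and zero_I: "0 \<in> I"
    and f_C1: "Ck_on 1 f V0" and g_C1: "Ck_on 1 g (V0 \<times> I)"
    and equilibrium: "{x. (x, 0) \<in> V0 \<and> f (x, 0) + k = 0} = {xc}"
    and energy: "property_B_ii k V0 f xc s H"
begin

definition field :: "real \<times> real \<Rightarrow> real \<times> real" where
  "field p = (snd p, k + f p)"

lemma s_pos: "p \<in> V0 \<Longrightarrow> s p > 0"
  using energy by (simp add: property_B_ii_def)

lemma continuous_on_s: "continuous_on V0 s"
  using energy Ck_on_mono[of 1 s V0 0] by (simp add: property_B_ii_def)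

lemma continuous_on_f: "continuous_on V0 f"
  using Ck_on_mono[OF f_C1, of 0] by simp

lemma continuous_on_g: "continuous_on (V0 \<times> I) g"
  using Ck_on_mono[OF g_C1, of 0] by simp

lemma continuous_on_field: "continuous_on V0 field"
  unfolding field_def by (intro continuous_intros continuous_on_f)

text \<open>C^2 smoothness supplies the total derivative; the partial derivatives prescribed by
  condition (ii) then determine it.\<close>

lemma H_has_derivative:
  assumes "p \<in> V0"
  shows "(H has_derivative (\<lambda>v. (- (f p + k) * fst v + snd p * snd v) / s p)) (at p)"
proof -
  obtain x y where p: "p = (x, y)" by fastforce
  define D where "D = frechet_derivative H (at p)"
  have D: "(H has_derivative D) (at p)"
    using energy assms Ck_on_has_derivative[of 1 H V0 p] by (simp add: property_B_ii_def D_def numeral_2_eq_2)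
  have "((\<lambda>x'. (x', y)) has_derivative (\<lambda>h. (h, 0))) (at x)"
    by (auto intro!: derivative_eq_intros)
  from diff_chain_at[OF this, of H D] D have "((\<lambda>x'. H (x', y)) has_derivative (\<lambda>h. D (h, 0))) (at x)"
    by (simp add: p o_def)
  moreover have "((\<lambda>x'. H (x', y)) has_derivative (*) (- ((f p + k) / s p))) (at x)"
    using energy assms by (simp add: property_B_ii_def p has_field_derivative_def)
  ultimately have Dx: "D (h, 0) = - ((f p + k) / s p) * h" for h
    using has_derivative_unique by metis
  have "((\<lambda>y'. (x, y')) has_derivative (\<lambda>h. (0, h))) (at y)"
    by (auto intro!: derivative_eq_intros)
  from diff_chain_at[OF this, of H D] D have "((\<lambda>y'. H (x, y')) has_derivative (\<lambda>h. D (0, h))) (at y)"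
    by (simp add: p o_def)
  moreover have "((\<lambda>y'. H (x, y')) has_derivative (*) (y / s p)) (at y)"
    using energy assms by (simp add: property_B_ii_def p has_field_derivative_def)
  ultimately have Dy: "D (0, h) = y / s p * h" for h
    using has_derivative_unique by metis
  have "D = (\<lambda>v. (- (f p + k) * fst v + snd p * snd v) / s p)"
  proof
    fix v :: "real \<times> real"
    have "D v = D ((fst v, 0) + (0, snd v))" by simp
    also have "\<dots> = D (fst v, 0) + D (0, snd v)"
      using has_derivative_linear[OF D] linear_add by blast
    finally show "D v = (- (f p + k) * fst v + snd p * snd v) / s p"
      using Dx Dy s_pos[OF assms] by (simp add: p field_simps)
  qed
  with D show ?thesis by simp
qed

text \<open>The gradient of \<open>H\<close> is the field turned by a right angle and divided by
  \<open>s\<close>. So the rate is 0 for the field itself, and only the perturbing term contributes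
  for a perturbed one.\<close>

lemma H_along:
  assumes "(\<phi> has_vector_derivative v) (at t)" "\<phi> t \<in> V0"
  shows "((\<lambda>t. H (\<phi> t)) has_real_derivative
    (- (f (\<phi> t) + k) * fst v + snd (\<phi> t) * snd v) / s (\<phi> t)) (at t)"
proof -
  have "(\<phi> has_derivative (\<lambda>h. h *\<^sub>R v)) (at t)"
    using assms(1) by (simp add: has_vector_derivative_def)
  from diff_chain_at[OF this H_has_derivative[OF assms(2)]]
  have "((\<lambda>t. H (\<phi> t)) has_derivative
      (\<lambda>h. (- (f (\<phi> t) + k) * fst (h *\<^sub>R v) + snd (\<phi> t) * snd (h *\<^sub>R v)) / s (\<phi> t))) (at t)"
    by (simp only: o_def)
  then show ?thesis
    unfolding has_field_derivative_def
    by (rule has_derivative_eq_rhs)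
      (auto simp: fun_eq_iff algebra_simps diff_divide_distrib add_divide_distrib)
qed

text \<open>A zero of the field lies on the axis y = 0 and solves f + k = 0 there, so it is the
  point (xc, 0), at which \<open>H\<close> vanishes.\<close>

lemma field_nonzero:
  assumes "p \<in> V0" "H p \<noteq> 0"
  shows "field p \<noteq> 0"
proof
  assume "field p = 0"
  then have "fst p \<in> {x. (x, 0) \<in> V0 \<and> f (x, 0) + k = 0}" "snd p = 0"
    using assms(1) by (auto simp: field_def zero_prod_def prod_eq_iff add.commute) (metis prod.collapse)+
  then have "p = (xc, 0)" unfolding equilibrium by (simp add: prod_eq_iff)
  with assms(2) energy show False by (simp add: property_B_ii_def)
qed

text \<open>The partial derivative y / s has the sign of y. The factor \<open>y0\<close> in the
  conclusion treats the upper and the lower half-plane at once.\<close>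

lemma H_vertical_mono:
  assumes "(x0, y0) \<in> V0" "y0 \<noteq> 0"
  obtains \<rho> where "\<rho> > 0" "\<And>y. \<bar>y - y0\<bar> < \<rho> \<Longrightarrow> (x0, y) \<in> V0 \<and> y0 * y > 0"
    "\<And>y y'. \<bar>y - y0\<bar> < \<rho> \<Longrightarrow> \<bar>y' - y0\<bar> < \<rho> \<Longrightarrow> y < y' \<Longrightarrow> y0 * (H (x0, y') - H (x0, y)) > 0"
proof -
  obtain e where e: "e > 0" "ball (x0, y0) e \<subseteq> V0" using open_V0 assms(1) openE by blast
  define \<rho> where "\<rho> = min e \<bar>y0\<bar>"
  have \<rho>: "\<rho> > 0" using e assms by (simp add: \<rho>_def)
  have V: "(x0, y) \<in> V0" "y0 * y > 0" if "\<bar>y - y0\<bar> < \<rho>" for y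
  proof -
    have "(x0, y) \<in> ball (x0, y0) e"
      using that by (simp add: dist_Pair_Pair dist_real_def \<rho>_def abs_minus_commute)
    then show "(x0, y) \<in> V0" using e by blast
    show "y0 * y > 0" using that by (auto simp: \<rho>_def zero_less_mult_iff abs_if split: if_splits)
  qed
  have "y0 * (H (x0, y') - H (x0, y)) > 0"
    if "\<bar>y - y0\<bar> < \<rho>" "\<bar>y' - y0\<bar> < \<rho>" "y < y'" for y y'
  proof -
    have z: "\<bar>z - y0\<bar> < \<rho>" if "y \<le> z" "z \<le> y'" for z
      using that \<open>\<bar>y - y0\<bar> < \<rho>\<close> \<open>\<bar>y' - y0\<bar> < \<rho>\<close> by linarith
    have "((\<lambda>y. H (x0, y)) has_real_derivative z / s (x0, z)) (at z)" if "y \<le> z" "z \<le> y'" for z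
      using energy V(1)[OF z[OF that]] by (simp add: property_B_ii_def)
    then obtain z where z': "y < z" "z < y'" "H (x0, y') - H (x0, y) = (y' - y) * (z / s (x0, z))"
      using MVT2[OF \<open>y < y'\<close>, of "\<lambda>y. H (x0, y)" "\<lambda>z. z / s (x0, z)"] by blast
    have "y0 * z > 0" "s (x0, z) > 0" using V[OF z] s_pos z' by auto
    moreover have "y0 * (H (x0, y') - H (x0, y)) = (y0 * z) * ((y' - y) / s (x0, z))"
      using z'(3) by (simp add: field_simps)
    ultimately show ?thesis using \<open>y < y'\<close> by (simp only: mult_pos_pos divide_pos_pos diff_gt_0_iff_gt)
  qed
  with \<rho> V that show ?thesis by blast
qed

text \<open>Only the second component needs extending, as the first one is linear. The extended
  field has a flow defined for all times.\<close>

lemma lipschitz_field_extension: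
  assumes "compact K" "K \<subseteq> V0"
  obtains F L where "L-lipschitz_on UNIV (\<lambda>p. (snd p, F p))" "\<And>p. p \<in> K \<Longrightarrow> F p = k + f p"
proof -
  have "Ck_on 1 (\<lambda>p. k + f p) V0"
    by (intro Ck_on_add open_V0 Ck_on_const f_C1)
  then obtain L where "L-lipschitz_on K (\<lambda>p. k + f p)"
    using Ck_on_1_lipschitz_on_compact[OF _ open_V0 assms] by blast
  then obtain F where F: "L-lipschitz_on UNIV F" "\<And>p. p \<in> K \<Longrightarrow> F p = k + f p"
    using lipschitz_extension_real by blast
  have "1-lipschitz_on UNIV (\<lambda>p::real \<times> real. snd p)"
    by (intro lipschitz_onI) (auto simp: dist_snd_le)
  from lipschitz_on_Pair[OF this F(1)] F(2) that show ?thesis by blast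
qed

end

lemma compact_neighbourhood_in_open:
  fixes C :: "'a::euclidean_space set"
  assumes "compact C" "open V" "C \<subseteq> V" "C \<noteq> {}"
  obtains r where "r > 0" "compact {p. infdist p C \<le> r}" "{p. infdist p C \<le> r} \<subseteq> V"
proof -
  obtain r where r: "r > 0" "(\<Union>x\<in>C. cball x r) \<subseteq> V"
    using compact_subset_open_imp_cball_epsilon_subset[OF assms(1,2,3)] by blast
  have "p \<in> V" if "infdist p C \<le> r" for p
  proof -
    obtain x where "x \<in> C" "infdist p C = dist p x"
      using infdist_attains_inf[OF compact_imp_closed[OF assms(1)] assms(4)] by blast
    then have "p \<in> cball x r" using that by (simp add: dist_commute)
    then show ?thesis using r(2) \<open>x \<in> C\<close> by blast
  qed
  then show ?thesis
    using that[OF r(1)] compact_infdist_le[OF assms(4,1) r(1)] by blast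
qed

section \<open>An oval as a single periodic orbit\<close>

locale oval = planar_oscillator +
  fixes h :: real
  assumes h_pos: "h > 0" and oval: "closed_oval_around (xc, 0) (level_set V0 H h)"
begin

abbreviation "C \<equiv> level_set V0 H h"

lemma C_iff: "p \<in> C \<longleftrightarrow> p \<in> V0 \<and> H p = h"
  by (simp add: level_set_def)

lemma C_subset: "C \<subseteq> V0"
  by (auto simp: C_iff)

lemma C_topology: "compact C" "connected C" "C \<noteq> {}"
proof -
  obtain \<gamma> where "simple_path \<gamma>" "path_image \<gamma> = C"
    using oval unfolding closed_oval_around_def by blast
  then show "compact C" "connected C" "C \<noteq> {}"
    using compact_path_image connected_path_image path_image_nonempty simple_path_imp_path by metis+
qed

end

text \<open>\<open>F\<close> agrees with the original field only on the neighbourhood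
  \<open>N\<close> of the oval. As orbits that start on the oval stay on it, they are orbits of the
  original field.\<close>

locale oval_flow = oval + lipschitz_flow "\<lambda>p. (snd p, F p)" L \<Phi>
  for F :: "real \<times> real \<Rightarrow> real" and L :: real and \<Phi> :: "real \<Rightarrow> real \<times> real \<Rightarrow> real \<times> real" +
  fixes N :: "(real \<times> real) set"
  assumes N: "open N" "C \<subseteq> N" "N \<subseteq> V0" and F_eq: "\<And>p. p \<in> N \<Longrightarrow> F p = k + f p"
begin

text \<open>The times spent on the oval form a closed set because the oval is compact, and an open
  one because \<open>H\<close> is constant along the orbit as long as it remains in
  \<open>N\<close>. The line is connected.\<close>

lemma flow_in_C:
  assumes "p \<in> C"
  shows "\<Phi> t p \<in> C"
proof -
  define S where "S = {t. \<Phi> t p \<in> C}"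
  have c: "continuous_on UNIV (\<lambda>t. \<Phi> t p)" by (intro continuous_intros)
  have "closed S"
    using continuous_closed_vimage[of C "\<lambda>t. \<Phi> t p"] compact_imp_closed[OF C_topology(1)] c
    by (simp add: S_def vimage_def continuous_on_eq_continuous_at)
  moreover have "open S"
    unfolding open_contains_ball
  proof
    fix t assume t: "t \<in> S"
    have "open {t. \<Phi> t p \<in> N}"
      using continuous_open_vimage[of N "\<lambda>t. \<Phi> t p"] N(1) c
      by (simp add: vimage_def continuous_on_eq_continuous_at)
    moreover have "t \<in> {t. \<Phi> t p \<in> N}" using t N by (auto simp: S_def)
    ultimately obtain e where "e > 0" "ball t e \<subseteq> {t. \<Phi> t p \<in> N}"
      by (rule openE)
    then have e: "e > 0" "\<And>r. r \<in> ball t e \<Longrightarrow> \<Phi> r p \<in> N" by auto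
    have "\<Phi> r p \<in> C" if r: "r \<in> ball t e" for r
    proof -
      have "((\<lambda>t. H (\<Phi> t p)) has_real_derivative 0) (at u within ball t e)" if "u \<in> ball t e" for u
      proof (rule has_field_derivative_at_within)
        have "\<Phi> u p \<in> V0" using e(2)[OF that] N(3) by blast
        from H_along[OF flow_deriv this] show "((\<lambda>t. H (\<Phi> t p)) has_real_derivative 0) (at u)"
          by (simp add: F_eq[OF e(2)[OF that]] algebra_simps)
      qed
      then obtain c where "\<And>u. u \<in> ball t e \<Longrightarrow> H (\<Phi> u p) = c"
        using has_field_derivative_zero_constant[OF convex_ball] by blast
      then have "H (\<Phi> r p) = H (\<Phi> t p)" using r e(1) by simp
      then show ?thesis using t e(2)[OF r] N(3) by (auto simp: S_def C_iff)
    qed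
    then show "\<exists>e>0. ball t e \<subseteq> S" using e(1) by (auto simp: S_def)
  qed
  moreover have "0 \<in> S" using assms by (simp add: S_def)
  ultimately have "S = UNIV" using clopen[of S] by blast
  then show ?thesis by (auto simp: S_def)
qed

lemma flow_deriv_C:
  assumes "p \<in> C"
  shows "((\<lambda>t. \<Phi> t p) has_vector_derivative field (\<Phi> t p)) (at t)"
proof -
  have "F (\<Phi> t p) = k + f (\<Phi> t p)" using F_eq N(2) flow_in_C[OF assms] by blast
  then show ?thesis using flow_deriv[of p t] by (simp add: field_def)
qed

lemma field_nonzero_C: "p \<in> C \<Longrightarrow> field p \<noteq> 0"
  using field_nonzero h_pos by (auto simp: C_iff)

lemma fst_flow_deriv: "((\<lambda>t. fst (\<Phi> t p)) has_real_derivative snd (\<Phi> t p)) (at t)"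
  and snd_flow_deriv: "((\<lambda>t. snd (\<Phi> t p)) has_real_derivative F (\<Phi> t p)) (at t)"
  unfolding has_real_derivative_iff_has_vector_derivative
  using bounded_linear.has_vector_derivative[OF bounded_linear_fst flow_deriv[of p t]]
    bounded_linear.has_vector_derivative[OF bounded_linear_snd flow_deriv[of p t]]
  by simp_all

text \<open>An orbit with y = 0 at all times also has y' = 0, so it would be an equilibrium.\<close>

lemma leaves_axis:
  assumes "p \<in> C"
  obtains t where "snd (\<Phi> t p) \<noteq> 0"
proof (rule ccontr)
  assume "\<not> thesis"
  then have *: "snd (\<Phi> t p) = 0" for t using that by blast
  then have "F (\<Phi> 0 p) = 0"
    using snd_flow_deriv[of p 0] DERIV_unique[OF _ DERIV_const] by simp
  then have "field p = 0"
    using *[of 0] F_eq[of p] N(2) assms by (auto simp: field_def zero_prod_def)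
  then show False using field_nonzero_C[OF assms] by simp
qed

text \<open>Off the axis x' = y is nonzero, so every nearby point of the oval flows in a short time
  to the vertical line through p. \<open>H\<close> is injective on that line near p, so the point of
  arrival is p itself. In this way the oval is seen to be one arc near p, with the topology of the
  curve never being examined.\<close>

lemma flow_box_off_axis:
  assumes p: "p \<in> C" "snd p \<noteq> 0"
  obtains \<delta> where "\<delta> > 0" "\<And>q. q \<in> C \<Longrightarrow> dist q p < \<delta> \<Longrightarrow> \<exists>a. \<bar>a\<bar> < 1 \<and> \<Phi> a q = p"
proof -
  obtain x0 y0 where xy: "p = (x0, y0)" by fastforce
  obtain \<rho> where \<rho>: "\<rho> > 0"
    "\<And>y y'. \<bar>y - y0\<bar> < \<rho> \<Longrightarrow> \<bar>y' - y0\<bar> < \<rho> \<Longrightarrow> y < y' \<Longrightarrow> y0 * (H (x0, y') - H (x0, y)) > 0"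
    using H_vertical_mono[of x0 y0] p by (auto simp: xy C_iff) metis
  have inj: "y = y0" if "\<bar>y - y0\<bar> < \<rho>" "H (x0, y) = H (x0, y0)" for y
    using \<rho>(2)[of y y0] \<rho>(2)[of y0 y] \<rho>(1) that by (cases y y0 rule: linorder_cases) auto
  have "open {q. dist (\<Phi> (fst q) (snd q)) p < \<rho>}"
    by (intro open_Collect_less continuous_intros)
  moreover have "(0, p) \<in> {q. dist (\<Phi> (fst q) (snd q)) p < \<rho>}" using \<rho>(1) by simp
  ultimately obtain A B where "open A" "open B" "(0, p) \<in> A \<times> B"
    and "A \<times> B \<subseteq> {q. dist (\<Phi> (fst q) (snd q)) p < \<rho>}"
    by (rule open_prod_elim)
  then have AB: "open A" "open B" "0 \<in> A" "p \<in> B" "\<And>t z. t \<in> A \<Longrightarrow> z \<in> B \<Longrightarrow> dist (\<Phi> t z) p < \<rho>"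
    by auto
  obtain \<eta> where \<eta>: "\<eta> > 0" "ball 0 \<eta> \<subseteq> A" using openE[OF AB(1,3)] by blast
  obtain \<delta>2 where \<delta>2: "\<delta>2 > 0" "ball p \<delta>2 \<subseteq> B" using openE[OF AB(2,4)] by blast
  have cont: "continuous_on UNIV (\<lambda>(t, z). fst (\<Phi> t z))" "continuous_on UNIV (\<lambda>(t, z). snd (\<Phi> t z))"
    unfolding case_prod_unfold by (intro continuous_intros)+
  obtain \<delta>1 \<tau> where \<tau>: "\<delta>1 > 0"
    "\<And>z. z \<in> ball p \<delta>1 \<Longrightarrow> \<bar>\<tau> z - 0\<bar> < min 1 \<eta> \<and> fst (\<Phi> (\<tau> z) z) = x0"
    by (rule crossing_time[of "\<lambda>t z. fst (\<Phi> t z)" "\<lambda>t z. snd (\<Phi> t z)" 0 p x0 "min 1 \<eta>"])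
      (use p \<eta> cont in \<open>auto simp: xy fst_flow_deriv\<close>)
  show ?thesis
  proof (rule that[of "min \<delta>1 \<delta>2"])
    show "min \<delta>1 \<delta>2 > 0" using \<tau>(1) \<delta>2(1) by simp
    fix q assume q: "q \<in> C" "dist q p < min \<delta>1 \<delta>2"
    then have *: "\<bar>\<tau> q\<bar> < 1" "\<bar>\<tau> q\<bar> < \<eta>" "fst (\<Phi> (\<tau> q) q) = x0"
      using \<tau>(2)[of q] by (auto simp: dist_commute)
    have "dist (\<Phi> (\<tau> q) q) p < \<rho>"
      using *(2) q(2) \<eta>(2) \<delta>2(2) by (intro AB(5)) (auto simp: dist_commute)
    then have "\<bar>snd (\<Phi> (\<tau> q) q) - y0\<bar> < \<rho>"
      using dist_snd_le[of "\<Phi> (\<tau> q) q" p] by (simp add: xy dist_real_def)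
    moreover have "H (x0, snd (\<Phi> (\<tau> q) q)) = H (x0, y0)"
      using flow_in_C[OF q(1), of "\<tau> q"] p(1) *(3) by (simp add: C_iff xy) (metis prod.collapse)
    ultimately have "snd (\<Phi> (\<tau> q) q) = y0" using inj by blast
    then have "\<Phi> (\<tau> q) q = p" using *(3) by (simp add: xy prod_eq_iff)
    then show "\<exists>a. \<bar>a\<bar> < 1 \<and> \<Phi> a q = p" using *(1) by blast
  qed
qed

text \<open>A point on the axis is carried by the flow to a point off the axis; the time shift a
  found there also works at the original point, since the flow maps commute. The radius is divided
  by the Lipschitz constant of \<Phi> t.\<close>

lemma flow_box:
  assumes p: "p \<in> C"
  obtains \<delta> where "\<delta> > 0" "\<And>q. q \<in> C \<Longrightarrow> dist q p < \<delta> \<Longrightarrow> \<exists>a. \<bar>a\<bar> < 1 \<and> \<Phi> a q = p"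
proof -
  obtain t where t: "snd (\<Phi> t p) \<noteq> 0" using leaves_axis[OF p] .
  obtain \<delta>' where \<delta>': "\<delta>' > 0"
    "\<And>q. q \<in> C \<Longrightarrow> dist q (\<Phi> t p) < \<delta>' \<Longrightarrow> \<exists>a. \<bar>a\<bar> < 1 \<and> \<Phi> a q = \<Phi> t p"
    using flow_box_off_axis[OF flow_in_C[OF p] t] by blast
  define \<delta> where "\<delta> = \<delta>' / exp (L * \<bar>t\<bar>)"
  show ?thesis
  proof (rule that[of \<delta>])
    show "\<delta> > 0" using \<delta>'(1) by (simp add: \<delta>_def)
    fix q assume q: "q \<in> C" "dist q p < \<delta>"
    have "dist (\<Phi> t q) (\<Phi> t p) \<le> exp (L * \<bar>t\<bar>) * dist q p" by (rule dist_flow)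
    also have "\<dots> < \<delta>'" using q(2) by (simp add: \<delta>_def field_simps)
    finally obtain a where a: "\<bar>a\<bar> < 1" "\<Phi> a (\<Phi> t q) = \<Phi> t p"
      using \<delta>'(2)[OF flow_in_C[OF q(1)]] by blast
    have "\<Phi> a q = \<Phi> (- t) (\<Phi> a (\<Phi> t q))" by (simp flip: flow_add)
    also have "\<dots> = \<Phi> (- t) (\<Phi> t p)" by (simp only: a(2))
    also have "\<dots> = p" by (simp flip: flow_add)
    finally show "\<exists>a. \<bar>a\<bar> < 1 \<and> \<Phi> a q = p" using a(1) by blast
  qed
qed

lemma flow_periodic_on_C:
  assumes p: "p \<in> C"
  obtains T where "T > 0" "\<Phi> T p = p"
proof -
  \<comment> \<open>Samples at distance 4 in time: the two corrections by flow boxes are each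
    shorter than 1, so two different samples that are brought to the same point still differ by a
    positive time.\<close>
  have "\<forall>n. \<Phi> (4 * real n) p \<in> C" using flow_in_C[OF p] by blast
  then obtain q r where q: "q \<in> C" and r: "strict_mono (r :: nat \<Rightarrow> nat)"
    and lim: "((\<lambda>n. \<Phi> (4 * real n) p) \<circ> r) \<longlonglongrightarrow> q"
    using C_topology(1) unfolding compact_eq_seq_compact_metric seq_compact_def by metis
  obtain \<delta> where \<delta>: "\<delta> > 0" "\<And>z. z \<in> C \<Longrightarrow> dist z q < \<delta> \<Longrightarrow> \<exists>a. \<bar>a\<bar> < 1 \<and> \<Phi> a z = q"
    using flow_box[OF q] by blast
  obtain n0 where n0: "\<And>n. n \<ge> n0 \<Longrightarrow> dist (\<Phi> (4 * real (r n)) p) q < \<delta>"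
    using lim \<delta>(1) unfolding lim_sequentially by auto
  obtain a b where a: "\<bar>a\<bar> < 1" "\<Phi> a (\<Phi> (4 * real (r n0)) p) = q"
    and b: "\<bar>b\<bar> < 1" "\<Phi> b (\<Phi> (4 * real (r (Suc n0))) p) = q"
    using \<delta>(2)[OF flow_in_C[OF p] n0] by (meson le_Suc_eq order_refl)
  have "r n0 < r (Suc n0)" using r by (simp add: strict_mono_Suc_iff)
  then have "real (r n0) + 1 \<le> real (r (Suc n0))" by linarith
  then have "(b + 4 * real (r (Suc n0))) - (a + 4 * real (r n0)) > 0"
    using a(1) b(1) by linarith
  moreover have "\<Phi> ((b + 4 * real (r (Suc n0))) - (a + 4 * real (r n0))) p = p"
  proof -
    have "\<Phi> ((b + 4 * real (r (Suc n0))) - (a + 4 * real (r n0))) p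
        = \<Phi> (- (a + 4 * real (r n0))) (\<Phi> b (\<Phi> (4 * real (r (Suc n0))) p))"
      by (simp add: algebra_simps flip: flow_add)
    also have "\<dots> = \<Phi> (- (a + 4 * real (r n0))) (\<Phi> a (\<Phi> (4 * real (r n0)) p))"
      by (simp only: a(2) b(2))
    also have "\<dots> = p" by (simp flip: flow_add)
    finally show ?thesis .
  qed
  ultimately show ?thesis using that by blast
qed

text \<open>By the flow boxes, every orbit is relatively open in the oval; the oval is connected, so
  there is only one orbit.\<close>

lemma orbit_covers_C:
  assumes "p \<in> C" "q \<in> C"
  obtains t where "\<Phi> t p = q"
proof -
  define R where "R x y \<longleftrightarrow> (\<exists>t. \<Phi> t x = y)" for x y
  have sym: "R y x" if "R x y" for x y
  proof -
    from that obtain t where "\<Phi> t x = y" by (auto simp: R_def)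
    then have "\<Phi> (- t) y = x" by (metis flow_0 flow_add add.left_inverse)
    then show ?thesis by (auto simp: R_def)
  qed
  have trans: "R x z" if "R x y" "R y z" for x y z
    using that unfolding R_def by (metis flow_add)
  have "R p q"
  proof (rule connected_equivalence_relation[OF C_topology(2) assms])
    fix a assume a: "a \<in> C"
    obtain \<delta> where \<delta>: "\<delta> > 0" "\<And>z. z \<in> C \<Longrightarrow> dist z a < \<delta> \<Longrightarrow> \<exists>b. \<bar>b\<bar> < 1 \<and> \<Phi> b z = a"
      using flow_box[OF a] by blast
    have "\<forall>x\<in>C \<inter> ball a \<delta>. R a x"
      using \<delta>(2) sym unfolding R_def by (metis IntE dist_commute mem_ball)
    then show "\<exists>T. openin (top_of_set C) T \<and> a \<in> T \<and> (\<forall>x\<in>T. R a x)"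
      using a \<delta>(1) by (intro exI[of _ "C \<inter> ball a \<delta>"]) auto
  qed (use sym trans in blast)+
  then show ?thesis using that by (auto simp: R_def)
qed

lemma minimal_period:
  assumes p: "p \<in> C"
  obtains T where "T > 0" "\<Phi> T p = p" "\<And>t. 0 < t \<Longrightarrow> t < T \<Longrightarrow> \<Phi> t p \<noteq> p"
proof -
  obtain T where T: "T > 0" "\<Phi> T p = p" using flow_periodic_on_C[OF p] .
  \<comment> \<open>Movement in the direction of the field at p excludes very short returns. Hence
    the periods are bounded away from 0, and a least one exists by compactness.\<close>
  have "((\<lambda>t. \<Phi> t p \<bullet> field p) has_real_derivative field p \<bullet> field p) (at 0)"
    using bounded_linear.has_vector_derivative[OF bounded_linear_inner_left flow_deriv_C[OF p, of 0]]
    by (simp add: has_real_derivative_iff_has_vector_derivative)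
  moreover have "field p \<bullet> field p > 0" using field_nonzero_C[OF p] by simp
  ultimately obtain e where e: "e > 0" "\<forall>t>0. t < e \<longrightarrow> \<Phi> 0 p \<bullet> field p < \<Phi> (0 + t) p \<bullet> field p"
    using DERIV_pos_inc_right by blast
  have e: "e > 0" "\<And>t. 0 < t \<Longrightarrow> t < e \<Longrightarrow> \<Phi> t p \<noteq> p"
    using e by force+
  define A where "A = {e..max e T} \<inter> {t. \<Phi> t p = p}"
  have "closed {t. \<Phi> t p = p}" by (intro closed_Collect_eq continuous_intros)
  then have "compact A" unfolding A_def by (intro compact_Int_closed) auto
  moreover have "T \<in> A" using T e(2)[of T] by (cases "T < e") (auto simp: A_def not_less)
  ultimately obtain T0 where T0: "T0 \<in> A" "\<And>t. t \<in> A \<Longrightarrow> T0 \<le> t"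
    using compact_attains_inf[of A] by blast
  show ?thesis
  proof (rule that[of T0])
    show "T0 > 0" "\<Phi> T0 p = p" using T0 e(1) by (auto simp: A_def)
    show "\<Phi> t p \<noteq> p" if "0 < t" "t < T0" for t
      using T0(2)[of t] T0(1) e(2)[of t] that by (cases "t < e") (auto simp: A_def not_less)
  qed
qed

text \<open>\<open>melnikov\<close> picks its parametrization with \<open>SOME\<close>, so the
  choice is meaningful only if one exists. One least period of the orbit, scaled to unit time, is
  such a parametrization.\<close>

lemma oriented_exists: "\<exists>\<gamma>. oriented_by field C \<gamma>"
proof -
  obtain p where p: "p \<in> C" using C_topology(3) by blast
  obtain T where T: "T > 0" "\<Phi> T p = p" "\<And>t. 0 < t \<Longrightarrow> t < T \<Longrightarrow> \<Phi> t p \<noteq> p"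
    using minimal_period[OF p] by blast
  define \<gamma> where "\<gamma> = (\<lambda>t. \<Phi> (T * t) p)"
  have d: "(\<gamma> has_vector_derivative T *\<^sub>R field (\<gamma> t)) (at t)" for t
  proof -
    have "((\<lambda>t. T * t) has_vector_derivative T) (at t)"
      by (auto intro!: derivative_eq_intros)
    from vector_diff_chain_at[OF this flow_deriv_C[OF p]] show ?thesis
      by (simp add: o_def \<gamma>_def)
  qed
  have c: "continuous_on UNIV \<gamma>" unfolding \<gamma>_def by (intro continuous_intros)
  have \<gamma>C: "\<gamma> t \<in> C" for t using flow_in_C[OF p] by (simp add: \<gamma>_def)
  have inj: "x = 0 \<and> y = 1" if "0 \<le> x" "x < y" "y \<le> 1" "\<gamma> x = \<gamma> y" for x y
  proof -
    have "\<Phi> (T * (y - x)) p = \<Phi> (- (T * x)) (\<gamma> y)"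
      by (simp add: \<gamma>_def algebra_simps flip: flow_add)
    also have "\<dots> = p" using that(4)[symmetric] by (simp add: \<gamma>_def flip: flow_add)
    finally have "\<not> T * (y - x) < T" using T(1) that(2) T(3)[of "T * (y - x)"] by auto
    then show ?thesis using T(1) that by (simp add: not_less mult_le_cancel_left1)
  qed
  have "simple_path \<gamma>"
    unfolding simple_path_def loop_free_def path_def
  proof (intro conjI ballI impI)
    show "continuous_on {0..1} \<gamma>" using c continuous_on_subset by blast
    fix x y :: real assume "x \<in> {0..1}" "y \<in> {0..1}" "\<gamma> x = \<gamma> y"
    then show "x = y \<or> x = 0 \<and> y = 1 \<or> x = 1 \<and> y = 0"
      using inj[of x y] inj[of y x] by (cases x y rule: linorder_cases) auto
  qed
  moreover have "pathfinish \<gamma> = pathstart \<gamma>"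
    using T(2) by (simp add: pathfinish_def pathstart_def \<gamma>_def)
  moreover have "path_image \<gamma> = C"
  proof (rule equalityI)
    show "path_image \<gamma> \<subseteq> C" using \<gamma>C by (auto simp: path_image_def)
    show "C \<subseteq> path_image \<gamma>"
    proof
      fix q assume "q \<in> C"
      then obtain t where t: "\<Phi> t p = q" using orbit_covers_C[OF p] by blast
      obtain r where "0 \<le> r" "r < T" "\<Phi> t p = \<Phi> r p"
        using flow_periodic_reduce[OF T(2,1), of t] by metis
      then have "q = \<gamma> (r / T)" "r / T \<in> {0..1}"
        using T(1) t by (auto simp: \<gamma>_def)
      then show "q \<in> path_image \<gamma>" by (auto simp: path_image_def)
    qed
  qed
  moreover have "\<gamma> C1_differentiable_on {0..1}"
    unfolding C1_differentiable_on_def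
  proof (intro exI conjI ballI)
    show "(\<gamma> has_vector_derivative T *\<^sub>R field (\<gamma> x)) (at x)" for x by (rule d)
    show "continuous_on {0..1} (\<lambda>x. T *\<^sub>R field (\<gamma> x))"
      by (intro continuous_intros continuous_on_compose2[OF continuous_on_field]
          continuous_on_subset[OF c]) (use \<gamma>C C_subset in auto)
  qed
  moreover have "\<forall>t\<in>{0..1}. \<exists>\<mu>>0. vector_derivative \<gamma> (at t) = \<mu> *\<^sub>R field (\<gamma> t)"
    using vector_derivative_at[OF d] T(1) by blast
  ultimately show ?thesis unfolding oriented_by_def by blast
qed

text \<open>Every admissible parametrization is the orbit of \<gamma> 0 with a change of time
  \<tau>, where \<tau>' = \<mu> > 0, by uniqueness for the rescaled equation. Since dx = y dt, the
  line integral becomes an increment of \<open>A\<close>. Simplicity of the path makes \<tau> 1 the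
  least period, whatever path was chosen.\<close>

lemma line_integral_along_orbit:
  assumes \<gamma>: "oriented_by field C \<gamma>" and G: "continuous_on C G"
    and A: "\<And>t. (A has_real_derivative G (\<Phi> t (\<gamma> 0)) * snd (\<Phi> t (\<gamma> 0))) (at t)"
  obtains T where "T > 0" "\<Phi> T (\<gamma> 0) = \<gamma> 0" "\<And>t. 0 < t \<Longrightarrow> t < T \<Longrightarrow> \<Phi> t (\<gamma> 0) \<noteq> \<gamma> 0"
    "line_integral_dx G \<gamma> = A T - A 0"
proof -
  obtain D where D: "\<And>t. t \<in> {0..1} \<Longrightarrow> (\<gamma> has_vector_derivative D t) (at t)" "continuous_on {0..1} D"
    using \<gamma> unfolding oriented_by_def C1_differentiable_on_def by blast
  have \<gamma>C: "\<gamma> t \<in> C" if "t \<in> {0..1}" for t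
    using \<gamma> that unfolding oriented_by_def path_image_def by blast
  have c\<gamma>: "continuous_on {0..1} \<gamma>"
    using D(1) by (intro continuous_at_imp_continuous_on ballI has_vector_derivative_continuous) auto
  \<comment> \<open>Orientation yields a positive factor separately at each t; writing it as a
    quotient of inner products shows that it is continuous.\<close>
  define \<mu> where "\<mu> t = (D t \<bullet> field (\<gamma> t)) / (field (\<gamma> t) \<bullet> field (\<gamma> t))" for t
  have \<mu>: "\<mu> t > 0" "D t = \<mu> t *\<^sub>R field (\<gamma> t)" if t: "t \<in> {0..1}" for t
  proof -
    obtain m where m: "m > 0" "vector_derivative \<gamma> (at t) = m *\<^sub>R field (\<gamma> t)"
      using \<gamma> t unfolding oriented_by_def by blast
    have "D t = m *\<^sub>R field (\<gamma> t)" using vector_derivative_at[OF D(1)[OF t]] m(2) by simp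
    moreover from this have "\<mu> t = m" using field_nonzero_C[OF \<gamma>C[OF t]] by (simp add: \<mu>_def)
    ultimately show "\<mu> t > 0" "D t = \<mu> t *\<^sub>R field (\<gamma> t)" using m(1) by auto
  qed
  have c\<mu>: "continuous_on {0..1} \<mu>"
    unfolding \<mu>_def
    by (intro continuous_intros D continuous_on_compose2[OF continuous_on_field c\<gamma>])
      (use \<gamma>C C_subset field_nonzero_C in auto)
  define \<tau> where "\<tau> t = integral {0..t} \<mu>" for t
  have d\<tau>: "(\<tau> has_real_derivative \<mu> t) (at t within {0..1})" if "t \<in> {0..1}" for t
    unfolding \<tau>_def has_real_derivative_iff_has_vector_derivative
    using integral_has_vector_derivative[OF c\<mu> that] by simp
  have \<tau>0: "\<tau> 0 = 0" by (simp add: \<tau>_def)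
  have c\<tau>: "continuous_on {0..1} \<tau>"
    using d\<tau> DERIV_continuous_on by blast
  define B where "B = Sup (\<mu> ` {0..1})"
  have B: "\<bar>\<mu> t\<bar> \<le> B" if "t \<in> {0..1}" for t
  proof -
    have "bounded (\<mu> ` {0..1})"
      by (intro compact_imp_bounded compact_continuous_image c\<mu>) auto
    then show ?thesis
      using \<mu>(1)[OF that] that bounded_imp_bdd_above cSup_upper[of "\<mu> t" "\<mu> ` {0..1}"]
      by (auto simp: B_def)
  qed
  have eq: "\<gamma> t = \<Phi> (\<tau> t) (\<gamma> 0)" if t: "t \<in> {0..1}" for t
  proof -
    have "norm (\<gamma> t - \<Phi> (\<tau> t) (\<gamma> 0)) \<le> exp (B * L * (t - 0)) * norm (\<gamma> 0 - \<Phi> (\<tau> 0) (\<gamma> 0))"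
    proof (rule rescaled_solutions_dist[where \<mu>=\<mu>])
      fix r assume r: "r \<in> {0..t}"
      then have r1: "r \<in> {0..1}" using t by auto
      have Fr: "F (\<gamma> r) = k + f (\<gamma> r)" using F_eq N(2) \<gamma>C[OF r1] by blast
      show "(\<gamma> has_vector_derivative \<mu> r *\<^sub>R (snd (\<gamma> r), F (\<gamma> r))) (at r within {0..t})"
        using D(1)[OF r1] \<mu>(2)[OF r1] Fr by (simp add: field_def has_vector_derivative_at_within)
      have "(\<tau> has_vector_derivative \<mu> r) (at r within {0..t})"
        using has_vector_derivative_within_subset[OF d\<tau>[OF r1, unfolded has_real_derivative_iff_has_vector_derivative]] t
        by auto
      from vector_diff_chain_within[OF this has_vector_derivative_at_within[OF flow_deriv]]
      show "((\<lambda>t. \<Phi> (\<tau> t) (\<gamma> 0)) has_vector_derivative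
          \<mu> r *\<^sub>R (snd (\<Phi> (\<tau> r) (\<gamma> 0)), F (\<Phi> (\<tau> r) (\<gamma> 0)))) (at r within {0..t})"
        by (simp add: o_def)
      show "\<bar>\<mu> r\<bar> \<le> B" using B[OF r1] .
    qed (use t in auto)
    then show ?thesis by (simp add: \<tau>0)
  qed
  have \<tau>_mono: "\<tau> x < \<tau> y" if "0 \<le> x" "x < y" "y \<le> 1" for x y
  proof (rule DERIV_pos_imp_increasing_open[OF \<open>x < y\<close>])
    fix r assume r: "x < r" "r < y"
    then have "(\<tau> has_real_derivative \<mu> r) (at r)"
      using d\<tau>[of r] that by (simp add: at_within_Icc_at)
    then show "\<exists>d. (\<tau> has_real_derivative d) (at r) \<and> 0 < d" using \<mu>(1)[of r] r that by auto
  qed (use that in \<open>auto intro: continuous_on_subset[OF c\<tau>]\<close>)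
  show ?thesis
  proof (rule that[of "\<tau> 1"])
    show "\<tau> 1 > 0" using \<tau>_mono[of 0 1] \<tau>0 by simp
    show "\<Phi> (\<tau> 1) (\<gamma> 0) = \<gamma> 0"
      using \<gamma> eq[of 1] by (simp add: oriented_by_def pathfinish_def pathstart_def)
    show "\<Phi> r (\<gamma> 0) \<noteq> \<gamma> 0" if r: "0 < r" "r < \<tau> 1" for r
    proof
      assume *: "\<Phi> r (\<gamma> 0) = \<gamma> 0"
      obtain t where t: "0 \<le> t" "t \<le> 1" "\<tau> t = r"
        using IVT'[of \<tau> 0 r 1] c\<tau> \<tau>0 r by auto
      then have "\<gamma> t = \<gamma> 0" using eq[of t] * by simp
      then have "t = 0 \<or> t = 1"
        using \<gamma> t unfolding oriented_by_def simple_path_def loop_free_def by fastforce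
      then show False using t \<tau>0 r by auto
    qed
    have "((\<lambda>t. G (\<gamma> t) * fst (vector_derivative \<gamma> (at t))) has_integral A (\<tau> 1) - A (\<tau> 0)) {0..1}"
    proof (rule fundamental_theorem_of_calculus)
      fix t :: real assume t: "t \<in> {0..1}"
      have "((\<lambda>t. A (\<tau> t)) has_real_derivative
          G (\<Phi> (\<tau> t) (\<gamma> 0)) * snd (\<Phi> (\<tau> t) (\<gamma> 0)) * \<mu> t) (at t within {0..1})"
        by (rule DERIV_chain2[OF A d\<tau>[OF t]])
      moreover have "G (\<Phi> (\<tau> t) (\<gamma> 0)) * snd (\<Phi> (\<tau> t) (\<gamma> 0)) * \<mu> t
          = G (\<gamma> t) * fst (vector_derivative \<gamma> (at t))"
        using eq[OF t, symmetric] vector_derivative_at[OF D(1)[OF t]] \<mu>(2)[OF t]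
        by (simp add: field_def)
      ultimately show "((\<lambda>t. A (\<tau> t)) has_vector_derivative
          G (\<gamma> t) * fst (vector_derivative \<gamma> (at t))) (at t within {0..1})"
        by (simp add: has_real_derivative_iff_has_vector_derivative)
    qed simp
    then show "line_integral_dx G \<gamma> = A (\<tau> 1) - A 0"
      by (simp add: line_integral_dx_def integral_unique \<tau>0)
  qed
qed

text \<open>The base point q and the period \<open>T0\<close> need not match the parametrization
  chosen by \<open>melnikov\<close>. The antiderivative grows by the same amount over each least
  period, wherever that period starts, and \<open>T0\<close> consists of n least periods.\<close>

lemma melnikov_along_flow:
  assumes q: "q \<in> C" and T0: "T0 > 0" "\<Phi> T0 q = q"
  obtains n :: nat where "n > 0"
    "integral {0..T0} (\<lambda>t. g (\<Phi> t q, 0) / s (\<Phi> t q) * snd (\<Phi> t q)) = real n * melnikov k V0 f g s H h"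
proof -
  define G where "G p = g (p, 0) / s p" for p
  have G: "continuous_on C G"
    unfolding G_def
    by (intro continuous_intros continuous_on_compose2[OF continuous_on_g]
        continuous_on_subset[OF continuous_on_s C_subset])
      (use C_subset zero_I s_pos in force)+
  define \<gamma> where "\<gamma> = (SOME \<gamma>. oriented_by field C \<gamma>)"
  have \<gamma>: "oriented_by field C \<gamma>"
    unfolding \<gamma>_def using someI_ex[OF oriented_exists] .
  have M: "melnikov k V0 f g s H h = line_integral_dx G \<gamma>"
    unfolding melnikov_def \<gamma>_def field_def G_def ..
  define p where "p = \<gamma> 0"
  have p: "p \<in> C"
    using \<gamma> by (auto simp: p_def oriented_by_def path_image_def)
  have "continuous_on UNIV (\<lambda>t. G (\<Phi> t p) * snd (\<Phi> t p))"
    by (intro continuous_intros continuous_on_compose2[OF G]) (use flow_in_C[OF p] in auto)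
  then obtain A where A: "\<And>t. (A has_real_derivative G (\<Phi> t p) * snd (\<Phi> t p)) (at t)"
    using continuous_antiderivative unfolding has_real_derivative_iff_has_vector_derivative by blast
  obtain T where T: "T > 0" "\<Phi> T p = p" "\<And>t. 0 < t \<Longrightarrow> t < T \<Longrightarrow> \<Phi> t p \<noteq> p"
    and MT: "line_integral_dx G \<gamma> = A T - A 0"
    using line_integral_along_orbit[OF \<gamma> G A[unfolded p_def]] unfolding p_def by blast
  have shift: "A (t + T) - A t = A T - A 0" for t
  proof -
    have "((\<lambda>t. A (t + T) - A t) has_real_derivative 0) (at t)" for t
    proof -
      have "((\<lambda>t. A (t + T)) has_real_derivative G (\<Phi> (t + T) p) * snd (\<Phi> (t + T) p)) (at t)"
        using A[of "t + T"] by (simp add: DERIV_shift)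
      from DERIV_diff[OF this A[of t]] show ?thesis by (simp add: flow_periodic(1)[OF T(2)])
    qed
    then show ?thesis using DERIV_isconst_all[of "\<lambda>t. A (t + T) - A t" t 0] by simp
  qed
  have shift_n: "A (t + real n * T) - A t = real n * (A T - A 0)" for t n
  proof (induction n)
    case (Suc n)
    then show ?case using shift[of "t + real n * T"] by (simp add: algebra_simps)
  qed simp
  obtain a where a: "\<Phi> a p = q" using orbit_covers_C[OF p q] .
  have q_eq: "\<Phi> t q = \<Phi> (t + a) p" for t by (simp add: flow_add a)
  have "\<Phi> T0 p = p"
  proof -
    have "\<Phi> T0 p = \<Phi> (- a) (\<Phi> (T0 + a) p)" by (simp flip: flow_add)
    also have "\<dots> = \<Phi> (- a) (\<Phi> a p)" using T0(2) q_eq a by simp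
    finally show ?thesis by (simp flip: flow_add)
  qed
  obtain m r where m: "T0 = r + of_int m * T" "0 \<le> r" "r < T" "\<Phi> T0 p = \<Phi> r p" "m \<ge> 0"
    using flow_periodic_reduce[OF T(2,1), of T0] T0(1) by (metis less_imp_le)
  \<comment> \<open>The remainder of \<open>T0\<close> modulo the least period again returns to p,
    which minimality forbids unless it is 0.\<close>
  have "r = 0" using T(3)[of r] m \<open>\<Phi> T0 p = p\<close> by (cases "r = 0") auto
  define n where "n = nat m"
  have n: "T0 = real n * T" using m \<open>r = 0\<close> by (simp add: n_def)
  then have "n > 0" using T0(1) by (cases n) auto
  have "((\<lambda>t. G (\<Phi> t q) * snd (\<Phi> t q)) has_integral A (T0 + a) - A (0 + a)) {0..T0}"
  proof (rule fundamental_theorem_of_calculus)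
    fix t :: real
    have "((\<lambda>t. A (t + a)) has_real_derivative G (\<Phi> t q) * snd (\<Phi> t q)) (at t)"
      using A[of "t + a"] by (simp add: DERIV_shift q_eq)
    then show "((\<lambda>t. A (t + a)) has_vector_derivative G (\<Phi> t q) * snd (\<Phi> t q)) (at t within {0..T0})"
      using has_vector_derivative_at_within has_real_derivative_iff_has_vector_derivative by blast
  qed (use T0 in auto)
  moreover have "A (T0 + a) - A (0 + a) = real n * (A T - A 0)"
    using shift_n[of a n] by (simp add: n add.commute)
  ultimately have "integral {0..T0} (\<lambda>t. G (\<Phi> t q) * snd (\<Phi> t q)) = real n * melnikov k V0 f g s H h"
    using integral_unique M MT by metis
  then show ?thesis using that[OF \<open>n > 0\<close>] by (simp add: G_def)
qed

text \<open>If y were never positive, x would be nonincreasing and periodic, hence constant near the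
  time t at which y is nonzero, contradicting x' = y.\<close>

lemma upper_half_point: obtains p where "p \<in> C" "snd p > 0"
proof -
  obtain p where p: "p \<in> C" using C_topology(3) by blast
  obtain T where T: "T > 0" "\<Phi> T p = p" using flow_periodic_on_C[OF p] .
  obtain t where t: "snd (\<Phi> t p) \<noteq> 0" using leaves_axis[OF p] .
  have "\<exists>t. snd (\<Phi> t p) > 0"
  proof (rule ccontr)
    assume "\<not> ?thesis"
    then have neg: "snd (\<Phi> r p) \<le> 0" for r by (simp add: not_less)
    have mono: "fst (\<Phi> b p) \<le> fst (\<Phi> a p)" if "a \<le> b" for a b
      using DERIV_nonpos_imp_nonincreasing[OF that, of "\<lambda>t. fst (\<Phi> t p)"] fst_flow_deriv neg by blast
    have "fst (\<Phi> r p) = fst (\<Phi> t p)" if "\<bar>t - r\<bar> < T" for r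
    proof (cases "r \<le> t")
      case True
      then have "fst (\<Phi> t p) \<le> fst (\<Phi> r p)" "fst (\<Phi> (r + T) p) \<le> fst (\<Phi> t p)"
        using that by (auto intro!: mono)
      then show ?thesis using flow_periodic(1)[OF T(2)] by simp
    next
      case False
      then have "fst (\<Phi> r p) \<le> fst (\<Phi> t p)" "fst (\<Phi> (t + T) p) \<le> fst (\<Phi> r p)"
        using that by (auto intro!: mono)
      then show ?thesis using flow_periodic(1)[OF T(2)] by simp
    qed
    then have "\<forall>r. \<bar>t - r\<bar> < T \<longrightarrow> fst (\<Phi> t p) = fst (\<Phi> r p)" by metis
    from DERIV_local_const[OF fst_flow_deriv T(1) this] show False using t by simp
  qed
  then show ?thesis using that flow_in_C[OF p] by blast
qed

end

section \<open>Periodic solutions and the integral \<open>M\<close>, stated without the auxiliary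
  extension\<close>

context oval
begin

lemma oval_flow_exists:
  obtains F L \<Phi> N where "oval_flow V0 k xc f s H I g h F L \<Phi> N"
proof -
  obtain r where r: "r > 0" "compact {p. infdist p C \<le> r}" "{p. infdist p C \<le> r} \<subseteq> V0"
    using compact_neighbourhood_in_open[OF C_topology(1) open_V0 C_subset C_topology(3)] .
  obtain F L where F: "L-lipschitz_on UNIV (\<lambda>p. (snd p, F p))"
    "\<And>p. p \<in> {p. infdist p C \<le> r} \<Longrightarrow> F p = k + f p"
    using lipschitz_field_extension[OF r(2,3)] by blast
  obtain \<Phi> where \<Phi>: "lipschitz_flow (\<lambda>p. (snd p, F p)) L \<Phi>"
    using lipschitz_flow_exists[OF F(1)] .
  have "open {p. infdist p C < r}"
    by (intro open_Collect_less continuous_intros)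
  moreover have "C \<subseteq> {p. infdist p C < r}" using r(1) by auto
  ultimately have "oval_flow V0 k xc f s H I g h F L \<Phi> {p. infdist p C < r}"
    using \<Phi> r(3) F(2)
    by (intro oval_flow.intro oval_axioms oval_flow_axioms.intro) (auto simp: less_imp_le)
  then show ?thesis using that by blast
qed

lemma periodic_solution:
  obtains \<phi> T where "\<And>t. (\<phi> has_vector_derivative field (\<phi> t)) (at t)" "\<And>t. \<phi> t \<in> C"
    "T > 0" "\<And>t. \<phi> (t + T) = \<phi> t" "snd (\<phi> 0) > 0"
proof -
  obtain F L \<Phi> N where "oval_flow V0 k xc f s H I g h F L \<Phi> N" using oval_flow_exists .
  then interpret oval_flow V0 k xc f s H I g h F L \<Phi> N .
  obtain p where p: "p \<in> C" "snd p > 0" using upper_half_point .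
  obtain T where T: "T > 0" "\<Phi> T p = p" using flow_periodic_on_C[OF p(1)] .
  show ?thesis
    by (rule that[of "\<lambda>t. \<Phi> t p" T])
      (use flow_deriv_C[OF p(1)] flow_in_C[OF p(1)] flow_periodic(1)[OF T(2)] T p in auto)
qed

text \<open>The solution may come from any flow, in particular from the perturbed one at \<epsilon>
  = 0: as it stays on the oval, it also solves the equation extended around this oval, and
  uniqueness identifies the two.\<close>

lemma melnikov_along_solution:
  assumes \<phi>: "\<And>t. (\<phi> has_vector_derivative field (\<phi> t)) (at t)" "\<And>t. \<phi> t \<in> C"
    and T: "T > 0" "\<phi> T = \<phi> 0"
  obtains n :: nat where "n > 0"
    "integral {0..T} (\<lambda>t. g (\<phi> t, 0) / s (\<phi> t) * snd (\<phi> t)) = real n * melnikov k V0 f g s H h"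
proof -
  obtain F L \<Phi> N where "oval_flow V0 k xc f s H I g h F L \<Phi> N" using oval_flow_exists .
  then interpret oval_flow V0 k xc f s H I g h F L \<Phi> N .
  have "(\<phi> has_vector_derivative (snd (\<phi> t), F (\<phi> t))) (at t)" for t
    using \<phi>(1)[of t] \<phi>(2)[of t] F_eq[of "\<phi> t"] N(2) by (auto simp: field_def)
  then have eq: "\<phi> t = \<Phi> t (\<phi> 0)" for t by (rule solution_eq_flow)
  have "\<Phi> T (\<phi> 0) = \<phi> 0" using eq[of T] T(2) by simp
  from melnikov_along_flow[OF \<phi>(2) T(1) this] obtain n :: nat where "n > 0"
    "integral {0..T} (\<lambda>t. g (\<Phi> t (\<phi> 0), 0) / s (\<Phi> t (\<phi> 0)) * snd (\<Phi> t (\<phi> 0)))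
      = real n * melnikov k V0 f g s H h" .
  then show ?thesis using that by (simp add: eq[symmetric])
qed

end

section \<open>The perturbed return map\<close>

lemma dist_section:
  fixes x0 y0 y \<epsilon> :: real
  shows "dist ((x0, y0), 0) ((x0, y), \<epsilon>) \<le> \<bar>y - y0\<bar> + \<bar>\<epsilon>\<bar>"
  using norm_Pair_le[of "(0, y0 - y)" "- \<epsilon>"] by (simp add: dist_norm norm_Pair abs_minus_commute)

text \<open>The third coordinate is \<epsilon>, frozen by the last component 0 of the field. One
  Lipschitz flow thus handles all small \<epsilon> together.\<close>

locale perturbed_oval = oval + lipschitz_flow "\<lambda>z. ((snd (fst z), F z), 0)" L \<Phi>
  for F :: "(real \<times> real) \<times> real \<Rightarrow> real" and L :: real
    and \<Phi> :: "real \<Rightarrow> (real \<times> real) \<times> real \<Rightarrow> (real \<times> real) \<times> real" +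
  fixes r e :: real
  assumes r_pos: "r > 0" and tube_subset: "{p. infdist p C \<le> r} \<subseteq> V0"
    and e_pos: "e > 0" and e_subset: "{-e..e} \<subseteq> I"
    and F_eq: "\<And>p \<epsilon>. infdist p C \<le> r \<Longrightarrow> \<bar>\<epsilon>\<bar> \<le> e \<Longrightarrow> F (p, \<epsilon>) = k + f p + \<epsilon> * g (p, \<epsilon>)"
begin

definition "tube = {p. infdist p C \<le> r} \<times> {-e..e}"

text \<open>Along a perturbed orbit the derivative of \<open>H\<close> is \<epsilon> times
  \<open>w\<close>. At \<epsilon> = 0 this is the integrand of \<open>M\<close> with dx replaced by
  y dt.\<close>

definition "w z = g z / s (fst z) * snd (fst z)" for z :: "(real \<times> real) \<times> real"

text \<open>The integral of \<open>w\<close> over a return time \<tau>, rescaled to the fixed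
  interval from 0 to 1, so that it depends continuously on z even when \<tau> varies with z. With
  the first return time it is the \<open>D\<close> of the overview.\<close>

definition "displacement \<tau> z = integral {0..1} (\<lambda>u. \<tau> * w (\<Phi> (\<tau> * u) z))"

lemma fst_flow_deriv':
  "((\<lambda>t. fst (\<Phi> t z)) has_vector_derivative (snd (fst (\<Phi> t z)), F (\<Phi> t z))) (at t)"
  using bounded_linear.has_vector_derivative[OF bounded_linear_fst flow_deriv[of z t]] by simp

lemma snd_flow: "snd (\<Phi> t z) = snd z"
proof -
  have "((\<lambda>t. snd (\<Phi> t z)) has_real_derivative 0) (at t)" for t
    using bounded_linear.has_vector_derivative[OF bounded_linear_snd flow_deriv[of z t]]
    by (simp add: has_real_derivative_iff_has_vector_derivative)
  then show ?thesis using DERIV_isconst_all[of "\<lambda>t. snd (\<Phi> t z)" t 0] by simp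
qed

lemma tubeD:
  assumes "z \<in> tube"
  shows "fst z \<in> V0" "snd z \<in> I" "F z = k + f (fst z) + snd z * g z"
  using assms tube_subset e_subset F_eq[of "fst z" "snd z"] by (auto simp: tube_def)

lemma continuous_on_w: "continuous_on tube w"
proof -
  have "tube \<subseteq> V0 \<times> I"
    using tubeD(1,2) by (simp add: subset_iff mem_Times_iff)
  then have "continuous_on tube g"
    by (rule continuous_on_subset[OF continuous_on_g])
  moreover have "continuous_on tube (\<lambda>z. s (fst z))"
    by (rule continuous_on_compose2[OF continuous_on_s continuous_on_fst[OF continuous_on_id]])
      (use tubeD(1) in blast)
  moreover have "s (fst z) \<noteq> 0" if "z \<in> tube" for z
    using s_pos[OF tubeD(1)[OF that]] by simp
  ultimately show ?thesis unfolding w_def[abs_def] by (intro continuous_intros) simp_all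
qed

lemma perturbed_field_deriv:
  assumes "\<Phi> t z \<in> tube"
  shows "((\<lambda>t. fst (\<Phi> t z)) has_vector_derivative
    (snd (fst (\<Phi> t z)), k + f (fst (\<Phi> t z)) + snd z * g (\<Phi> t z))) (at t)"
  using fst_flow_deriv'[of z t] tubeD(3)[OF assms] by (simp add: snd_flow)

lemma energy_deriv:
  assumes "\<Phi> t z \<in> tube"
  shows "((\<lambda>t. H (fst (\<Phi> t z))) has_real_derivative snd z * w (\<Phi> t z)) (at t)"
proof -
  have "s (fst (\<Phi> t z)) > 0" using s_pos tubeD(1)[OF assms] .
  with H_along[OF perturbed_field_deriv[OF assms] tubeD(1)[OF assms]] show ?thesis
    by (simp add: w_def algebra_simps)
qed

lemma energy_displacement:
  assumes "\<tau> \<ge> 0" and tube: "\<And>t. t \<in> {0..\<tau>} \<Longrightarrow> \<Phi> t z \<in> tube"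
  shows "H (fst (\<Phi> \<tau> z)) - H (fst z) = snd z * displacement \<tau> z"
proof -
  have "((\<lambda>u. snd z * (\<tau> * w (\<Phi> (\<tau> * u) z))) has_integral
      H (fst (\<Phi> (\<tau> * 1) z)) - H (fst (\<Phi> (\<tau> * 0) z))) {0..1}"
  proof (rule fundamental_theorem_of_calculus)
    fix u :: real assume u: "u \<in> {0..1}"
    have "((\<lambda>u. \<tau> * u) has_real_derivative \<tau>) (at u)"
      by (auto intro!: derivative_eq_intros)
    moreover have "\<Phi> (\<tau> * u) z \<in> tube"
      using u assms(1) by (intro tube) (auto simp: mult_left_le)
    ultimately have "((\<lambda>u. H (fst (\<Phi> (\<tau> * u) z))) has_real_derivative snd z * w (\<Phi> (\<tau> * u) z) * \<tau>) (at u)"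
      by (intro DERIV_chain2[OF energy_deriv])
    then show "((\<lambda>u. H (fst (\<Phi> (\<tau> * u) z))) has_vector_derivative
        snd z * (\<tau> * w (\<Phi> (\<tau> * u) z))) (at u within {0..1})"
      unfolding has_real_derivative_iff_has_vector_derivative
      by (simp add: mult_ac has_vector_derivative_at_within)
  qed simp
  from integral_unique[OF this] show ?thesis
    by (simp add: displacement_def)
qed

lemma periodic_in_tube:
  assumes "\<tau> > 0" "\<Phi> \<tau> z = z" and tube: "\<And>t. t \<in> {0..\<tau>} \<Longrightarrow> \<Phi> t z \<in> tube"
  shows "\<Phi> t z \<in> tube"
proof -
  obtain t' where "0 \<le> t'" "t' < \<tau>" "\<Phi> t z = \<Phi> t' z"
    using flow_periodic_reduce[OF assms(2,1), of t] by metis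
  then show ?thesis using tube[of t'] by simp
qed

text \<open>For \<epsilon> = 0 the orbit stays on the oval through its starting point, whose level
  usually differs from \<open>h\<close>; the facts about ovals are therefore used at the level of z.
  The return need not be known to be the first one on that oval, hence the factor n.\<close>

lemma unperturbed_displacement:
  assumes \<tau>: "\<tau> > 0" "\<Phi> \<tau> z = z" and tube: "\<And>t. t \<in> {0..\<tau>} \<Longrightarrow> \<Phi> t z \<in> tube"
    and z: "snd z = 0" "H (fst z) > 0" "closed_oval_around (xc, 0) (level_set V0 H (H (fst z)))"
  obtains n :: nat where "n > 0" "displacement \<tau> z = real n * melnikov k V0 f g s H (H (fst z))"
proof -
  interpret z: oval V0 k xc f s H I g "H (fst z)"
    using z by unfold_locales
  have in_tube: "\<Phi> t z \<in> tube" for t using periodic_in_tube[OF \<tau> tube] .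
  define \<phi> where "\<phi> t = fst (\<Phi> t z)" for t
  have \<phi>: "\<Phi> t z = (\<phi> t, 0)" for t
    using snd_flow[of t z] z(1) by (simp add: \<phi>_def prod_eq_iff)
  have d: "(\<phi> has_vector_derivative field (\<phi> t)) (at t)" for t
    using perturbed_field_deriv[OF in_tube, of t] z(1) by (simp add: \<phi>_def[abs_def] field_def)
  have "((\<lambda>t. H (\<phi> t)) has_real_derivative 0) (at t)" for t
    using energy_deriv[OF in_tube, of t] z(1) by (simp add: \<phi>_def)
  then have "H (\<phi> t) = H (\<phi> 0)" for t using DERIV_isconst_all by blast
  then have C: "\<phi> t \<in> level_set V0 H (H (fst z))" for t
    using tubeD(1)[OF in_tube, of t] by (simp add: level_set_def \<phi>_def)
  have "\<phi> \<tau> = \<phi> 0" using \<tau>(2) by (simp add: \<phi>_def)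
  from z.melnikov_along_solution[OF d C \<tau>(1) this] obtain n :: nat where n: "n > 0"
    "integral {0..\<tau>} (\<lambda>t. g (\<phi> t, 0) / s (\<phi> t) * snd (\<phi> t)) = real n * melnikov k V0 f g s H (H (fst z))" .
  have weq: "g (\<phi> t, 0) / s (\<phi> t) * snd (\<phi> t) = w (\<Phi> t z)" for t
    by (simp add: w_def \<phi>)
  have "continuous_on UNIV (\<lambda>t. w (\<Phi> t z))"
    by (intro continuous_on_compose2[OF continuous_on_w] continuous_intros) (use in_tube in auto)
  then obtain A where A: "\<And>t. (A has_real_derivative w (\<Phi> t z)) (at t)"
    using continuous_antiderivative unfolding has_real_derivative_iff_has_vector_derivative by blast
  have "((\<lambda>t. w (\<Phi> t z)) has_integral A \<tau> - A 0) {0..\<tau>}"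
    using \<tau>(1) by (intro fundamental_theorem_of_calculus)
      (auto intro!: has_vector_derivative_at_within[OF A[unfolded has_real_derivative_iff_has_vector_derivative]])
  moreover have "((\<lambda>u. \<tau> * w (\<Phi> (\<tau> * u) z)) has_integral A (\<tau> * 1) - A (\<tau> * 0)) {0..1}"
  proof (rule fundamental_theorem_of_calculus)
    fix u :: real
    have "((\<lambda>u. \<tau> * u) has_real_derivative \<tau>) (at u)"
      by (auto intro!: derivative_eq_intros)
    from DERIV_chain2[OF A this]
    show "((\<lambda>u. A (\<tau> * u)) has_vector_derivative \<tau> * w (\<Phi> (\<tau> * u) z)) (at u within {0..1})"
      unfolding has_real_derivative_iff_has_vector_derivative
      by (simp add: mult_ac has_vector_derivative_at_within)
  qed simp
  ultimately have "displacement \<tau> z = integral {0..\<tau>} (\<lambda>t. w (\<Phi> t z))"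
    unfolding displacement_def by (metis integral_unique mult_1_right mult_zero_right)
  then show ?thesis using that n[unfolded weq] by simp
qed

lemma displacement_continuous:
  assumes \<tau>: "continuous_on U \<tau>" "\<And>z. z \<in> U \<Longrightarrow> \<tau> z \<ge> 0"
    and tube: "\<And>z t. z \<in> U \<Longrightarrow> t \<in> {0..\<tau> z} \<Longrightarrow> \<Phi> t z \<in> tube"
  shows "continuous_on U (\<lambda>z. displacement (\<tau> z) z)"
proof -
  have c: "continuous_on (U \<times> cbox 0 1) (\<lambda>q. \<tau> (fst q))"
    by (intro continuous_on_compose2[OF \<tau>(1)] continuous_intros) auto
  have "continuous_on (U \<times> cbox 0 1) (\<lambda>q. \<tau> (fst q) * w (\<Phi> (\<tau> (fst q) * snd q) (fst q)))"
  proof (intro continuous_intros c continuous_on_compose2[OF continuous_on_w])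
    show "(\<lambda>q. \<Phi> (\<tau> (fst q) * snd q) (fst q)) ` (U \<times> cbox 0 1) \<subseteq> tube"
      using \<tau>(2) by (auto intro!: tube simp: mult_left_le)
  qed
  then have "continuous_on (U \<times> cbox 0 1) (\<lambda>(z, u). \<tau> z * w (\<Phi> (\<tau> z * u) z))"
    by (simp add: case_prod_unfold)
  from integral_continuous_on_param[OF this] show ?thesis
    by (simp add: displacement_def)
qed

text \<open>The section is a vertical segment in the upper half-plane, crossed with x' > 0. The last
  clause is what makes energy sufficient to detect closed orbits: start and return both lie on the
  line x = x0, where \<open>H\<close> is injective, so equal values of \<open>H\<close> mean equal
  points.\<close>

lemma return_section:
  obtains x0 y0 \<beta> \<tau> where "\<beta> > 0" "\<beta> \<le> e" "(x0, y0) \<in> V0" "H (x0, y0) = h"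
    "\<And>y. \<bar>y - y0\<bar> < \<beta> \<Longrightarrow> y > 0 \<and> (x0, y) \<in> V0"
    "\<And>y y'. \<bar>y - y0\<bar> < \<beta> \<Longrightarrow> \<bar>y' - y0\<bar> < \<beta> \<Longrightarrow> y < y' \<Longrightarrow> H (x0, y) < H (x0, y')"
    "continuous_on (ball ((x0, y0), 0) (2 * \<beta>)) \<tau>"
    "\<And>z. z \<in> ball ((x0, y0), 0) (2 * \<beta>) \<Longrightarrow> \<tau> z > 0"
    "\<And>z t. z \<in> ball ((x0, y0), 0) (2 * \<beta>) \<Longrightarrow> \<bar>snd z\<bar> \<le> e \<Longrightarrow> t \<in> {0..\<tau> z} \<Longrightarrow> \<Phi> t z \<in> tube"
    "\<And>y \<epsilon>. \<bar>y - y0\<bar> < \<beta> \<Longrightarrow> \<bar>\<epsilon>\<bar> < \<beta> \<Longrightarrow>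
        H (fst (\<Phi> (\<tau> ((x0, y), \<epsilon>)) ((x0, y), \<epsilon>))) = H (x0, y) \<Longrightarrow>
        \<Phi> (\<tau> ((x0, y), \<epsilon>)) ((x0, y), \<epsilon>) = ((x0, y), \<epsilon>)"
proof -
  obtain \<phi> T where \<phi>: "\<And>t. (\<phi> has_vector_derivative field (\<phi> t)) (at t)" "\<And>t. \<phi> t \<in> C"
    and T: "T > 0" "\<And>t. \<phi> (t + T) = \<phi> t" and pos: "snd (\<phi> 0) > 0"
    using periodic_solution by blast
  obtain x0 y0 where xy: "\<phi> 0 = (x0, y0)" by fastforce
  have y0: "y0 > 0" using pos by (simp add: xy)
  have xyV: "(x0, y0) \<in> V0" "H (x0, y0) = h" using \<phi>(2)[of 0] by (auto simp: xy C_iff)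
  define z0 where "z0 = ((x0, y0), 0 :: real)"
  have \<Phi>z0: "\<Phi> t z0 = (\<phi> t, 0)" for t
  proof -
    have "((\<lambda>t. (\<phi> t, 0)) has_vector_derivative ((snd (fst (\<phi> t, 0)), F (\<phi> t, 0)), 0)) (at t)" for t
    proof -
      have "F (\<phi> t, 0) = k + f (\<phi> t)"
        using F_eq[of "\<phi> t" 0] \<phi>(2)[of t] r_pos e_pos by simp
      then show ?thesis
        using has_vector_derivative_Pair[OF \<phi>(1)[of t] has_vector_derivative_const[of 0]]
        by (simp add: field_def)
    qed
    from solution_eq_flow[OF this] show ?thesis by (simp add: z0_def xy)
  qed
  obtain \<rho> where \<rho>: "\<rho> > 0" "\<And>y. \<bar>y - y0\<bar> < \<rho> \<Longrightarrow> (x0, y) \<in> V0 \<and> y0 * y > 0"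
    "\<And>y y'. \<bar>y - y0\<bar> < \<rho> \<Longrightarrow> \<bar>y' - y0\<bar> < \<rho> \<Longrightarrow> y < y' \<Longrightarrow> y0 * (H (x0, y') - H (x0, y)) > 0"
    using H_vertical_mono[OF xyV(1)] y0 by (metis less_irrefl)
  have mono: "H (x0, y) < H (x0, y')" if "\<bar>y - y0\<bar> < \<rho>" "\<bar>y' - y0\<bar> < \<rho>" "y < y'" for y y'
    using \<rho>(3)[OF that] y0 by (simp add: zero_less_mult_iff)
  have "open {q. dist (\<Phi> (fst q) (snd q)) z0 < \<rho>}"
    by (intro open_Collect_less continuous_intros)
  moreover have "\<Phi> T z0 = z0" using T(2)[of 0] by (simp add: \<Phi>z0) (simp add: z0_def xy)
  then have "(T, z0) \<in> {q. dist (\<Phi> (fst q) (snd q)) z0 < \<rho>}" using \<rho>(1) by simp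
  ultimately obtain A B where "open A" "open B" "(T, z0) \<in> A \<times> B"
    and "A \<times> B \<subseteq> {q. dist (\<Phi> (fst q) (snd q)) z0 < \<rho>}"
    by (rule open_prod_elim)
  then have AB: "open A" "open B" "T \<in> A" "z0 \<in> B"
    "\<And>t z. t \<in> A \<Longrightarrow> z \<in> B \<Longrightarrow> dist (\<Phi> t z) z0 < \<rho>"
    by auto
  obtain \<eta> where \<eta>: "\<eta> > 0" "ball T \<eta> \<subseteq> A" using openE[OF AB(1,3)] by blast
  obtain \<delta>1 where \<delta>1: "\<delta>1 > 0" "ball z0 \<delta>1 \<subseteq> B" using openE[OF AB(2,4)] by blast
  have cont: "continuous_on UNIV (\<lambda>(t, z). fst (fst (\<Phi> t z)))" "continuous_on UNIV (\<lambda>(t, z). snd (fst (\<Phi> t z)))"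
    unfolding case_prod_unfold by (intro continuous_intros)+
  have der: "((\<lambda>t. fst (fst (\<Phi> t z))) has_real_derivative snd (fst (\<Phi> t z))) (at t)" for t z
    using bounded_linear.has_vector_derivative[OF bounded_linear_fst fst_flow_deriv'[of z t]]
    by (simp add: has_real_derivative_iff_has_vector_derivative)
  \<comment> \<open>The tolerance T / 2 keeps the return time positive and below 2 T; the tolerance
    \<eta> keeps the point of return within \<rho> of the base point, where \<open>H\<close> is
    monotone on the section.\<close>
  have T_val: "snd (fst (\<Phi> T z0)) \<noteq> 0" "fst (fst (\<Phi> T z0)) = x0" "min \<eta> (T / 2) > 0"
    using \<open>\<Phi> T z0 = z0\<close> y0 \<eta>(1) T(1) by (simp_all add: z0_def)
  obtain \<delta>2 \<tau> where \<delta>2: "\<delta>2 > 0" and \<tau>: "continuous_on (ball z0 \<delta>2) \<tau>"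
    "\<And>z. z \<in> ball z0 \<delta>2 \<Longrightarrow> \<bar>\<tau> z - T\<bar> < min \<eta> (T / 2) \<and> fst (fst (\<Phi> (\<tau> z) z)) = x0"
    using crossing_time[OF der cont T_val] by blast
  \<comment> \<open>By time 2 T the flow stretches distances at most by this exponential, so orbits
    starting within \<delta>3 stay r-close to the unperturbed orbit until they return.\<close>
  define \<delta>3 where "\<delta>3 = r / exp (L * (2 * T))"
  have \<delta>3: "\<delta>3 > 0" using r_pos by (simp add: \<delta>3_def)
  \<comment> \<open>The halves occur because a point with both y - y0 and \<epsilon> smaller than
    \<beta> in absolute value lies in the ball of radius 2 \<beta>.\<close>
  define \<beta> where "\<beta> = Min {\<rho>, e, \<delta>1 / 2, \<delta>2 / 2, \<delta>3 / 2}"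
  have \<beta>: "\<beta> > 0" "\<beta> \<le> \<rho>" "\<beta> \<le> e" "2 * \<beta> \<le> \<delta>1" "2 * \<beta> \<le> \<delta>2" "2 * \<beta> \<le> \<delta>3"
    using \<rho>(1) e_pos \<delta>1(1) \<delta>2 \<delta>3 by (auto simp: \<beta>_def min_def)
  have sub: "z \<in> ball z0 \<delta>1" "z \<in> ball z0 \<delta>2" "z \<in> ball z0 \<delta>3" if "z \<in> ball z0 (2 * \<beta>)" for z
    using that \<beta> by auto
  have \<tau>_pos: "\<tau> z > 0" "\<tau> z \<le> 2 * T" if "z \<in> ball z0 (2 * \<beta>)" for z
  proof -
    have "\<bar>\<tau> z - T\<bar> < T / 2" using \<tau>(2)[OF sub(2)[OF that]] by simp
    then show "\<tau> z > 0" "\<tau> z \<le> 2 * T" by linarith+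
  qed
  have in_tube: "\<Phi> t z \<in> tube" if z: "z \<in> ball z0 (2 * \<beta>)" "\<bar>snd z\<bar> \<le> e" and t: "t \<in> {0..\<tau> z}" for z t
  proof -
    have "dist (\<Phi> t z) (\<Phi> t z0) \<le> exp (L * \<bar>t\<bar>) * dist z z0" by (rule dist_flow)
    also have "\<dots> \<le> exp (L * (2 * T)) * dist z z0"
      using t \<tau>_pos[OF z(1)] L_nonneg by (intro mult_right_mono) (auto intro!: mult_left_mono)
    also have "\<dots> \<le> r"
      using sub(3)[OF z(1)] by (simp add: \<delta>3_def field_simps dist_commute)
    finally have "dist (fst (\<Phi> t z)) (\<phi> t) \<le> r"
      using dist_fst_le[of "\<Phi> t z" "\<Phi> t z0"] by (simp add: \<Phi>z0)
    then have "infdist (fst (\<Phi> t z)) C \<le> r"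
      using infdist_le2[OF \<phi>(2)] by blast
    then show ?thesis using z(2) snd_flow[of t z] by (auto simp: tube_def mem_Times_iff abs_le_iff)
  qed
  show ?thesis
  proof (rule that[of \<beta> x0 y0 \<tau>, folded z0_def])
    show "\<beta> > 0" "\<beta> \<le> e" "(x0, y0) \<in> V0" "H (x0, y0) = h" using \<beta> xyV by auto
    show "y > 0 \<and> (x0, y) \<in> V0" if "\<bar>y - y0\<bar> < \<beta>" for y
      using \<rho>(2)[of y] that \<beta>(2) y0 by (auto simp: zero_less_mult_iff)
    show "H (x0, y) < H (x0, y')" if "\<bar>y - y0\<bar> < \<beta>" "\<bar>y' - y0\<bar> < \<beta>" "y < y'" for y y'
      using mono[of y y'] that \<beta>(2) by simp
    show "continuous_on (ball z0 (2 * \<beta>)) \<tau>"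
      using \<beta>(5) by (intro continuous_on_subset[OF \<tau>(1)]) auto
    show "\<tau> z > 0" if "z \<in> ball z0 (2 * \<beta>)" for z using \<tau>_pos(1)[OF that] .
    show "\<Phi> t z \<in> tube" if "z \<in> ball z0 (2 * \<beta>)" "\<bar>snd z\<bar> \<le> e" "t \<in> {0..\<tau> z}" for z t
      using in_tube that .
    show "\<Phi> (\<tau> ((x0, y), \<epsilon>)) ((x0, y), \<epsilon>) = ((x0, y), \<epsilon>)"
      if y: "\<bar>y - y0\<bar> < \<beta>" and \<epsilon>: "\<bar>\<epsilon>\<bar> < \<beta>"
        and eq: "H (fst (\<Phi> (\<tau> ((x0, y), \<epsilon>)) ((x0, y), \<epsilon>))) = H (x0, y)" for y \<epsilon>
    proof -
      define z where "z = ((x0, y), \<epsilon>)"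
      have z: "z \<in> ball z0 (2 * \<beta>)"
        using dist_section[of x0 y0 y \<epsilon>] y \<epsilon> by (simp add: z_def z0_def)
      define p where "p = fst (\<Phi> (\<tau> z) z)"
      have "\<tau> z \<in> A" using \<tau>(2)[OF sub(2)[OF z]] \<eta>(2) by (auto simp: dist_real_def abs_minus_commute)
      then have "dist (\<Phi> (\<tau> z) z) z0 < \<rho>"
        using AB(5) sub(1)[OF z] \<delta>1(2) by blast
      then have "dist (snd p) y0 < \<rho>"
        using dist_fst_le[of "\<Phi> (\<tau> z) z" z0] dist_snd_le[of p "(x0, y0)"] by (simp add: p_def z0_def)
      then have P: "\<bar>snd p - y0\<bar> < \<rho>" by (simp add: dist_real_def)
      have fp: "fst p = x0" using \<tau>(2)[OF sub(2)[OF z]] by (simp add: p_def)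
      have "H p = H (x0, y)" using eq by (simp add: p_def z_def)
      then have "H (x0, snd p) = H (x0, y)" using fp by (metis prod.collapse)
      then have "snd p = y"
        using mono[OF P, of y] mono[OF _ P, of y] y \<beta>(2) by (cases "snd p" y rule: linorder_cases) auto
      then have "p = (x0, y)" using fp by (simp add: prod_eq_iff)
      then show ?thesis
        using snd_flow[of "\<tau> z" z] unfolding p_def z_def[symmetric] by (simp add: prod_eq_iff z_def)
    qed
  qed
qed

end

section \<open>Sign change of the displacement and closed orbits for small \<epsilon>\<close>

lemma simple_zero_sign_change:
  assumes "simple_zero M a"
  obtains d where "d > 0" "\<And>x y. a - d < x \<Longrightarrow> x < a \<Longrightarrow> a < y \<Longrightarrow> y < a + d \<Longrightarrow> M x * M y < 0"
proof -
  obtain D where D: "M a = 0" "D \<noteq> 0" "(M has_real_derivative D) (at a)"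
    using assms by (auto simp: simple_zero_def)
  have *: thesis if D: "M a = 0" "(M has_real_derivative D) (at a)" "D > 0"
    and that: "\<And>d. d > 0 \<Longrightarrow> (\<And>x y. a - d < x \<Longrightarrow> x < a \<Longrightarrow> a < y \<Longrightarrow> y < a + d \<Longrightarrow> M x * M y < 0) \<Longrightarrow> thesis"
    for M :: "real \<Rightarrow> real" and D thesis
  proof -
    obtain d1 where d1: "d1 > 0" "\<And>x. x > 0 \<Longrightarrow> x < d1 \<Longrightarrow> M a < M (a + x)"
      using DERIV_pos_inc_right[OF D(2,3)] by blast
    obtain d2 where d2: "d2 > 0" "\<And>x. x > 0 \<Longrightarrow> x < d2 \<Longrightarrow> M (a - x) < M a"
      using DERIV_pos_inc_left[OF D(2,3)] by blast
    show ?thesis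
    proof (rule that[of "min d1 d2"])
      show "min d1 d2 > 0" using d1 d2 by simp
      show "M x * M y < 0" if "a - min d1 d2 < x" "x < a" "a < y" "y < a + min d1 d2" for x y
        using d1(2)[of "y - a"] d2(2)[of "a - x"] that D(1) by (simp add: mult_neg_pos)
    qed
  qed
  show ?thesis
  proof (cases "D > 0")
    case True
    then show ?thesis using *[OF D(1,3)] that by blast
  next
    case False
    then show ?thesis
      using *[of "\<lambda>x. - M x" "- D"] D DERIV_minus[OF D(3)] that by auto
  qed
qed

context perturbed_oval
begin

text \<open>The bound \<open>h1\<close> leaves room for neighbouring levels that are ovals too,
  where \<open>D\<close> at \<epsilon> = 0 is known through \<open>M\<close>. Two heights
  \<open>ym\<close> and \<open>yp\<close> on either side of \<open>y0\<close> are fixed before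
  \<epsilon>, so only the signs at these two points have to persist; the root between them may
  depend on \<epsilon> in any way.\<close>

lemma perturbed_periodic_orbit:
  assumes "h < h1" and ovals: "\<forall>h'. 0 < h' \<and> h' < h1 \<longrightarrow> closed_oval_around (xc, 0) (level_set V0 H h')"
    and zero: "simple_zero (melnikov k V0 f g s H) h"
  shows "\<forall>\<^sub>F \<epsilon> in nhds 0. \<exists>\<phi> T. T > 0 \<and> (\<forall>t. \<phi> (t + T) = \<phi> t) \<and> snd (\<phi> 0) \<noteq> 0 \<and>
    (\<forall>t. (\<phi> has_vector_derivative (snd (\<phi> t), k + f (\<phi> t) + \<epsilon> * g (\<phi> t, \<epsilon>))) (at t)) \<and>
    (\<forall>t. infdist (\<phi> t) C \<le> r)"
proof -
  obtain x0 y0 \<beta> \<tau> where \<beta>: "\<beta> > 0" "\<beta> \<le> e" and xy: "(x0, y0) \<in> V0" "H (x0, y0) = h"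
    and pos: "\<And>y. \<bar>y - y0\<bar> < \<beta> \<Longrightarrow> y > 0 \<and> (x0, y) \<in> V0"
    and mono: "\<And>y y'. \<bar>y - y0\<bar> < \<beta> \<Longrightarrow> \<bar>y' - y0\<bar> < \<beta> \<Longrightarrow> y < y' \<Longrightarrow> H (x0, y) < H (x0, y')"
    and \<tau>: "continuous_on (ball ((x0, y0), 0) (2 * \<beta>)) \<tau>"
      "\<And>z. z \<in> ball ((x0, y0), 0) (2 * \<beta>) \<Longrightarrow> \<tau> z > 0"
    and tube: "\<And>z t. z \<in> ball ((x0, y0), 0) (2 * \<beta>) \<Longrightarrow> \<bar>snd z\<bar> \<le> e \<Longrightarrow> t \<in> {0..\<tau> z} \<Longrightarrow> \<Phi> t z \<in> tube"
    and return: "\<And>y \<epsilon>. \<bar>y - y0\<bar> < \<beta> \<Longrightarrow> \<bar>\<epsilon>\<bar> < \<beta> \<Longrightarrow>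
        H (fst (\<Phi> (\<tau> ((x0, y), \<epsilon>)) ((x0, y), \<epsilon>))) = H (x0, y) \<Longrightarrow>
        \<Phi> (\<tau> ((x0, y), \<epsilon>)) ((x0, y), \<epsilon>) = ((x0, y), \<epsilon>)"
    by (rule return_section) blast
  define z where "z y \<epsilon> = ((x0, y), \<epsilon>)" for y \<epsilon> :: real
  define D where "D y \<epsilon> = displacement (\<tau> (z y \<epsilon>)) (z y \<epsilon>)" for y \<epsilon>
  \<comment> \<open>The ball alone may contain points with third coordinate beyond \<open>e\<close>,
    where the tube gives no control.\<close>
  define U where "U = ball ((x0, y0), 0 :: real) (2 * \<beta>) \<inter> {z. \<bar>snd z\<bar> \<le> e}"
  have zU: "z y \<epsilon> \<in> U" if "\<bar>y - y0\<bar> < \<beta>" "\<bar>\<epsilon>\<bar> < \<beta>" for y \<epsilon>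
    using dist_section[of x0 y0 y \<epsilon>] that \<beta> by (simp add: U_def z_def)
  have \<tau>U: "\<tau> z > 0" "\<And>t. t \<in> {0..\<tau> z} \<Longrightarrow> \<Phi> t z \<in> tube" if "z \<in> U" for z
    using \<tau>(2) tube that by (auto simp: U_def)
  have cD: "continuous_on U (\<lambda>z. displacement (\<tau> z) z)"
    by (rule displacement_continuous)
      (use \<tau>U in \<open>auto simp: less_imp_le U_def intro: continuous_on_subset[OF \<tau>(1)]\<close>)
  have energy_z: "H (fst (\<Phi> (\<tau> (z y \<epsilon>)) (z y \<epsilon>))) - H (x0, y) = \<epsilon> * D y \<epsilon>"
    if "\<bar>y - y0\<bar> < \<beta>" "\<bar>\<epsilon>\<bar> < \<beta>" for y \<epsilon>
    using energy_displacement[of "\<tau> (z y \<epsilon>)" "z y \<epsilon>"] \<tau>U[OF zU[OF that]]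
    by (simp add: D_def) (simp add: z_def)
  have D0: "\<exists>n::nat. n > 0 \<and> D y 0 = real n * melnikov k V0 f g s H (H (x0, y))"
    if y: "\<bar>y - y0\<bar> < \<beta>" and h': "0 < H (x0, y)" "H (x0, y) < h1" for y
  proof -
    \<comment> \<open>At \<epsilon> = 0 energy is conserved, so every point of the section returns
      to itself.\<close>
    have "\<Phi> (\<tau> (z y 0)) (z y 0) = z y 0"
      using return[OF y, of 0] energy_z[OF y, of 0] \<beta> by (simp add: z_def)
    moreover have "z y 0 \<in> U" using zU[OF y] \<beta>(1) by simp
    moreover have "closed_oval_around (xc, 0) (level_set V0 H (H (fst (z y 0))))"
      using ovals h' by (simp add: z_def)
    moreover have "snd (z y 0) = 0" "H (fst (z y 0)) > 0" using h' by (simp_all add: z_def)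
    ultimately obtain n :: nat where "n > 0"
      "displacement (\<tau> (z y 0)) (z y 0) = real n * melnikov k V0 f g s H (H (fst (z y 0)))"
      using unperturbed_displacement[of "\<tau> (z y 0)" "z y 0"] \<tau>U by blast
    then show ?thesis unfolding D_def by (intro exI[of _ n]) (simp add: z_def)
  qed
  obtain d where d: "d > 0" "\<And>x y. h - d < x \<Longrightarrow> x < h \<Longrightarrow> h < y \<Longrightarrow> y < h + d \<Longrightarrow>
      melnikov k V0 f g s H x * melnikov k V0 f g s H y < 0"
    using simple_zero_sign_change[OF zero] by blast
  \<comment> \<open>Levels within d' of \<open>h\<close> are positive, stay below \<open>h1\<close>
    and lie in the range of the sign change.\<close>
  define d' where "d' = Min {d, h, h1 - h}"
  have d': "d' > 0" "d' \<le> d" "d' \<le> h" "d' \<le> h1 - h"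
    using d(1) h_pos \<open>h < h1\<close> by (auto simp: d'_def)
  have "isCont (\<lambda>y. H (x0, y)) y0"
    using energy xy(1) DERIV_isCont unfolding property_B_ii_def by blast
  then obtain b where b: "b > 0" "\<And>y. \<bar>y - y0\<bar> < b \<Longrightarrow> \<bar>H (x0, y) - h\<bar> < d'"
    unfolding continuous_at_eps_delta using d'(1) xy(2) by (auto simp: dist_real_def)
  define \<beta>' where "\<beta>' = min \<beta> b / 2"
  have \<beta>': "\<beta>' > 0" "\<beta>' < \<beta>" "\<beta>' < b" using \<beta>(1) b(1) by (auto simp: \<beta>'_def min_def)
  define ym yp where "ym = y0 - \<beta>'" and "yp = y0 + \<beta>'"
  have ym: "\<bar>ym - y0\<bar> < \<beta>" "H (x0, ym) < h" "\<bar>H (x0, ym) - h\<bar> < d'"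
    and yp: "\<bar>yp - y0\<bar> < \<beta>" "h < H (x0, yp)" "\<bar>H (x0, yp) - h\<bar> < d'"
    using \<beta>' \<beta>(1) mono[of ym y0] mono[of y0 yp] xy(2) b(2)[of ym] b(2)[of yp]
    by (auto simp: ym_def yp_def)
  have "D ym 0 * D yp 0 < 0"
  proof -
    \<comment> \<open>The two multiplicities may differ; their product is positive, so the sign of
      the product is that of the two values of \<open>M\<close>.\<close>
    obtain n1 n2 :: nat where n: "n1 > 0" "D ym 0 = real n1 * melnikov k V0 f g s H (H (x0, ym))"
      "n2 > 0" "D yp 0 = real n2 * melnikov k V0 f g s H (H (x0, yp))"
      using D0[OF ym(1)] D0[OF yp(1)] ym yp d' by (auto simp: abs_less_iff)
    have "melnikov k V0 f g s H (H (x0, ym)) * melnikov k V0 f g s H (H (x0, yp)) < 0"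
      using ym yp d' by (intro d(2)) (auto simp: abs_less_iff)
    moreover have "real n1 * real n2 > 0" using n by simp
    ultimately have "(real n1 * real n2) *
        (melnikov k V0 f g s H (H (x0, ym)) * melnikov k V0 f g s H (H (x0, yp))) < 0"
      by (rule mult_pos_neg[rotated])
    then show ?thesis by (simp add: n mult_ac)
  qed
  moreover have cD\<epsilon>: "isCont (D y) 0" if "\<bar>y - y0\<bar> < \<beta>" for y
  proof -
    have "continuous_on {-\<beta><..<\<beta>} (\<lambda>\<epsilon>. z y \<epsilon>)" unfolding z_def by (intro continuous_intros)
    then have "continuous_on {-\<beta><..<\<beta>} (D y)"
      unfolding D_def[abs_def] by (rule continuous_on_compose2[OF cD]) (use zU[OF that] in auto)
    then show ?thesis
      using \<beta>(1) by (simp add: continuous_on_eq_continuous_at)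
  qed
  have "isCont (\<lambda>\<epsilon>. D ym \<epsilon> * D yp \<epsilon>) 0"
    by (intro continuous_intros cD\<epsilon> ym(1) yp(1))
  ultimately have "\<forall>\<^sub>F \<epsilon> in nhds 0. D ym \<epsilon> * D yp \<epsilon> < 0"
    unfolding isCont_def
    by (auto simp: eventually_nhds_conv_at dest: order_tendstoD(2))
  moreover have "\<forall>\<^sub>F \<epsilon> in nhds 0. \<epsilon> \<in> {-\<beta><..<\<beta>}"
    using \<beta>(1) by (intro eventually_nhds_in_open) auto
  ultimately show ?thesis
  proof eventually_elim
    case (elim \<epsilon>)
    then have \<epsilon>: "\<bar>\<epsilon>\<bar> < \<beta>" by auto
    have near: "\<bar>y - y0\<bar> < \<beta>" if "y \<in> {ym..yp}" for y
      using that ym(1) yp(1) by auto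
    have "continuous_on {ym..yp} (\<lambda>y. z y \<epsilon>)" unfolding z_def by (intro continuous_intros)
    then have "continuous_on {ym..yp} (\<lambda>y. D y \<epsilon>)"
      unfolding D_def by (rule continuous_on_compose2[OF cD]) (use zU near \<epsilon> in blast)
    moreover have "ym \<le> yp" using \<beta>'(1) by (simp add: ym_def yp_def)
    moreover have "(D ym \<epsilon> \<le> 0 \<and> 0 \<le> D yp \<epsilon>) \<or> (D yp \<epsilon> \<le> 0 \<and> 0 \<le> D ym \<epsilon>)"
      using elim(1) by (auto simp: mult_less_0_iff)
    ultimately obtain y where y: "y \<in> {ym..yp}" "D y \<epsilon> = 0"
      using IVT'[of "\<lambda>y. D y \<epsilon>" ym 0 yp] IVT2'[of "\<lambda>y. D y \<epsilon>" yp 0 ym] by auto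
    define T where "T = \<tau> (z y \<epsilon>)"
    have T: "T > 0" "\<Phi> T (z y \<epsilon>) = z y \<epsilon>"
      using \<tau>U(1)[OF zU[OF near[OF y(1)] \<epsilon>]] return[OF near[OF y(1)] \<epsilon>] energy_z[OF near[OF y(1)] \<epsilon>] y(2)
      by (auto simp: T_def z_def)
    have in_tube: "\<Phi> t (z y \<epsilon>) \<in> tube" for t
      using periodic_in_tube[OF T] \<tau>U(2)[OF zU[OF near[OF y(1)] \<epsilon>]] by (simp add: T_def)
    have eq: "\<Phi> t (z y \<epsilon>) = (fst (\<Phi> t (z y \<epsilon>)), \<epsilon>)" for t
      using snd_flow[of t "z y \<epsilon>"] by (simp add: z_def prod_eq_iff)
    show ?case
    proof (intro exI[of _ "\<lambda>t. fst (\<Phi> t (z y \<epsilon>))"] exI[of _ T] conjI allI)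
      show "T > 0" by (rule T)
      show "fst (\<Phi> (t + T) (z y \<epsilon>)) = fst (\<Phi> t (z y \<epsilon>))" for t
        using flow_periodic(1)[OF T(2)] by simp
      show "snd (fst (\<Phi> 0 (z y \<epsilon>))) \<noteq> 0" using pos[OF near[OF y(1)]] by (simp add: z_def)
      show "((\<lambda>t. fst (\<Phi> t (z y \<epsilon>))) has_vector_derivative
          (snd (fst (\<Phi> t (z y \<epsilon>))), k + f (fst (\<Phi> t (z y \<epsilon>))) + \<epsilon> * g (fst (\<Phi> t (z y \<epsilon>)), \<epsilon>))) (at t)" for t
        using perturbed_field_deriv[OF in_tube, of t] eq[of t, symmetric] by (simp add: z_def)
      show "infdist (fst (\<Phi> t (z y \<epsilon>))) C \<le> r" for t
        using in_tube[of t] by (auto simp: tube_def)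
    qed
  qed
qed

end

context oval
begin

text \<open>The bound \<eta> makes the tube as thin as desired, which later yields convergence of
  the perturbed phase curves to the oval.\<close>

lemma perturbed_oval_exists:
  assumes "\<eta> > 0"
  obtains F L \<Phi> r e where "perturbed_oval V0 k xc f s H I g h F L \<Phi> r e" "r \<le> \<eta>"
proof -
  obtain r' where r': "r' > 0" "{p. infdist p C \<le> r'} \<subseteq> V0"
    using compact_neighbourhood_in_open[OF C_topology(1) open_V0 C_subset C_topology(3)] by blast
  define r where "r = min r' \<eta>"
  have r: "r > 0" "{p. infdist p C \<le> r} \<subseteq> V0" "r \<le> \<eta>" using r' assms by (auto simp: r_def)
  have cK: "compact {p. infdist p C \<le> r}"
    by (rule compact_infdist_le[OF C_topology(3,1) r(1)])
  obtain e where e: "e > 0" "cball 0 e \<subseteq> I"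
    using open_I zero_I open_contains_cball by blast
  then have eI: "{-e..e} \<subseteq> I" by (auto simp: subset_iff dist_real_def)
  have o: "open (V0 \<times> I)" by (intro open_Times open_V0 open_I)
  have "Ck_on 1 (\<lambda>z. f (fst z)) (V0 \<times> I)"
  proof (rule Ck_on_compose[OF o f_C1])
    show "Ck_on 1 (\<lambda>x. fst x \<bullet> b) (V0 \<times> I)" for b :: "real \<times> real"
      by (intro Ck_on_bounded_linear[OF o] bounded_linear_compose[OF bounded_linear_inner_left bounded_linear_fst])
  qed auto
  then have "Ck_on 1 (\<lambda>z. k + f (fst z)) (V0 \<times> I)"
    by (rule Ck_on_add[OF o Ck_on_const])
  then have "Ck_on 1 (\<lambda>z. k + f (fst z) + snd z * g z) (V0 \<times> I)"
    by (rule Ck_on_add[OF o]) (intro Ck_on_mult[OF o] g_C1 Ck_on_bounded_linear[OF o] bounded_linear_snd)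
  moreover have "compact ({p. infdist p C \<le> r} \<times> {-e..e})" by (intro compact_Times cK) auto
  ultimately obtain L where "L-lipschitz_on ({p. infdist p C \<le> r} \<times> {-e..e}) (\<lambda>z. k + f (fst z) + snd z * g z)"
    using Ck_on_1_lipschitz_on_compact[OF _ o] Sigma_mono[OF r(2) eI] by blast
  then obtain F where F: "L-lipschitz_on UNIV F"
    "\<And>z. z \<in> {p. infdist p C \<le> r} \<times> {-e..e} \<Longrightarrow> F z = k + f (fst z) + snd z * g z"
    using lipschitz_extension_real by blast
  have "1-lipschitz_on UNIV (\<lambda>z::(real \<times> real) \<times> real. snd (fst z))"
    by (intro lipschitz_onI) (auto intro: order_trans[OF dist_snd_le dist_fst_le])
  from lipschitz_on_Pair[OF lipschitz_on_Pair[OF this F(1)] lipschitz_on_constant[of UNIV "0::real"]]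
  obtain L' where "L'-lipschitz_on UNIV (\<lambda>z. ((snd (fst z), F z), 0::real))" by blast
  then obtain \<Phi> where \<Phi>: "lipschitz_flow (\<lambda>z. ((snd (fst z), F z), 0)) L' \<Phi>"
    using lipschitz_flow_exists by blast
  have "F (p, \<epsilon>) = k + f p + \<epsilon> * g (p, \<epsilon>)" if "infdist p C \<le> r" "\<bar>\<epsilon>\<bar> \<le> e" for p \<epsilon>
    using F(2)[of "(p, \<epsilon>)"] that by (simp add: abs_le_iff)
  then have "perturbed_oval V0 k xc f s H I g h F L' \<Phi> r e"
    using \<Phi> r e(1) eI
    by (intro perturbed_oval.intro oval_axioms perturbed_oval_axioms.intro)
  then show ?thesis using that r(3) by blast
qed

end

section \<open>Property B\<close>

text \<open>Each point of the limit set has a ball inside \<open>V \<epsilon>\<close> for all small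
  \<epsilon>, with a range of \<epsilon> that depends on the point; a finite subcover makes it
  uniform on \<open>K\<close>.\<close>

lemma open_sets_limit_compact:
  fixes V :: "real \<Rightarrow> 'a::metric_space set"
  assumes lim: "open_sets_limit V (V 0) (at 0)" and K: "compact K" "K \<subseteq> V 0"
  shows "\<forall>\<^sub>F \<epsilon> in nhds 0. K \<subseteq> V \<epsilon>"
proof -
  have "V 0 = {p. \<exists>r>0. \<forall>\<^sub>F \<epsilon> in at 0. ball p r \<subseteq> V \<epsilon>}"
    using lim unfolding open_sets_limit_def by blast
  then have "\<forall>p\<in>K. \<exists>r>0. \<forall>\<^sub>F \<epsilon> in at 0. ball p r \<subseteq> V \<epsilon>" using K(2) by blast
  then obtain r where r: "\<And>p. p \<in> K \<Longrightarrow> r p > 0 \<and> (\<forall>\<^sub>F \<epsilon> in at 0. ball p (r p) \<subseteq> V \<epsilon>)" by metis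
  have "K \<subseteq> (\<Union>p\<in>K. ball p (r p))" using r by force
  then obtain A where A: "A \<subseteq> K" "finite A" "K \<subseteq> (\<Union>p\<in>A. ball p (r p))"
    using compactE_image[OF K(1), of K "\<lambda>p. ball p (r p)"] by blast
  have "\<forall>\<^sub>F \<epsilon> in at 0. \<forall>p\<in>A. ball p (r p) \<subseteq> V \<epsilon>"
    using A r by (intro eventually_ball_finite) auto
  then have "\<forall>\<^sub>F \<epsilon> in at 0. K \<subseteq> V \<epsilon>"
    by (rule eventually_mono) (use A(3) in blast)
  then show ?thesis using K(2) by (simp add: eventually_nhds_conv_at)
qed

text \<open>The quality of the choice at \<open>\<epsilon> \<noteq> 0\<close> is within \<open>\<bar>\<epsilon>\<bar>\<close> of the best possible one.\<close>

lemma eventually_choice_nhds_0: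
  fixes R :: "real \<Rightarrow> real \<Rightarrow> 'u \<Rightarrow> bool"
  assumes ev: "\<And>r. r > 0 \<Longrightarrow> \<forall>\<^sub>F \<epsilon> in nhds 0. \<exists>u. R \<epsilon> r u"
    and mono: "\<And>\<epsilon> r r' u. R \<epsilon> r u \<Longrightarrow> r \<le> r' \<Longrightarrow> R \<epsilon> r' u"
    and zero: "\<And>r. r > 0 \<Longrightarrow> R 0 r u0"
  shows "\<exists>U. \<forall>r>0. \<forall>\<^sub>F \<epsilon> in nhds 0. R \<epsilon> r (U \<epsilon>)"
proof -
  define A where "A \<epsilon> = {r. r > 0 \<and> (\<exists>u. R \<epsilon> r u)}" for \<epsilon>
  define U where "U \<epsilon> = (if \<epsilon> = 0 then u0 else SOME u. R \<epsilon> (Inf (A \<epsilon>) + \<bar>\<epsilon>\<bar>) u)" for \<epsilon>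
  have "\<forall>\<^sub>F \<epsilon> in nhds 0. R \<epsilon> r (U \<epsilon>)" if r: "r > 0" for r
  proof -
    have "\<forall>\<^sub>F \<epsilon> in nhds (0::real). \<epsilon> \<in> ball 0 (r / 2)"
      using r by (intro eventually_nhds_in_open) auto
    moreover have "\<forall>\<^sub>F \<epsilon> in nhds 0. \<exists>u. R \<epsilon> (r / 2) u" using ev[of "r / 2"] r by simp
    ultimately show ?thesis
    proof eventually_elim
      case (elim \<epsilon>)
      show ?case
      proof (cases "\<epsilon> = 0")
        case True
        then show ?thesis using zero[OF r] by (simp add: U_def)
      next
        case False
        \<comment> \<open>Half of the tolerance bounds the infimum, the other half bounds
          \<epsilon>.\<close>
        have mem: "r / 2 \<in> A \<epsilon>" using elim(2) r by (simp add: A_def)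
        have bdd: "bdd_below (A \<epsilon>)" by (rule bdd_belowI[of _ 0]) (simp add: A_def)
        obtain r' where r': "r' \<in> A \<epsilon>" "r' < Inf (A \<epsilon>) + \<bar>\<epsilon>\<bar>"
          using cInf_lessD[of "A \<epsilon>" "Inf (A \<epsilon>) + \<bar>\<epsilon>\<bar>"] mem False by auto
        then have "\<exists>u. R \<epsilon> (Inf (A \<epsilon>) + \<bar>\<epsilon>\<bar>) u"
          using mono[of \<epsilon> r' _ "Inf (A \<epsilon>) + \<bar>\<epsilon>\<bar>"] by (auto simp: A_def)
        then have "R \<epsilon> (Inf (A \<epsilon>) + \<bar>\<epsilon>\<bar>) (U \<epsilon>)"
          using False by (simp add: U_def someI_ex)
        moreover have "Inf (A \<epsilon>) + \<bar>\<epsilon>\<bar> \<le> r"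
          using cInf_lower[OF mem bdd] elim(1) by (simp add: dist_real_def)
        ultimately show ?thesis by (rule mono)
      qed
    qed
  qed
  then show ?thesis by blast
qed

section \<open>From closed orbits to families of waves\<close>

lemma translates_deriv:
  assumes "translates U U'"
  obtains \<tau> where "\<And>s. U' s = U (s + \<tau>)" "\<And>s. deriv U' s = deriv U (s + \<tau>)"
proof -
  obtain \<tau> where \<tau>: "\<And>s. U' s = U (s + \<tau>)" using assms by (auto simp: translates_def)
  then have "U' = (\<lambda>s. U (s + \<tau>))" by (rule ext)
  then have "deriv U' s = deriv U (s + \<tau>)" for s
    by (simp add: deriv_def DERIV_shift)
  with \<tau> that show ?thesis by blast
qed

locale property_B_equation =
  fixes m l :: nat
    and \<iota> :: "'n::finite \<Rightarrow> nat \<times> nat"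
    and W :: "(real ^ 'n) set"
    and I :: "real set"
    and P :: "(real ^ 'n) \<times> real \<Rightarrow> real"
    and c k xc :: real
    and Wc :: "(real \<times> real \<times> real) set"
    and Q :: "(real \<times> real \<times> real) \<times> real \<Rightarrow> real"
    and V :: "real \<Rightarrow> (real \<times> real) set"
    and f s H :: "real \<times> real \<Rightarrow> real"
    and g :: "(real \<times> real) \<times> real \<Rightarrow> real"
    and hbar :: ereal
    and hz :: "nat \<Rightarrow> real"
  assumes m: "m > 2" and slots: "derivative_slots m \<iota>"
    and openI: "open I" and zeroI: "0 \<in> I"
    and B: "property_B m \<iota> W I P c k Wc Q V f g xc s H hbar l hz"
    and smooth: "sufficiently_smooth_surface m V f g"
begin

lemma B_i: "property_B_i I k Wc Q V f g xc"
  and B_o: "property_B_o m \<iota> W I P c Wc Q"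
  and B_ii: "property_B_ii k (V 0) f xc s H"
  and B_iii: "property_B_iii k (V 0) f g xc s H hbar l hz"
  using B by (simp_all add: property_B_def)

lemma bij_hz:
  "bij_betw hz {1..l} {h. 0 < h \<and> ereal h < hbar \<and> simple_zero (melnikov k (V 0) f g s H) h}"
  using B_iii unfolding property_B_iii_def by blast

lemma open_V: "\<epsilon> \<in> I \<Longrightarrow> open (V \<epsilon>)"
  using B_i by (simp add: property_B_i_def)

sublocale planar_oscillator "V 0" k xc f s H I g
proof
  show "open (V 0)" by (rule open_V[OF zeroI])
  show "Ck_on 1 f (V 0)" "Ck_on 1 g (V 0 \<times> I)" "{x. (x, 0) \<in> V 0 \<and> f (x, 0) + k = 0} = {xc}"
    using B_i zeroI unfolding property_B_i_def by blast+
qed (rule openI zeroI B_ii)+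

abbreviation "level h \<equiv> level_set (V 0) H h"

definition "regular \<epsilon> \<longleftrightarrow> \<epsilon> \<in> I \<and>
  {(x, y, z). (x, y) \<in> V \<epsilon> \<and> z = k + f (x, y) + \<epsilon> * g ((x, y), \<epsilon>)} \<subseteq> {(x, y, z) \<in> Wc. Q ((x, y, z), \<epsilon>) = k} \<and>
  Ck_on (m - 2) (\<lambda>p. f p + \<epsilon> * g (p, \<epsilon>)) (V \<epsilon>)"

lemma eventually_regular: "\<forall>\<^sub>F \<epsilon> in nhds 0. regular \<epsilon>"
  unfolding regular_def
  by (intro eventually_conj eventually_nhds_in_open[OF openI zeroI]
      smooth[unfolded sufficiently_smooth_surface_def]
      B_i[unfolded property_B_i_def, THEN conjunct2, THEN conjunct1])

lemma regular_0: "regular 0"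
  using eventually_nhds_x_imp_x[OF eventually_regular] .

text \<open>The second conclusion identifies the phase curve of the wave with the orbit, so that
  statements on the position of orbits become statements on (U, U').\<close>

lemma wave_of_orbit:
  assumes \<epsilon>: "regular \<epsilon>"
    and \<phi>: "\<And>t. (\<phi> has_vector_derivative (snd (\<phi> t), k + f (\<phi> t) + \<epsilon> * g (\<phi> t, \<epsilon>))) (at t)"
    and V: "\<And>t. \<phi> t \<in> V \<epsilon>"
    and T: "T > 0" "\<And>t. \<phi> (t + T) = \<phi> t" and t0: "snd (\<phi> t0) \<noteq> 0"
  shows "periodic_travelling_wave m \<iota> W P c \<epsilon> (\<lambda>t. fst (\<phi> t))" (is ?wave)
    and "(fst (\<phi> \<sigma>), deriv (\<lambda>t. fst (\<phi> t)) \<sigma>) = \<phi> \<sigma>"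
proof -
  have u: "((\<lambda>t. fst (\<phi> t)) has_real_derivative snd (\<phi> t)) (at t)"
    and v: "((\<lambda>t. snd (\<phi> t)) has_real_derivative k + f (\<phi> t) + \<epsilon> * g (\<phi> t, \<epsilon>)) (at t)" for t
    unfolding has_real_derivative_iff_has_vector_derivative
    using bounded_linear.has_vector_derivative[OF bounded_linear_fst \<phi>]
      bounded_linear.has_vector_derivative[OF bounded_linear_snd \<phi>]
    by simp_all
  show "(fst (\<phi> \<sigma>), deriv (\<lambda>t. fst (\<phi> t)) \<sigma>) = \<phi> \<sigma>"
    using DERIV_imp_deriv[OF u] by simp
  have \<epsilon>I: "\<epsilon> \<in> I" using \<epsilon> by (simp add: regular_def)
  have "Ck_on (m - 2) (\<lambda>p. f p + \<epsilon> * g (p, \<epsilon>)) (V \<epsilon>)"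
    using \<epsilon> unfolding regular_def by blast
  then have "Ck_on (m - 2) (\<lambda>p. k + (f p + \<epsilon> * g (p, \<epsilon>))) (V \<epsilon>)"
    by (rule Ck_on_add[OF open_V[OF \<epsilon>I] Ck_on_const])
  then have smooth: "Ck_on (m - 2) (\<lambda>p. k + f p + \<epsilon> * g (p, \<epsilon>)) (V \<epsilon>)"
    by (simp add: add.assoc)
  have surface: "(fst p, snd p, k + f p + \<epsilon> * g (p, \<epsilon>)) \<in> Wc \<and>
      Q ((fst p, snd p, k + f p + \<epsilon> * g (p, \<epsilon>)), \<epsilon>) = k" if "p \<in> V \<epsilon>" for p
  proof -
    have "(fst p, snd p, k + f p + \<epsilon> * g (p, \<epsilon>)) \<in>
        {(x, y, z). (x, y) \<in> V \<epsilon> \<and> z = k + f (x, y) + \<epsilon> * g ((x, y), \<epsilon>)}"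
      using that by simp
    then have "(fst p, snd p, k + f p + \<epsilon> * g (p, \<epsilon>)) \<in> {(x, y, z) \<in> Wc. Q ((x, y, z), \<epsilon>) = k}"
      using \<epsilon> unfolding regular_def by blast
    then show ?thesis by simp
  qed
  show ?wave
    by (rule periodic_travelling_waveI[OF m slots B_o \<epsilon>I surface smooth, where v="\<lambda>t. snd (\<phi> t)"])
      (use V u v T t0 in auto)
qed

lemma oval_at: "0 < h \<Longrightarrow> ereal h < hbar \<Longrightarrow> oval (V 0) k xc f s H I g h"
  using B_iii by unfold_locales (auto simp: property_B_iii_def)

lemma unperturbed_wave:
  assumes "0 < h" "ereal h < hbar"
  shows "\<exists>u. periodic_travelling_wave m \<iota> W P c 0 u \<and> (\<forall>\<sigma>. (u \<sigma>, deriv u \<sigma>) \<in> level h)"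
proof -
  interpret oval "V 0" k xc f s H I g h using oval_at[OF assms] .
  obtain \<phi> T where \<phi>: "\<And>t. (\<phi> has_vector_derivative field (\<phi> t)) (at t)" "\<And>t. \<phi> t \<in> C"
    and T: "T > 0" "\<And>t. \<phi> (t + T) = \<phi> t" "snd (\<phi> 0) > 0"
    using periodic_solution by blast
  have d: "(\<phi> has_vector_derivative (snd (\<phi> t), k + f (\<phi> t) + 0 * g (\<phi> t, 0))) (at t)" for t
    using \<phi>(1)[of t] by (simp add: field_def)
  have V: "\<phi> t \<in> V 0" for t using \<phi>(2)[of t] C_subset by blast
  have "snd (\<phi> 0) \<noteq> 0" using T(3) by simp
  note wave = wave_of_orbit[where \<phi>=\<phi>, OF regular_0 d V T(1,2) this]
  show ?thesis
    using wave \<phi>(2) by (intro exI[of _ "\<lambda>t. fst (\<phi> t)"]) simp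
qed

lemma perturbed_wave:
  assumes j: "j \<in> {1..l}" and r: "r > 0"
  shows "\<forall>\<^sub>F \<epsilon> in nhds 0. \<exists>u. periodic_travelling_wave m \<iota> W P c \<epsilon> u \<and>
    (\<forall>\<sigma>. infdist (u \<sigma>, deriv u \<sigma>) (level (hz j)) \<le> r)"
proof -
  have hz: "0 < hz j" "ereal (hz j) < hbar" "simple_zero (melnikov k (V 0) f g s H) (hz j)"
    using bij_betwE[OF bij_hz] j by blast+
  interpret oval "V 0" k xc f s H I g "hz j" using oval_at[OF hz(1,2)] .
  \<comment> \<open>A real number is needed strictly between, as \<open>hbar\<close> may be
    infinite.\<close>
  obtain h1 where h1: "hz j < h1" "ereal h1 < hbar"
    using ereal_dense2[OF hz(2)] by auto
  have ovals: "\<forall>h'. 0 < h' \<and> h' < h1 \<longrightarrow> closed_oval_around (xc, 0) (level h')"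
  proof (intro allI impI)
    fix h' assume "0 < h' \<and> h' < h1"
    then show "closed_oval_around (xc, 0) (level h')"
      using oval.oval[OF oval_at[of h']] h1(2) less_trans[of "ereal h'" "ereal h1" hbar] by simp
  qed
  obtain F L \<Phi> \<rho> e where "perturbed_oval (V 0) k xc f s H I g (hz j) F L \<Phi> \<rho> e" and \<rho>: "\<rho> \<le> r"
    using perturbed_oval_exists[OF r] .
  then interpret perturbed_oval "V 0" k xc f s H I g "hz j" F L \<Phi> \<rho> e by simp
  have "compact {p. infdist p C \<le> \<rho>}"
    by (rule compact_infdist_le[OF C_topology(3,1) r_pos])
  then have "\<forall>\<^sub>F \<epsilon> in nhds 0. {p. infdist p C \<le> \<rho>} \<subseteq> V \<epsilon>"
    using B_i tube_subset unfolding property_B_i_def by (intro open_sets_limit_compact) blast+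
  with perturbed_periodic_orbit[OF h1(1) ovals hz(3)] eventually_regular
  show ?thesis
  proof eventually_elim
    case (elim \<epsilon>)
    then obtain \<phi> T where T: "T > 0" "\<And>t. \<phi> (t + T) = \<phi> t" "snd (\<phi> 0) \<noteq> 0"
      and \<phi>: "\<And>t. (\<phi> has_vector_derivative (snd (\<phi> t), k + f (\<phi> t) + \<epsilon> * g (\<phi> t, \<epsilon>))) (at t)"
      and near: "\<And>t. infdist (\<phi> t) C \<le> \<rho>"
      by blast
    have "\<phi> t \<in> V \<epsilon>" for t using near[of t] elim(3) by blast
    note wave = wave_of_orbit[where \<phi>=\<phi>, OF elim(2) \<phi> this T]
    have "infdist (\<phi> \<sigma>) C \<le> r" for \<sigma> using near[of \<sigma>] \<rho> by linarith
    with wave show ?case by (intro exI[of _ "\<lambda>t. fst (\<phi> t)"]) simp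
  qed
qed

text \<open>A translate has the same phase curve, and different levels of \<open>H\<close> are
  disjoint.\<close>

lemma unperturbed_waves:
  "\<exists>U :: real \<Rightarrow> real \<Rightarrow> real.
    (\<forall>h>0. ereal h < hbar \<longrightarrow>
       periodic_travelling_wave m \<iota> W P c 0 (U h) \<and> (\<forall>\<sigma>. (U h \<sigma>, deriv (U h) \<sigma>) \<in> level h)) \<and>
    (\<forall>h>0. \<forall>h'>0. ereal h < hbar \<longrightarrow> ereal h' < hbar \<longrightarrow> h \<noteq> h' \<longrightarrow> \<not> translates (U h) (U h'))"
proof -
  obtain U where U: "\<And>h. 0 < h \<Longrightarrow> ereal h < hbar \<Longrightarrow>
      periodic_travelling_wave m \<iota> W P c 0 (U h) \<and> (\<forall>\<sigma>. (U h \<sigma>, deriv (U h) \<sigma>) \<in> level h)"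
    using unperturbed_wave by metis
  have "\<not> translates (U h) (U h')"
    if h: "0 < h" "ereal h < hbar" "0 < h'" "ereal h' < hbar" "h \<noteq> h'" for h h'
  proof
    assume "translates (U h) (U h')"
    then obtain \<tau> where "U h' 0 = U h (0 + \<tau>)" "deriv (U h') 0 = deriv (U h) (0 + \<tau>)"
      using translates_deriv by blast
    moreover have "(U h \<tau>, deriv (U h) \<tau>) \<in> level h" "(U h' 0, deriv (U h') 0) \<in> level h'"
      using U h by blast+
    ultimately show False using h(5) by (simp add: level_set_def)
  qed
  with U show ?thesis by blast
qed

text \<open>\<open>perturbed_wave\<close> gives, for each tolerance r, a range of \<epsilon> and
  waves that may depend on r. \<open>eventually_choice_nhds_0\<close> merges them into one family
  that meets every tolerance eventually; this yields the uniform limit, and closeness to disjoint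
  compact ovals separates the waves.\<close>

lemma perturbed_waves:
  "\<exists>U :: nat \<Rightarrow> real \<Rightarrow> real \<Rightarrow> real.
    (\<forall>\<^sub>F \<epsilon> in nhds 0.
       (\<forall>j\<in>{1..l}. periodic_travelling_wave m \<iota> W P c \<epsilon> (U j \<epsilon>)) \<and>
       (\<forall>i\<in>{1..l}. \<forall>j\<in>{1..l}. i \<noteq> j \<longrightarrow> \<not> translates (U i \<epsilon>) (U j \<epsilon>))) \<and>
    (\<forall>j\<in>{1..l}. uniform_limit UNIV
       (\<lambda>\<epsilon> \<sigma>. infdist (U j \<epsilon> \<sigma>, deriv (U j \<epsilon>) \<sigma>) (level (hz j))) (\<lambda>_. 0) (at 0))"
proof -
  define R where "R j \<epsilon> r u \<longleftrightarrow> periodic_travelling_wave m \<iota> W P c \<epsilon> u \<and>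
    (\<forall>\<sigma>. infdist (u \<sigma>, deriv u \<sigma>) (level (hz j)) \<le> r)" for j \<epsilon> r u
  have hz: "0 < hz j" "ereal (hz j) < hbar" if "j \<in> {1..l}" for j
    using bij_betwE[OF bij_hz] that by blast+
  have "\<exists>U. \<forall>r>0. \<forall>\<^sub>F \<epsilon> in nhds 0. R j \<epsilon> r (U \<epsilon>)" if j: "j \<in> {1..l}" for j
  proof -
    obtain u0 where u0: "periodic_travelling_wave m \<iota> W P c 0 u0"
      "\<And>\<sigma>. (u0 \<sigma>, deriv u0 \<sigma>) \<in> level (hz j)"
      using unperturbed_wave[OF hz[OF j]] by blast
    have 1: "\<forall>\<^sub>F \<epsilon> in nhds 0. \<exists>u. R j \<epsilon> r u" if "r > 0" for r
      unfolding R_def by (rule perturbed_wave[OF j that])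
    have 2: "R j \<epsilon> r' u" if "R j \<epsilon> r u" "r \<le> r'" for \<epsilon> r r' u
      using that unfolding R_def by (meson order_trans)
    have 3: "R j 0 r u0" if "r > 0" for r
      using u0 that by (simp add: R_def less_imp_le)
    show ?thesis
      by (rule eventually_choice_nhds_0[of "R j", OF 1 2 3])
  qed
  then obtain U where U: "\<And>j r. j \<in> {1..l} \<Longrightarrow> r > 0 \<Longrightarrow> \<forall>\<^sub>F \<epsilon> in nhds 0. R j \<epsilon> r (U j \<epsilon>)"
    by metis
  have waves: "\<forall>\<^sub>F \<epsilon> in nhds 0. \<forall>j\<in>{1..l}. periodic_travelling_wave m \<iota> W P c \<epsilon> (U j \<epsilon>)"
  proof (intro eventually_ball_finite ballI)
    fix j assume "j \<in> {1..l}"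
    from U[OF this, of 1] show "\<forall>\<^sub>F \<epsilon> in nhds 0. periodic_travelling_wave m \<iota> W P c \<epsilon> (U j \<epsilon>)"
      by (auto simp: R_def elim: eventually_mono)
  qed simp
  have distinct: "\<forall>\<^sub>F \<epsilon> in nhds 0. i \<noteq> j \<longrightarrow> \<not> translates (U i \<epsilon>) (U j \<epsilon>)"
    if ij: "i \<in> {1..l}" "j \<in> {1..l}" for i j
  proof (cases "i = j")
    case False
    interpret Ci: oval "V 0" k xc f s H I g "hz i" using oval_at[OF hz[OF ij(1)]] .
    interpret Cj: oval "V 0" k xc f s H I g "hz j" using oval_at[OF hz[OF ij(2)]] .
    have "hz i \<noteq> hz j" using bij_betw_imp_inj_on[OF bij_hz] ij False by (auto dest: inj_onD)
    then have "Ci.C \<inter> Cj.C = {}" by (auto simp: level_set_def)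
    then obtain d where d: "d > 0" "\<And>x y. x \<in> Ci.C \<Longrightarrow> y \<in> Cj.C \<Longrightarrow> d \<le> dist x y"
      using separate_compact_closed[OF Ci.C_topology(1) compact_imp_closed[OF Cj.C_topology(1)]] by blast
    \<comment> \<open>A common point of both phase curves would be within d / 3 of each oval,
      putting the ovals at distance at most 2 d / 3 < d.\<close>
    have "d / 3 > 0" using d(1) by simp
    from U[OF ij(1) this] U[OF ij(2) this] show ?thesis
    proof eventually_elim
      case (elim \<epsilon>)
      have "\<not> translates (U i \<epsilon>) (U j \<epsilon>)"
      proof
        assume "translates (U i \<epsilon>) (U j \<epsilon>)"
        then obtain \<tau> where "U j \<epsilon> 0 = U i \<epsilon> (0 + \<tau>)" "deriv (U j \<epsilon>) 0 = deriv (U i \<epsilon>) (0 + \<tau>)"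
          using translates_deriv by blast
        then obtain p where p: "infdist p Ci.C \<le> d / 3" "infdist p Cj.C \<le> d / 3"
          using elim unfolding R_def by metis
        obtain x where x: "x \<in> Ci.C" "infdist p Ci.C = dist p x"
          using infdist_attains_inf[OF compact_imp_closed[OF Ci.C_topology(1)] Ci.C_topology(3)] by blast
        obtain y where y: "y \<in> Cj.C" "infdist p Cj.C = dist p y"
          using infdist_attains_inf[OF compact_imp_closed[OF Cj.C_topology(1)] Cj.C_topology(3)] by blast
        have "dist x y \<le> dist p x + dist p y" by (rule dist_triangle3)
        then show False using d(2)[OF x(1) y(1)] d(1) p x(2) y(2) by linarith
      qed
      then show ?case by simp
    qed
  qed simp
  have "\<forall>\<^sub>F \<epsilon> in nhds 0. \<forall>i\<in>{1..l}. \<forall>j\<in>{1..l}. i \<noteq> j \<longrightarrow> \<not> translates (U i \<epsilon>) (U j \<epsilon>)"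
    using distinct by (intro eventually_ball_finite ballI) auto
  moreover have "uniform_limit UNIV
      (\<lambda>\<epsilon> \<sigma>. infdist (U j \<epsilon> \<sigma>, deriv (U j \<epsilon>) \<sigma>) (level (hz j))) (\<lambda>_. 0) (at 0)"
    if j: "j \<in> {1..l}" for j
  proof (rule uniform_limitI)
    fix e :: real assume e: "e > 0"
    then have "\<forall>\<^sub>F \<epsilon> in at 0. R j \<epsilon> (e / 2) (U j \<epsilon>)"
      using U[OF j, of "e / 2"] by (simp add: eventually_nhds_conv_at)
    then show "\<forall>\<^sub>F \<epsilon> in at 0. \<forall>\<sigma>\<in>UNIV.
        dist (infdist (U j \<epsilon> \<sigma>, deriv (U j \<epsilon>) \<sigma>) (level (hz j))) 0 < e"
    proof eventually_elim
      case (elim \<epsilon>)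
      show ?case
      proof
        fix \<sigma>
        have "infdist (U j \<epsilon> \<sigma>, deriv (U j \<epsilon>) \<sigma>) (level (hz j)) \<le> e / 2"
          using elim by (simp add: R_def)
        then show "dist (infdist (U j \<epsilon> \<sigma>, deriv (U j \<epsilon>) \<sigma>) (level (hz j))) 0 < e"
          using e infdist_nonneg[of "(U j \<epsilon> \<sigma>, deriv (U j \<epsilon>) \<sigma>)" "level (hz j)"]
          by (simp add: dist_real_def)
      qed
    qed
  qed
  ultimately show ?thesis using eventually_conj[OF waves] by blast
qed

end

theorem theorem2:
  fixes m l :: nat
    and \<iota> :: "'n::finite \<Rightarrow> nat \<times> nat"
    and W :: "(real ^ 'n) set"
    and I :: "real set"
    and P :: "(real ^ 'n) \<times> real \<Rightarrow> real"
    and c k xc :: real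
    and Wc :: "(real \<times> real \<times> real) set"
    and Q :: "(real \<times> real \<times> real) \<times> real \<Rightarrow> real"
    and V :: "real \<Rightarrow> (real \<times> real) set"
    and f s H :: "real \<times> real \<Rightarrow> real"
    and g :: "(real \<times> real) \<times> real \<Rightarrow> real"
    and hbar :: ereal
    and hz :: "nat \<Rightarrow> real"
  assumes "m > 2"
    and "derivative_slots m \<iota>"
    and "open W"
    and "open I" and "is_interval I" and "0 \<in> I"
    and "Ck_on 1 P (W \<times> I)"
    and "property_B m \<iota> W I P c k Wc Q V f g xc s H hbar l hz"
    and "sufficiently_smooth_surface m V f g"
  shows
    "(\<exists>U :: real \<Rightarrow> real \<Rightarrow> real.
        (\<forall>h>0. ereal h < hbar \<longrightarrow>
           periodic_travelling_wave m \<iota> W P c 0 (U h) \<and>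
           (\<forall>\<sigma>. (U h \<sigma>, deriv (U h) \<sigma>) \<in> level_set (V 0) H h)) \<and>
        (\<forall>h>0. \<forall>h'>0. ereal h < hbar \<longrightarrow> ereal h' < hbar \<longrightarrow> h \<noteq> h' \<longrightarrow>
           \<not> translates (U h) (U h'))) \<and>
     (\<exists>U :: nat \<Rightarrow> real \<Rightarrow> real \<Rightarrow> real.
        (\<forall>\<^sub>F \<epsilon> in nhds 0.
           (\<forall>j\<in>{1..l}. periodic_travelling_wave m \<iota> W P c \<epsilon> (U j \<epsilon>)) \<and>
           (\<forall>i\<in>{1..l}. \<forall>j\<in>{1..l}. i \<noteq> j \<longrightarrow> \<not> translates (U i \<epsilon>) (U j \<epsilon>))) \<and>
        (\<forall>j\<in>{1..l}.
           uniform_limit UNIV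
             (\<lambda>\<epsilon> \<sigma>. infdist (U j \<epsilon> \<sigma>, deriv (U j \<epsilon>) \<sigma>) (level_set (V 0) H (hz j)))
             (\<lambda>_. 0) (at 0)))"
proof -
  interpret property_B_equation m l \<iota> W I P c k xc Wc Q V f s H g hbar hz
    using assms by unfold_locales
  show ?thesis using unperturbed_waves perturbed_waves by (rule conjI)
qed

end
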